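(* The class of spherical random fields that are axially symmetric with respect to the axis passing through the pole $\mathbf{0}$ is the union of the following mutually disjoint subclasses: isotropic fields, diagonal anisotropic fields, and harmonic degree-dependent anisotropic fields. For all fields in this class, the poles corresponding to $\theta=0$ and $\theta=\pi$ are points of isotropy. A spherical random field is axially symmetric of this type if and only if its spectral coefficients satisfy $C_{\ell\ell'mm'}=\delta_m^{m'}C_{\ell\ell'm}$ for all $\ell,\ell',m,m'$ (for some numbers $C_{\ell\ell'm}$). Equivalently, its covariance function admits the spectral representation $$C((\theta_1,\varphi_1),(\theta_2,\varphi_2))=\sum_{\ell\in\mathbb{N}_0}\sum_{\ell'\in\mathbb{N}_0}\sum_{m=-\min(\ell,\ell')}^{\min(\ell,\ell')}\left(\frac{(2\ell+1)(\ell-m)!(2\ell'+1)(\ell'-m)!}{16\pi^2(\ell+m)!(\ell'+m)!}\right)^{1/2}C_{\ell\ell'm}\,e^{im(\varphi_1-\varphi_2)}P_\ell^m(\cos\theta_1)P_{\ell'}^m(\cos\theta_2).$$ Moreover, if the covariance function is differentiable, then it belongs to this axially symmetric class if and only if, for all $\theta_i,\varphi_i$, $i=1,2$, $$\frac{\partial}{\partial\varphi_1}C((\theta_1,\varphi_1),(\theta_2,\varphi_2))=-\frac{\partial}{\partial\varphi_2}C((\theta_1,\varphi_1),(\theta_2,\varphi_2)).$$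
   Context: $(\theta,\varphi)$ are colatitude and longitude on the unit sphere $\mathbb{S}^2$; $\mathbf{0}$ is the pole $\theta=0$; $\gamma$ is the great-circle distance. A spherical random field is a real-valued zero-mean second-order random field $T$ on $\mathbb{S}^2$ with continuous, not identically constant covariance function $C$. It is isotropic if $C$ depends only on $\gamma(\mathbf{x}_1,\mathbf{x}_2)$; $\mathbf{x}_0$ is a point of isotropy if $C(\mathbf{x}_0,\mathbf{x})$ depends only on $\gamma(\mathbf{x}_0,\mathbf{x})$. It is axially symmetric with respect to the axis through $\mathbf{0}$ if $C(\rho\mathbf{x}_1,\rho\mathbf{x}_2)=C(\mathbf{x}_1,\mathbf{x}_2)$ for all $\mathbf{x}_1,\mathbf{x}_2$ and every rotation $\rho$ about that axis. $Y_{\ell m}(\theta,\varphi)=e^{im\varphi}\left[\frac{(2\ell+1)(\ell-m)!}{4\pi(\ell+m)!}\right]^{1/2}P_\ell^m(\cos\theta)$, $|m|\le\ell$, are the orthonormal complex spherical harmonics, $P_\ell^m$ the associated Legendre functions with $P_\ell^{-m}=(-1)^m\frac{(\ell-m)!}{(\ell+m)!}P_\ell^m$ for $m>0$. The field is expanded as $T=\sum_{\ell,m}a_{\ell m}Y_{\ell m}$ with $a_{\ell m}=\int_{\mathbb{S}^2}T\,Y^*_{\ell m}\,d\mathbf{s}$ ($d\mathbf{s}$ surface measure), the series being taken to converge in $L_2(\Omega\times\mathbb{S}^2)$ and, at each $\mathbf{x}\in\mathbb{S}^2$, in $L_2(\Omega)$, where $\Omega$ is the underlying probability space. The spectral coefficients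 are $C_{\ell\ell'mm'}=\mathbf{E}(a_{\ell m}a^*_{\ell'm'})$, and the covariance function has the expansion $C(\mathbf{x}_1,\mathbf{x}_2)=\sum_{\ell,\ell',m,m'}C_{\ell\ell'mm'}Y_{\ell m}(\mathbf{x}_1)Y^*_{\ell'm'}(\mathbf{x}_2)$. Isotropy is equivalent to $C_{\ell\ell'mm'}=\delta_\ell^{\ell'}\delta_m^{m'}C_\ell$. Harmonic degree-dependent anisotropic: $C_{\ell\ell'mm'}=\delta_m^{m'}C_{\ell\ell'm}$ with $C_{\ell\ell'm}\ne0$ for some $\ell\neq\ell'$ and some $|m|\le\min(\ell,\ell')$. Diagonal anisotropic: $C_{\ell\ell'mm'}=\delta_\ell^{\ell'}\delta_m^{m'}C_{\ell m}$ with $C_{\ell m}\neq C_{\ell m'}$ for some $\ell$ and some $m\neq m'$ in $\{-\ell,\dots,\ell\}$. *)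

theory Defs
  imports "HOL-Probability.Probability" "HOL-Computational_Algebra.Polynomial"
begin

abbreviation \<S> :: "(real^3) set" where
  "\<S> \<equiv> sphere 0 1"

definition sph_point :: "real \<Rightarrow> real \<Rightarrow> real^3" where
  "sph_point \<theta> \<phi> = vector [sin \<theta> * cos \<phi>, sin \<theta> * sin \<phi>, cos \<theta>]"

definition north_pole :: "real^3" where
  "north_pole = sph_point 0 0"

definition south_pole :: "real^3" where
  "south_pole = sph_point pi 0"

definition colatitude :: "real^3 \<Rightarrow> real" where
  "colatitude x = arccos (x $ 3)"

text \<open>The longitude lies in \<open>(-\<pi>, \<pi>]\<close>, and it is \<open>0\<close> at the two poles, where it is arbitrary.\<close>

definition longitude :: "real^3 \<Rightarrow> real" where
  "longitude x = Arg (Complex (x $ 1) (x $ 2))"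

definition great_circle_dist :: "real^3 \<Rightarrow> real^3 \<Rightarrow> real" where
  "great_circle_dist x y = arccos (x \<bullet> y)"

text \<open>The surface measure \<open>sin \<theta> d\<theta> d\<phi>\<close>, carried over from the coordinate rectangle to the sphere.\<close>

definition sphere_measure :: "(real^3) measure" where
  "sphere_measure =
     distr (density lborel
              (\<lambda>(\<theta>, \<phi>). ennreal (sin \<theta>) * indicator ({0..pi} \<times> {0..<2 * pi}) (\<theta>, \<phi>)))
           (restrict_space borel \<S>) (\<lambda>(\<theta>, \<phi>). sph_point \<theta> \<phi>)"

text \<open>Legendre polynomials by Rodrigues' formula.\<close>

definition legendre_poly :: "nat \<Rightarrow> real poly" where
  "legendre_poly l = smult (1 / (2 ^ l * fact l)) ((pderiv ^^ l) ([:-1, 0, 1:] ^ l))"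

text \<open>Associated Legendre functions, for \<open>\<bar>m\<bar> \<le> l\<close> and \<open>\<bar>x\<bar> \<le> 1\<close>, with the Condon--Shortley
  sign \<open>(-1)^m\<close>. In products of two of these functions of the same order \<open>m\<close> the sign cancels.\<close>

definition assoc_legendre_nonneg :: "nat \<Rightarrow> nat \<Rightarrow> real \<Rightarrow> real" where
  "assoc_legendre_nonneg l m x =
     (-1) ^ m * sqrt (1 - x\<^sup>2) ^ m * poly ((pderiv ^^ m) (legendre_poly l)) x"

definition assoc_legendre :: "nat \<Rightarrow> int \<Rightarrow> real \<Rightarrow> real" where
  "assoc_legendre l m x =
     (if m \<ge> 0 then assoc_legendre_nonneg l (nat m) x
      else (-1) ^ nat (- m) * (fact (nat (int l + m)) / fact (nat (int l - m)))
             * assoc_legendre_nonneg l (nat (- m)) x)"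

definition sph_harmonic_coord :: "nat \<Rightarrow> int \<Rightarrow> real \<Rightarrow> real \<Rightarrow> complex" where
  "sph_harmonic_coord l m \<theta> \<phi> =
     exp (\<i> * of_int m * of_real \<phi>) *
     of_real (sqrt ((2 * real l + 1) * fact (nat (int l - m)) / (4 * pi * fact (nat (int l + m))))
              * assoc_legendre l m (cos \<theta>))"

definition sph_harmonic :: "nat \<Rightarrow> int \<Rightarrow> real^3 \<Rightarrow> complex" where
  "sph_harmonic l m x = sph_harmonic_coord l m (colatitude x) (longitude x)"

definition field_cov :: "'a measure \<Rightarrow> (real^3 \<Rightarrow> 'a \<Rightarrow> real) \<Rightarrow> real^3 \<Rightarrow> real^3 \<Rightarrow> real" where
  "field_cov M T x y =
     (\<integral>\<omega>. (T x \<omega> - (\<integral>\<omega>'. T x \<omega>' \<partial>M)) * (T y \<omega> - (\<integral>\<omega>'. T y \<omega>' \<partial>M)) \<partial>M)"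

definition harmonic_coeff :: "(real^3 \<Rightarrow> 'a \<Rightarrow> real) \<Rightarrow> nat \<Rightarrow> int \<Rightarrow> 'a \<Rightarrow> complex" where
  "harmonic_coeff T l m \<omega> =
     (\<integral>x. complex_of_real (T x \<omega>) * cnj (sph_harmonic l m x) \<partial>sphere_measure)"

definition spectral_coeff ::
  "'a measure \<Rightarrow> (real^3 \<Rightarrow> 'a \<Rightarrow> real) \<Rightarrow> nat \<Rightarrow> nat \<Rightarrow> int \<Rightarrow> int \<Rightarrow> complex" where
  "spectral_coeff M T l l' m m' =
     (\<integral>\<omega>. harmonic_coeff T l m \<omega> * cnj (harmonic_coeff T l' m' \<omega>) \<partial>M)"

definition harmonic_partial_sum ::
  "(real^3 \<Rightarrow> 'a \<Rightarrow> real) \<Rightarrow> nat \<Rightarrow> real^3 \<Rightarrow> 'a \<Rightarrow> complex" where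
  "harmonic_partial_sum T L x \<omega> =
     (\<Sum>l\<le>L. \<Sum>m = -int l..int l. harmonic_coeff T l m \<omega> * sph_harmonic l m x)"

text \<open>Mean-square errors are nonnegative integrals in \<open>ennreal\<close>, since a Bochner integral would be
  \<open>0\<close> for an error that is not square-integrable.\<close>

locale spherical_random_field = prob_space M
  for M :: "'a measure" and T :: "real^3 \<Rightarrow> 'a \<Rightarrow> real" +
  assumes measurable_field: "(\<lambda>(\<omega>, x). T x \<omega>) \<in> borel_measurable (M \<Otimes>\<^sub>M sphere_measure)"
    and measurable_at: "x \<in> \<S> \<Longrightarrow> T x \<in> borel_measurable M"
    and second_order: "x \<in> \<S> \<Longrightarrow> integrable M (\<lambda>\<omega>. (T x \<omega>)\<^sup>2)"
    and zero_mean: "x \<in> \<S> \<Longrightarrow> (\<integral>\<omega>. T x \<omega> \<partial>M) = 0"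
    and continuous_cov: "continuous_on (\<S> \<times> \<S>) (\<lambda>(x, y). field_cov M T x y)"
    and nonconstant_cov: "\<not> (\<exists>k. \<forall>x\<in>\<S>. \<forall>y\<in>\<S>. field_cov M T x y = k)"
    and expansion_L2:
      "(\<lambda>L. \<integral>\<^sup>+(\<omega>, x). ennreal ((norm (of_real (T x \<omega>) - harmonic_partial_sum T L x \<omega>))\<^sup>2)
              \<partial>(M \<Otimes>\<^sub>M sphere_measure)) \<longlonglongrightarrow> 0"
    and expansion_pointwise_L2:
      "x \<in> \<S> \<Longrightarrow>
       (\<lambda>L. \<integral>\<^sup>+\<omega>. ennreal ((norm (of_real (T x \<omega>) - harmonic_partial_sum T L x \<omega>))\<^sup>2) \<partial>M)
         \<longlonglongrightarrow> 0"

definition isotropic :: "'a measure \<Rightarrow> (real^3 \<Rightarrow> 'a \<Rightarrow> real) \<Rightarrow> bool" where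
  "isotropic M T \<longleftrightarrow>
     (\<exists>f. \<forall>x\<in>\<S>. \<forall>y\<in>\<S>. field_cov M T x y = f (great_circle_dist x y))"

definition point_of_isotropy ::
  "'a measure \<Rightarrow> (real^3 \<Rightarrow> 'a \<Rightarrow> real) \<Rightarrow> real^3 \<Rightarrow> bool" where
  "point_of_isotropy M T x0 \<longleftrightarrow>
     (\<exists>f. \<forall>x\<in>\<S>. field_cov M T x0 x = f (great_circle_dist x0 x))"

definition axially_symmetric :: "'a measure \<Rightarrow> (real^3 \<Rightarrow> 'a \<Rightarrow> real) \<Rightarrow> bool" where
  "axially_symmetric M T \<longleftrightarrow>
     (\<forall>R :: real^3^3. rotation_matrix R \<and> R *v north_pole = north_pole \<longrightarrow>
        (\<forall>x\<in>\<S>. \<forall>y\<in>\<S>. field_cov M T (R *v x) (R *v y) = field_cov M T x y))"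

definition order_diagonal_spectrum ::
  "'a measure \<Rightarrow> (real^3 \<Rightarrow> 'a \<Rightarrow> real) \<Rightarrow> (nat \<Rightarrow> nat \<Rightarrow> int \<Rightarrow> complex) \<Rightarrow> bool" where
  "order_diagonal_spectrum M T c \<longleftrightarrow>
     (\<forall>l l' m m'. \<bar>m\<bar> \<le> int l \<and> \<bar>m'\<bar> \<le> int l' \<longrightarrow>
        spectral_coeff M T l l' m m' = (if m = m' then c l l' m else 0))"

definition degree_dependent_anisotropic ::
  "'a measure \<Rightarrow> (real^3 \<Rightarrow> 'a \<Rightarrow> real) \<Rightarrow> bool" where
  "degree_dependent_anisotropic M T \<longleftrightarrow>
     (\<exists>c. order_diagonal_spectrum M T c \<and>
          (\<exists>l l' m. l \<noteq> l' \<and> \<bar>m\<bar> \<le> int (min l l') \<and> c l l' m \<noteq> 0))"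

definition diagonal_anisotropic :: "'a measure \<Rightarrow> (real^3 \<Rightarrow> 'a \<Rightarrow> real) \<Rightarrow> bool" where
  "diagonal_anisotropic M T \<longleftrightarrow>
     (\<exists>c :: nat \<Rightarrow> int \<Rightarrow> complex.
        (\<forall>l l' m m'. \<bar>m\<bar> \<le> int l \<and> \<bar>m'\<bar> \<le> int l' \<longrightarrow>
           spectral_coeff M T l l' m m' = (if l = l' \<and> m = m' then c l m else 0)) \<and>
        (\<exists>l m m'. m \<noteq> m' \<and> \<bar>m\<bar> \<le> int l \<and> \<bar>m'\<bar> \<le> int l \<and> c l m \<noteq> c l m'))"

definition axial_term ::
  "(nat \<Rightarrow> nat \<Rightarrow> int \<Rightarrow> complex) \<Rightarrow> real \<Rightarrow> real \<Rightarrow> real \<Rightarrow> real \<Rightarrow> nat \<Rightarrow> nat \<Rightarrow> complex" where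
  "axial_term c \<theta>1 \<phi>1 \<theta>2 \<phi>2 l l' =
     (\<Sum>m = -int (min l l')..int (min l l').
        of_real (sqrt (((2 * real l + 1) * fact (nat (int l - m)) *
                        (2 * real l' + 1) * fact (nat (int l' - m))) /
                       (16 * pi\<^sup>2 * fact (nat (int l + m)) * fact (nat (int l' + m))))) *
        c l l' m * exp (\<i> * of_int m * of_real (\<phi>1 - \<phi>2)) *
        of_real (assoc_legendre l m (cos \<theta>1) * assoc_legendre l' m (cos \<theta>2)))"

text \<open>The double series over \<open>l\<close> and \<open>l'\<close> is an iterated sum, inner over \<open>l'\<close>. All the series
  involved are required to converge.\<close>

definition axial_representation ::
  "'a measure \<Rightarrow> (real^3 \<Rightarrow> 'a \<Rightarrow> real) \<Rightarrow> (nat \<Rightarrow> nat \<Rightarrow> int \<Rightarrow> complex) \<Rightarrow> bool" where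
  "axial_representation M T c \<longleftrightarrow>
     (\<forall>\<theta>1\<in>{0..pi}. \<forall>\<phi>1. \<forall>\<theta>2\<in>{0..pi}. \<forall>\<phi>2.
        (\<forall>l. summable (axial_term c \<theta>1 \<phi>1 \<theta>2 \<phi>2 l)) \<and>
        (\<lambda>l. \<Sum>l'. axial_term c \<theta>1 \<phi>1 \<theta>2 \<phi>2 l l') sums
          complex_of_real (field_cov M T (sph_point \<theta>1 \<phi>1) (sph_point \<theta>2 \<phi>2)))"

text \<open>Differentiability in the coordinates, on the closed coordinate domain. It follows from
  differentiability on the sphere, because \<open>sph_point\<close> is smooth.\<close>

definition differentiable_cov :: "'a measure \<Rightarrow> (real^3 \<Rightarrow> 'a \<Rightarrow> real) \<Rightarrow> bool" where
  "differentiable_cov M T \<longleftrightarrow>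
     (\<lambda>((\<theta>1, \<phi>1), (\<theta>2, \<phi>2)). field_cov M T (sph_point \<theta>1 \<phi>1) (sph_point \<theta>2 \<phi>2))
       differentiable_on (({0..pi} \<times> UNIV) \<times> ({0..pi} \<times> UNIV))"

end

theory Submission
  imports Defs
begin

text \<open>Write \<open>\<Gamma>\<close> for the covariance function and \<open>w = x\<^sub>1 + i x\<^sub>2\<close>. By Fubini, the spectral coefficients are the
  coefficients of \<open>\<Gamma>\<close> with respect to products of spherical harmonics, and \<open>L\<^sub>2(\<Omega>)\<close> convergence
  at each point gives back \<open>\<Gamma>\<close> as the iterated series. A rotation by \<open>\<alpha>\<close> about the polar axis
  multiplies \<open>Y\<^sub>l\<^sub>m\<close> by \<open>exp (i m \<alpha>)\<close> and preserves the surface measure, so axial symmetry makes the spectrum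
  diagonal in the order; conversely the resulting series depends only on \<open>\<phi>\<^sub>1 - \<phi>\<^sub>2\<close>.

  The isotropic case rests on the addition theorem. On the sphere \<open>Y\<^sub>l\<^sub>m\<close> is a multiple of
  \<open>w\<^sup>m\<close> times the \<open>m\<close>-th derivative of \<open>P\<^sub>l\<close>, and the differentiated Legendre equation shows that the rotations about
  the second axis act on these functions by a ladder relation, under which the derivative of
  \<open>\<Sum>\<^sub>m Y\<^sub>l\<^sub>m(x) cnj (Y\<^sub>l\<^sub>m(y))\<close> telescopes to \<open>0\<close>. This sum is therefore a multiple of \<open>P\<^sub>l(x \<bullet> y)\<close>. Together with
  orthogonality it diagonalises every kernel \<open>p(x \<bullet> y)\<close> with \<open>p\<close> a polynomial, hence by
  Weierstrass every continuous function of \<open>x \<bullet> y\<close>.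

  In the differentiable case, the sum of the two longitude derivatives is the derivative of \<open>\<Gamma>\<close> along the
  simultaneous rotation of both arguments.\<close>

section \<open>Legendre polynomials\<close>

text \<open>The coordinates are singular where the argument needs continuity: the longitude jumps
  across a meridian and is arbitrary at the poles. For nonnegative order the factors
  \<open>exp (i m phi)\<close> and \<open>sin theta ^ m\<close> merge into \<open>w^m\<close>, so
  the harmonics are polynomials in the Cartesian coordinates; negative orders are their conjugates
  up to sign. Continuity, measurability and the action of rotations are read off from this form.

  One differential equation for the \<open>k\<close>-th derivative of \<open>P_l\<close> serves
  three times: it yields the ladder relation, the recursion between the latitude integrals of
  consecutive orders, and \<open>P_l(1) \<noteq> 0\<close>. Its coefficient
  \<open>(l + k + 1) * (l - k)\<close> is also the quotient of consecutive squared normalising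
  factors. This coincidence makes the sum over the orders telescope, and it makes the norm of a
  harmonic independent of its order, so that a rotation invariant kernel gets a single eigenvalue in
  each degree.

  The addition theorem acts in both directions: it diagonalises isotropic kernels, and it sums an
  order-independent diagonal spectrum to a function of \<open>x \<bullet> y\<close>.\<close>

abbreviation legendre_deriv :: "nat \<Rightarrow> nat \<Rightarrow> real poly" where
  "legendre_deriv l k \<equiv> (pderiv ^^ k) (legendre_poly l)"

lemma pderiv_funpow_smult: "(pderiv ^^ k) (smult c p) = smult c ((pderiv ^^ k) p)"
  by (induction k) (simp_all add: pderiv_smult)

lemma degree_pderiv_funpow: "degree ((pderiv ^^ k) p) = degree p - k" for p :: "real poly"
  by (induction k) (simp_all add: degree_pderiv)

lemma poly_ext: "(\<And>x. poly p x = poly q x) \<Longrightarrow> p = q" for p q :: "real poly"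
  by (simp add: fun_eq_iff poly_eq_poly_eq_iff[symmetric])

lemma degree_rodrigues: "degree ([:-1, 0, 1:] ^ l :: real poly) = 2 * l"
  by (subst degree_power_eq) simp_all

lemma degree_legendre_poly: "degree (legendre_poly l) = l"
  by (simp add: legendre_poly_def degree_pderiv_funpow degree_rodrigues)

lemma legendre_poly_nonzero: "legendre_poly l \<noteq> 0"
proof (cases "l = 0")
  case True
  then show ?thesis by (simp add: legendre_poly_def)
next
  case False
  then show ?thesis using degree_legendre_poly[of l] by auto
qed

lemma legendre_deriv_eq_0: "l < k \<Longrightarrow> legendre_deriv l k = 0"
proof -
  assume "l < k"
  then obtain j where k: "k = Suc (l + j)" using less_iff_Suc_add by auto
  have "degree (legendre_deriv l l) = 0"
    by (simp add: degree_pderiv_funpow degree_legendre_poly)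
  then have *: "legendre_deriv l (Suc l) = 0" by (simp add: pderiv_eq_0_iff)
  have "legendre_deriv l k = (pderiv ^^ j) (legendre_deriv l (Suc l))"
    unfolding k by (simp add: funpow_add funpow_swap1 add.commute[of l] del: funpow.simps)
      (metis add_Suc_right comp_apply funpow_add)
  also have "\<dots> = 0" unfolding * by (induction j) simp_all
  finally show ?thesis .
qed

text \<open>The power \<open>u 0 = (x^2 - 1)^l\<close> solves the first-order equation
  \<open>(x^2 - 1) u' = 2 l x u\<close>. Differentiating this once gives the case
  \<open>k = 0\<close>, and each further differentiation raises \<open>k\<close> by one.\<close>

lemma rodrigues_ode:
  fixes l k :: nat
  defines "u \<equiv> \<lambda>j. (pderiv ^^ j) ([:-1, 0, 1:] ^ l :: real poly)"
  shows "[:-1, 0, 1:] * u (k + 2) + smult (2 * (real k + 1 - real l)) ([:0, 1:] * u (k + 1))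
    + smult ((real k + 1) * (real k - 2 * real l)) (u k) = 0"
proof -
  have u: "pderiv (u j) = u (Suc j)" for j by (simp add: u_def)
  show ?thesis
  proof (induction k)
    case 0
    have 1: "[:-1, 0, 1:] * u 1 = smult (2 * real l) ([:0, 1:] * u 0)"
    proof (cases l)
      case (Suc n)
      define q where "q = ([:-1, 0, 1:] :: real poly)"
      have "pderiv q = smult 2 [:0, 1:]" by (simp add: q_def pderiv_pCons)
      then show ?thesis
        by (simp add: u_def Suc pderiv_power_Suc smult_add_left algebra_simps flip: q_def
            del: power_Suc mult_pCons_left mult_pCons_right smult_pCons)
          (simp add: algebra_simps)
    qed (simp add: u_def)
    show ?case
    proof (rule poly_ext)
      fix x
      from arg_cong[OF 1, of "\<lambda>p. poly (pderiv p) x"] 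
      show "poly ([:- 1, 0, 1:] * u (0 + 2) + smult (2 * (real 0 + 1 - real l)) ([:0, 1:] * u (0 + 1))
          + smult ((real 0 + 1) * (real 0 - 2 * real l)) (u 0)) x = poly 0 x"
        by (simp add: u pderiv_mult pderiv_smult pderiv_pCons algebra_simps numeral_2_eq_2
            del: mult_pCons_left mult_pCons_right)
    qed
  next
    case (Suc k)
    show ?case
    proof (rule poly_ext)
      fix x
      from arg_cong[OF Suc, of "\<lambda>p. poly (pderiv p) x"] 
      show "poly ([:- 1, 0, 1:] * u (Suc k + 2) + smult (2 * (real (Suc k) + 1 - real l)) ([:0, 1:] * u (Suc k + 1))
          + smult ((real (Suc k) + 1) * (real (Suc k) - 2 * real l)) (u (Suc k))) x = poly 0 x"
        by (simp add: u pderiv_mult pderiv_smult pderiv_add pderiv_pCons algebra_simps numeral_2_eq_2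
            del: mult_pCons_left mult_pCons_right)
    qed
  qed
qed

text \<open>This is \<open>rodrigues_ode\<close> at index \<open>l + k\<close>, because
  \<open>legendre_poly l\<close> is already an \<open>l\<close>-th derivative. The factor
  \<open>(l + k + 1) * (l - k)\<close> returns as the constant of the ladder relation and of the
  integration by parts.\<close>

lemma legendre_deriv_ode:
  "(1 - x\<^sup>2) * poly (legendre_deriv l (k + 2)) x - 2 * (real k + 1) * x * poly (legendre_deriv l (k + 1)) x
    + (real l + real k + 1) * (real l - real k) * poly (legendre_deriv l k) x = 0"
proof -
  define u where "u = (\<lambda>j. (pderiv ^^ j) ([:-1, 0, 1:] ^ l :: real poly))"
  define c :: real where "c = 1 / (2 ^ l * fact l)"
  have Q: "legendre_deriv l j = smult c (u (l + j))" for j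
    by (simp add: u_def c_def legendre_poly_def pderiv_funpow_smult funpow_add add.commute)
  have ode: "poly ([:-1, 0, 1:] * u (l + k + 2)
      + smult (2 * (real (l + k) + 1 - real l)) ([:0, 1:] * u (l + k + 1))
      + smult ((real (l + k) + 1) * (real (l + k) - 2 * real l)) (u (l + k))) x = 0" (is "?E = 0")
    unfolding u_def rodrigues_ode by simp
  have "(1 - x\<^sup>2) * poly (legendre_deriv l (k + 2)) x
      - 2 * (real k + 1) * x * poly (legendre_deriv l (k + 1)) x
      + (real l + real k + 1) * (real l - real k) * poly (legendre_deriv l k) x = - c * ?E"
    unfolding Q by (simp add: algebra_simps power2_eq_square)
  also note ode
  finally show ?thesis by simp
qed

text \<open>At \<open>x = 1\<close> the leading term of the differential equation drops out, and
  what remains computes each derivative at \<open>1\<close> from the previous one. A zero would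
  therefore spread to the \<open>l\<close>-th derivative, which is a nonzero constant.\<close>

lemma legendre_poly_1_nonzero: "poly (legendre_poly l) 1 \<noteq> 0"
proof
  assume *: "poly (legendre_poly l) 1 = 0"
  have "poly (legendre_deriv l k) 1 = 0" for k
  proof (induction k)
    case (Suc k)
    with legendre_deriv_ode[where x = 1 and l = l and k = k] have "2 * (real k + 1) * poly (legendre_deriv l (k + 1)) 1 = 0"
      by simp
    moreover have "real k + 1 \<noteq> 0" by linarith
    ultimately show ?case by simp
  qed (use * in simp)
  then have "poly (legendre_deriv l l) 1 = 0" .
  moreover obtain c where c: "legendre_deriv l l = [:c:]"
    by (metis degree_legendre_poly degree_pderiv_funpow degree_eq_zeroE diff_self_eq_0)
  moreover have "legendre_deriv l k \<noteq> 0" if "k \<le> l" for k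
    using that
  proof (induction k)
    case (Suc k)
    then show ?case by (simp add: pderiv_eq_0_iff degree_pderiv_funpow degree_legendre_poly)
  qed (simp add: legendre_poly_nonzero)
  ultimately show False by simp
qed

section \<open>The addition theorem\<close>

definition solid_harmonic :: "nat \<Rightarrow> nat \<Rightarrow> complex \<Rightarrow> real \<Rightarrow> complex" where
  "solid_harmonic l m w z = w ^ m * of_real (poly (legendre_deriv l m) z)"

text \<open>The sum of the addition theorem without its factor
  \<open>(2 * l + 1) / (4 * pi)\<close>: orders \<open>m\<close> and \<open>- m\<close> are paired
  into twice a real part, and the factorial quotients are what remains of the squared
  normalisation.\<close>

definition zonal_sum :: "nat \<Rightarrow> complex \<Rightarrow> real \<Rightarrow> complex \<Rightarrow> real \<Rightarrow> real" where
  "zonal_sum l w z w' z' = poly (legendre_poly l) z * poly (legendre_poly l) z' +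
     2 * (\<Sum>m<l. fact (l - Suc m) / fact (l + Suc m) *
       Re (solid_harmonic l (Suc m) w z * cnj (solid_harmonic l (Suc m) w' z')))"

lemma solid_harmonic_0: "solid_harmonic l 0 w z = of_real (poly (legendre_poly l) z)"
  by (simp add: solid_harmonic_def)

lemma solid_harmonic_eq_0: "l < m \<Longrightarrow> solid_harmonic l m w z = 0"
  by (simp add: solid_harmonic_def legendre_deriv_eq_0)

text \<open>The vector field \<open>w' = z\<close>, \<open>z' = - Re w\<close> generates the rotations about the second axis.\<close>

lemma solid_harmonic_derivative:
  fixes w :: "real \<Rightarrow> complex" and z :: "real \<Rightarrow> real"
  assumes w: "(w has_vector_derivative of_real (z s)) (at s)"
    and z: "(z has_real_derivative - Re (w s)) (at s)"
    and unit: "(cmod (w s))\<^sup>2 + (z s)\<^sup>2 = 1"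
  shows solid_harmonic_derivative_0:
      "((\<lambda>s. solid_harmonic l 0 (w s) (z s)) has_vector_derivative
          of_real (- Re (solid_harmonic l 1 (w s) (z s)))) (at s)"
    and solid_harmonic_derivative_Suc:
      "((\<lambda>s. solid_harmonic l (Suc m) (w s) (z s)) has_vector_derivative
          ((real l + real m + 1) * (real l - real m) * solid_harmonic l m (w s) (z s)
            - solid_harmonic l (m + 2) (w s) (z s)) / 2) (at s)"
proof -
  have Q: "((\<lambda>s. of_real (poly (legendre_deriv l k) (z s)) :: complex) has_vector_derivative
      of_real (poly (legendre_deriv l (Suc k)) (z s) * - Re (w s))) (at s)" for k
  proof (rule has_vector_derivative_of_real)
    show "((\<lambda>s. poly (legendre_deriv l k) (z s)) has_real_derivative
        poly (legendre_deriv l (Suc k)) (z s) * - Re (w s)) (at s)"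
      using DERIV_chain2[OF poly_DERIV z, of "legendre_deriv l k"] by simp
  qed
  show "((\<lambda>s. solid_harmonic l 0 (w s) (z s)) has_vector_derivative
      of_real (- Re (solid_harmonic l 1 (w s) (z s)))) (at s)"
    using Q[of 0] by (simp add: solid_harmonic_def mult.commute)
  have pow: "((\<lambda>s. w s ^ Suc m) has_vector_derivative of_nat (Suc m) * w s ^ m * of_real (z s)) (at s)"
  proof -
    have "((\<lambda>v::complex. v ^ Suc m) has_field_derivative of_nat (Suc m) * w s ^ m) (at (w s))"
      by (auto intro!: derivative_eq_intros simp del: power_Suc simp: mult.commute)
    from field_vector_diff_chain_at[OF w this] show ?thesis
      by (simp add: o_def mult_ac)
  qed
  have ww: "w s * cnj (w s) = of_real (1 - (z s)\<^sup>2)"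
  proof -
    have "w s * cnj (w s) = of_real ((cmod (w s))\<^sup>2)" by (rule complex_norm_square[symmetric])
    also have "(cmod (w s))\<^sup>2 = 1 - (z s)\<^sup>2" using unit by simp
    finally show ?thesis .
  qed
  \<comment> \<open>Of the two halves of \<open>Re w\<close>, the one with \<open>w\<close> raises
    the order to \<open>m + 2\<close>. The one with \<open>cnj w\<close> meets a factor
    \<open>w\<close> and produces \<open>1 - z^2\<close>, which the differential equation converts
    into order \<open>m\<close>.\<close>
  have re: "of_real (Re (w s)) = (w s + cnj (w s)) / 2"
    by (simp add: complex_add_cnj)
  define q where "q = (\<lambda>k. complex_of_real (poly (legendre_deriv l k) (z s)))"
  have ode: "(1 - (of_real (z s))\<^sup>2) * q (m + 2) = 2 * (of_nat m + 1) * of_real (z s) * q (m + 1)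
     - (of_nat l + of_nat m + 1) * (of_nat l - of_nat m) * q m"
    using arg_cong[OF legendre_deriv_ode[of "z s" m l], of complex_of_real]
    by (simp add: q_def algebra_simps)
  have "((\<lambda>s. solid_harmonic l (Suc m) (w s) (z s)) has_vector_derivative
      w s ^ Suc m * of_real (poly (legendre_deriv l (Suc (Suc m))) (z s) * - Re (w s)) +
      of_nat (Suc m) * w s ^ m * of_real (z s) * of_real (poly (legendre_deriv l (Suc m)) (z s))) (at s)"
    unfolding solid_harmonic_def by (rule has_vector_derivative_mult[OF pow Q])
  also have "w s ^ Suc m * of_real (poly (legendre_deriv l (Suc (Suc m))) (z s) * - Re (w s)) +
      of_nat (Suc m) * w s ^ m * of_real (z s) * of_real (poly (legendre_deriv l (Suc m)) (z s))
    = - (w s ^ Suc m * of_real (Re (w s))) * q (m + 2) + (of_nat m + 1) * w s ^ m * of_real (z s) * q (m + 1)"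
    by (simp add: q_def)
  also have "\<dots> = - (w s ^ (m + 2)) * q (m + 2) / 2 + w s ^ m / 2 *
      (2 * (of_nat m + 1) * of_real (z s) * q (m + 1) - (w s * cnj (w s)) * q (m + 2))"
    unfolding re by (simp add: field_simps)
  also have "\<dots> = - (w s ^ (m + 2)) * q (m + 2) / 2 + w s ^ m / 2 *
      ((of_nat l + of_nat m + 1) * (of_nat l - of_nat m) * q m)"
  proof -
    have "2 * (of_nat m + 1) * of_real (z s) * q (m + 1) - (w s * cnj (w s)) * q (m + 2)
        = (of_nat l + of_nat m + 1) * (of_nat l - of_nat m) * q m"
      unfolding ww using ode by (simp add: algebra_simps)
    then show ?thesis by simp
  qed
  also have "\<dots> = ((real l + real m + 1) * (real l - real m) * solid_harmonic l m (w s) (z s)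
      - solid_harmonic l (m + 2) (w s) (z s)) / 2"
    by (simp add: solid_harmonic_def q_def field_simps)
  finally show "((\<lambda>s. solid_harmonic l (Suc m) (w s) (z s)) has_vector_derivative
          ((real l + real m + 1) * (real l - real m) * solid_harmonic l m (w s) (z s)
            - solid_harmonic l (m + 2) (w s) (z s)) / 2) (at s)" .
qed

text \<open>The weights satisfy \<open>d (Suc m) * ((l + m + 1) * (l - m)) = d m\<close>, which
  cancels the ladder constant. So the summand of order \<open>Suc m\<close> has as derivative half
  the difference of consecutive values of \<open>a + b\<close>. The term of order \<open>0\<close>
  cancels the lower end, and the upper end vanishes because no harmonic has order above
  \<open>l\<close>.\<close>

lemma zonal_sum_has_derivative_0:
  fixes w w' :: "real \<Rightarrow> complex" and z z' :: "real \<Rightarrow> real"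
  assumes w: "(w has_vector_derivative of_real (z s)) (at s)"
    and z: "(z has_real_derivative - Re (w s)) (at s)"
    and unit: "(cmod (w s))\<^sup>2 + (z s)\<^sup>2 = 1"
    and w': "(w' has_vector_derivative of_real (z' s)) (at s)"
    and z': "(z' has_real_derivative - Re (w' s)) (at s)"
    and unit': "(cmod (w' s))\<^sup>2 + (z' s)\<^sup>2 = 1"
  shows "((\<lambda>s. zonal_sum l (w s) (z s) (w' s) (z' s)) has_real_derivative 0) (at s)"
proof -
  define U where "U = (\<lambda>m s. solid_harmonic l m (w s) (z s))"
  define V where "V = (\<lambda>m s. solid_harmonic l m (w' s) (z' s))"
  define d :: "nat \<Rightarrow> real" where "d = (\<lambda>m. fact (l - m) / fact (l + m))"
  define a where "a = (\<lambda>m. d m * Re (U m s * cnj (V (Suc m) s)))"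
  define b where "b = (\<lambda>m. d m * Re (U (Suc m) s * cnj (V m s)))"
  have U_0: "(U 0 has_vector_derivative of_real (- Re (U 1 s))) (at s)"
    and U_Suc: "(U (Suc m) has_vector_derivative
      ((real l + real m + 1) * (real l - real m) * U m s - U (m + 2) s) / 2) (at s)" for m
    using solid_harmonic_derivative[OF w z unit] by (simp_all add: U_def)
  have V_0: "(V 0 has_vector_derivative of_real (- Re (V 1 s))) (at s)"
    and V_Suc: "(V (Suc m) has_vector_derivative
      ((real l + real m + 1) * (real l - real m) * V m s - V (m + 2) s) / 2) (at s)" for m
    using solid_harmonic_derivative[OF w' z' unit'] by (simp_all add: V_def)
  have d_Suc: "d (Suc m) * ((real l + real m + 1) * (real l - real m)) = d m" if "m < l" for m
  proof -
    have 1: "(fact (l - m) :: real) = (real l - real m) * fact (l - Suc m)"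
      using that by (simp add: fact_reduce[of "l - m"] of_nat_diff)
    have 2: "(fact (l + Suc m) :: real) = (real l + real m + 1) * fact (l + m)"
      by (simp add: algebra_simps)
    have "real l + real m + 1 \<noteq> 0" by linarith
    then show ?thesis unfolding d_def 1 2 by simp
  qed
  have Re_deriv: "(f has_vector_derivative D) (at s) \<Longrightarrow> ((\<lambda>s. Re (f s)) has_real_derivative Re D) (at s)"
    for f D
    using bounded_linear.has_vector_derivative[OF bounded_linear_Re]
    by (simp add: has_real_derivative_iff_has_vector_derivative)
  have 0: "((\<lambda>s. Re (U 0 s * cnj (V 0 s))) has_real_derivative - a 0 - b 0) (at s)"
    by (rule DERIV_cong[OF Re_deriv[OF has_vector_derivative_mult[OF U_0
          bounded_linear.has_vector_derivative[OF bounded_linear_cnj V_0]]]])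
      (simp add: a_def b_def d_def U_def V_def solid_harmonic_0)
  have Suc: "((\<lambda>s. d (Suc m) * Re (U (Suc m) s * cnj (V (Suc m) s))) has_real_derivative
      (a m + b m - a (Suc m) - b (Suc m)) / 2) (at s)" if "m < l" for m
  proof -
    define c where "c = (real l + real m + 1) * (real l - real m)"
    have c: "d m = d (Suc m) * c" using d_Suc[OF that] by (simp add: c_def)
    have "((\<lambda>s. Re (U (Suc m) s * cnj (V (Suc m) s))) has_real_derivative 
       Re (U (Suc m) s * cnj ((of_real c * V m s - V (m + 2) s) / 2) +
         (of_real c * U m s - U (m + 2) s) / 2 * cnj (V (Suc m) s))) (at s)"
      using Re_deriv[OF has_vector_derivative_mult[OF U_Suc
          bounded_linear.has_vector_derivative[OF bounded_linear_cnj V_Suc]], of m m]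
      by (simp add: c_def)
    from DERIV_cmult[OF this, of "d (Suc m)"] show ?thesis
      by (rule DERIV_cong) (simp add: a_def b_def c field_simps)
  qed
  have "((\<lambda>s. Re (U 0 s * cnj (V 0 s)) + 2 * (\<Sum>m<l. d (Suc m) * Re (U (Suc m) s * cnj (V (Suc m) s))))
      has_real_derivative - a 0 - b 0 + 2 * (\<Sum>m<l. (a m + b m - a (Suc m) - b (Suc m)) / 2)) (at s)"
    by (intro DERIV_add 0 DERIV_cmult DERIV_sum Suc) auto
  also have "2 * (\<Sum>m<l. (a m + b m - a (Suc m) - b (Suc m)) / 2)
      = (\<Sum>m<l. (a m + b m) - (a (Suc m) + b (Suc m)))"
    unfolding sum_distrib_left by (rule sum.cong) (auto simp: field_simps)
  also have "\<dots> = a 0 + b 0 - (a l + b l)"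
    by (subst sum_lessThan_telescope') simp
  also have "a l + b l = 0"
    by (simp add: a_def b_def U_def V_def solid_harmonic_eq_0)
  finally show ?thesis
    by (simp add: zonal_sum_def U_def V_def d_def solid_harmonic_0)
qed

text \<open>\<open>X\<close> and \<open>Z\<close> are the explicit flow of the vector field above, a
  rotation by \<open>s\<close> in the plane of the first and third coordinates. It keeps both points
  on the sphere, so the derivative is \<open>0\<close> along the whole orbit.\<close>

lemma zonal_sum_rotate:
  fixes w w' :: complex and z z' s :: real
  assumes unit: "(cmod w)\<^sup>2 + z\<^sup>2 = 1" and unit': "(cmod w')\<^sup>2 + z'\<^sup>2 = 1"
  defines "X \<equiv> \<lambda>w z s. Complex (Re w * cos s + z * sin s) (Im w)"
    and "Z \<equiv> \<lambda>w z s. z * cos s - Re w * sin s"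
  shows "zonal_sum l (X w z s) (Z w z s) (X w' z' s) (Z w' z' s) = zonal_sum l w z w' z'"
proof -
  have X: "(X w z has_vector_derivative of_real (Z w z s)) (at s)" for w z s
    unfolding has_vector_derivative_complex_iff X_def Z_def
    by (auto intro!: derivative_eq_intros)
  have Z: "(Z w z has_real_derivative - Re (X w z s)) (at s)" for w z s
    unfolding X_def Z_def by (auto intro!: derivative_eq_intros)
  have U: "(cmod (X w z s))\<^sup>2 + (Z w z s)\<^sup>2 = 1" if "(cmod w)\<^sup>2 + z\<^sup>2 = 1" for w z s
  proof -
    \<comment> \<open>The last factor is \<open>0\<close>. With it the equation is a polynomial
      identity in which \<open>sin s\<close> and \<open>cos s\<close> are independent
      variables.\<close>
    have "(cmod (X w z s))\<^sup>2 + (Z w z s)\<^sup>2 = (cmod w)\<^sup>2 + z\<^sup>2 + ((Re w)\<^sup>2 + z\<^sup>2) * ((sin s)\<^sup>2 + (cos s)\<^sup>2 - 1)"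
      unfolding cmod_power2 X_def Z_def complex.sel by algebra
    then show ?thesis using that by simp
  qed
  have "((\<lambda>s. zonal_sum l (X w z s) (Z w z s) (X w' z' s) (Z w' z' s)) has_real_derivative 0) (at s)" for s
    by (rule zonal_sum_has_derivative_0) (intro X Z U unit unit')+
  then have "(\<lambda>s. zonal_sum l (X w z s) (Z w z s) (X w' z' s) (Z w' z' s)) s =
      (\<lambda>s. zonal_sum l (X w z s) (Z w z s) (X w' z' s) (Z w' z' s)) 0"
    by (intro DERIV_isconst_all) auto
  then show ?thesis by (simp add: X_def Z_def)
qed

lemma zonal_sum_phase:
  assumes "cmod c = 1"
  shows "zonal_sum l (c * w) z (c * w') z' = zonal_sum l w z w' z'"
proof -
  have "c ^ n * cnj c ^ n = 1" for n
    using assms by (metis complex_norm_square of_real_1 power_mult_distrib power_one)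
  then have "solid_harmonic l n (c * w) z * cnj (solid_harmonic l n (c * w') z') =
      solid_harmonic l n w z * cnj (solid_harmonic l n w' z')" for n
    by (simp add: solid_harmonic_def power_mult_distrib mult_ac)
  then show ?thesis by (simp add: zonal_sum_def)
qed

text \<open>A rotation about the polar axis followed by one about the second axis takes \<open>(w, z)\<close> to the
  north pole, where only the term of order \<open>0\<close> survives.\<close>

theorem legendre_addition:
  assumes unit: "(cmod w)\<^sup>2 + z\<^sup>2 = 1" and unit': "(cmod w')\<^sup>2 + z'\<^sup>2 = 1"
  shows "zonal_sum l w z w' z' = poly (legendre_poly l) 1 * poly (legendre_poly l) (z * z' + Re (w' * cnj w))"
proof -
  obtain t where t: "z = cos t" "cmod w = sin t"
    using sincos_total_pi[of "cmod w" z] unit by (auto simp: add.commute)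
  define c where "c = cis (- Arg w)"
  define v where "v = c * w'"
  have w: "w = cmod w * cis (Arg w)"
    using rcis_cmod_Arg[of w] by (simp add: rcis_def)
  have cw: "c * w = of_real (sin t)"
    by (subst w) (simp add: c_def t cis_mult mult.left_commute)
  have c: "cmod c = 1" by (simp add: c_def)
  have re: "Re (w' * cnj w) = sin t * Re v"
    by (subst w) (simp add: v_def c_def t cis_cnj algebra_simps)
  have "zonal_sum l w z w' z' = zonal_sum l (of_real (sin t)) (cos t) v z'"
    using zonal_sum_phase[OF c, of l w z w' z'] by (simp add: cw v_def t)
  \<comment> \<open>The angle \<open>- t\<close> takes \<open>(sin t, cos t)\<close> to
    \<open>(0, 1)\<close>. The second point then has height
    \<open>z' * cos t + Re v * sin t\<close>, which is the inner product of the two original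
    points.\<close>
  also have "\<dots> = zonal_sum l 0 1 (Complex (Re v * cos t - z' * sin t) (Im v)) (z' * cos t + Re v * sin t)"
  proof -
    have "(cmod (complex_of_real (sin t)))\<^sup>2 + (cos t)\<^sup>2 = 1" by simp
    moreover have "(cmod v)\<^sup>2 + z'\<^sup>2 = 1" using unit' c by (simp add: v_def norm_mult)
    moreover have "Complex (sin t * cos t - cos t * sin t) 0 = 0" by (simp add: complex_eq_iff)
    moreover have "cos t * cos t + sin t * sin t = 1" 
      using sin_cos_squared_add[of t] by (simp add: power2_eq_square)
    ultimately show ?thesis
      using zonal_sum_rotate[of "of_real (sin t)" "cos t" v z' l "- t"] by simp
  qed
  also have "\<dots> = poly (legendre_poly l) 1 * poly (legendre_poly l) (z' * cos t + Re v * sin t)"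
    by (simp add: zonal_sum_def solid_harmonic_def)
  finally show ?thesis unfolding re t(1) by (simp only: mult.commute)
qed

section \<open>Spherical harmonics in Cartesian coordinates and their addition theorem\<close>

definition equatorial :: "real^3 \<Rightarrow> complex" where
  "equatorial x = Complex (x $ 1) (x $ 2)"

definition harmonic_norm :: "nat \<Rightarrow> nat \<Rightarrow> real" where
  "harmonic_norm l m = sqrt ((2 * real l + 1) * fact (l - m) / (4 * pi * fact (l + m)))"

text \<open>A polynomial in the coordinates of \<open>x\<close>, hence continuous also at the poles
  and across the meridian where \<open>longitude\<close> jumps. The sign is the Condon-Shortley sign
  of \<open>assoc_legendre\<close>.\<close>

definition cartesian_harmonic :: "nat \<Rightarrow> nat \<Rightarrow> real^3 \<Rightarrow> complex" where
  "cartesian_harmonic l m x =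
     of_real ((-1) ^ m * harmonic_norm l m) * solid_harmonic l m (equatorial x) (x $ 3)"

lemma inner_sphere: "x \<bullet> y = x $ 3 * y $ 3 + Re (equatorial y * cnj (equatorial x))"
  for x y :: "real^3"
  by (simp add: inner_vec_def sum_3 equatorial_def)

lemma equatorial_sphere: "x \<in> \<S> \<Longrightarrow> (cmod (equatorial x))\<^sup>2 + (x $ 3)\<^sup>2 = 1"
  unfolding equatorial_def cmod_power2 complex.sel
  by (simp add: norm_eq_1 inner_vec_def sum_3 power2_eq_square)

lemma sph_point_simps [simp]:
  "sph_point \<theta> \<phi> $ 3 = cos \<theta>" "equatorial (sph_point \<theta> \<phi>) = of_real (sin \<theta>) * cis \<phi>"
  by (simp_all add: sph_point_def equatorial_def complex_eq_iff)

lemma real3_eq_iff: "x = y \<longleftrightarrow> equatorial x = equatorial y \<and> x $ 3 = y $ 3" for x y :: "real^3"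
  by (simp add: vec_eq_iff forall_3 equatorial_def)

lemma sph_point_in_sphere [simp]: "sph_point \<theta> \<phi> \<in> \<S>"
proof -
  have "sph_point \<theta> \<phi> \<bullet> sph_point \<theta> \<phi> = (cos \<theta>)\<^sup>2 + (sin \<theta>)\<^sup>2 * ((cos \<phi>)\<^sup>2 + (sin \<phi>)\<^sup>2)"
    unfolding inner_sphere sph_point_simps
    by (simp add: power2_eq_square algebra_simps
        del: sin_cos_squared_add sin_cos_squared_add2 sin_cos_squared_add3)
  also have "\<dots> = 1" by simp
  finally show ?thesis by (simp add: norm_eq_1)
qed

lemma sph_point_colatitude_longitude:
  assumes "x \<in> \<S>"
  shows "sph_point (colatitude x) (longitude x) = x"
proof -
  have x3: "\<bar>x $ 3\<bar> \<le> 1" using component_le_norm_cart[of x 3] assms by simp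
  then have z: "cos (colatitude x) = x $ 3" by (simp add: colatitude_def cos_arccos_abs)
  have "sin (colatitude x) = sqrt (1 - (x $ 3)\<^sup>2)"
    using x3 by (simp add: colatitude_def sin_arccos_abs)
  also have "1 - (x $ 3)\<^sup>2 = (cmod (equatorial x))\<^sup>2" using equatorial_sphere[OF assms] by simp
  finally have "sin (colatitude x) = cmod (equatorial x)" by simp
  then show ?thesis
    using rcis_cmod_Arg[of "equatorial x"] z 
    by (simp add: real3_eq_iff rcis_def longitude_def flip: equatorial_def)
qed

lemma colatitude_bounds: "x \<in> \<S> \<Longrightarrow> colatitude x \<in> {0..pi}"
  using component_le_norm_cart[of x 3] by (auto simp: colatitude_def intro!: arccos_lbound arccos_ubound)

lemma sphere_coordinates:
  assumes "x \<in> \<S>"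
  obtains \<theta> \<phi> where "\<theta> \<in> {0..pi}" "x = sph_point \<theta> \<phi>"
  using sph_point_colatitude_longitude[OF assms] colatitude_bounds[OF assms] by metis

lemma sph_harmonic_coord_nonneg:
  assumes "\<theta> \<in> {0..pi}"
  shows "sph_harmonic_coord l (int m) \<theta> \<phi> = cartesian_harmonic l m (sph_point \<theta> \<phi>)"
proof -
  have "sin \<theta> \<ge> 0" using assms by (simp add: sin_ge_zero)
  then have "sqrt (1 - (cos \<theta>)\<^sup>2) = sin \<theta>" by (simp add: sin_squared_eq[symmetric])
  moreover have "nat (int l - int m) = l - m" "nat (int l + int m) = l + m" by simp_all
  moreover have "exp (\<i> * of_int (int m) * of_real \<phi>) = cis \<phi> ^ m"
    by (simp add: cis_conv_exp exp_of_nat_mult[symmetric] mult_ac)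
  ultimately show ?thesis
    by (simp add: sph_harmonic_coord_def cartesian_harmonic_def solid_harmonic_def assoc_legendre_def
        assoc_legendre_nonneg_def harmonic_norm_def power_mult_distrib)
qed

text \<open>The factorial quotient in \<open>assoc_legendre\<close> turns the normalising root of
  order \<open>- m\<close> into that of order \<open>m\<close>. The sign in front survives because
  the Cartesian harmonic contains one factor \<open>(-1) ^ m\<close> of its own.\<close>

lemma sph_harmonic_coord_neg:
  assumes "\<theta> \<in> {0..pi}" "0 < m" "m \<le> l"
  shows "sph_harmonic_coord l (- int m) \<theta> \<phi> = (-1) ^ m * cnj (cartesian_harmonic l m (sph_point \<theta> \<phi>))"
proof -
  have "sin \<theta> \<ge> 0" using assms by (simp add: sin_ge_zero)
  then have s: "sqrt (1 - (cos \<theta>)\<^sup>2) = sin \<theta>" by (simp add: sin_squared_eq[symmetric])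
  have n: "nat (int l - int m) = l - m" "nat (int l + int m) = l + m" by simp_all
  have e: "exp (\<i> * of_int (- int m) * of_real \<phi>) = cnj (cis \<phi>) ^ m"
  proof -
    have "cnj (cis \<phi>) = exp (- (\<i> * of_real \<phi>))" by (simp add: cis_cnj) (simp add: cis_conv_exp)
    then show ?thesis by (simp add: exp_of_nat_mult[symmetric] mult_ac)
  qed
  have "sqrt ((2 * real l + 1) * fact (l + m) / (4 * pi * fact (l - m))) * (fact (l - m) / fact (l + m))
      = sqrt ((2 * real l + 1) * fact (l + m) / (4 * pi * fact (l - m)) * (fact (l - m) / fact (l + m))\<^sup>2)"
    unfolding real_sqrt_mult[of _ "(fact (l - m) / fact (l + m))\<^sup>2"] by simp
  also have "(2 * real l + 1) * fact (l + m) / (4 * pi * fact (l - m)) * (fact (l - m) / fact (l + m))\<^sup>2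
      = (2 * real l + 1) * fact (l - m) / (4 * pi * fact (l + m))"
    by (simp add: power2_eq_square)
  finally have h: "sqrt ((2 * real l + 1) * fact (l + m) / (4 * pi * fact (l - m))) * (fact (l - m) / fact (l + m))
     = harmonic_norm l m" by (simp add: harmonic_norm_def)
  have "sph_harmonic_coord l (- int m) \<theta> \<phi> = cnj (cis \<phi>) ^ m *
     of_real ((sqrt ((2 * real l + 1) * fact (l + m) / (4 * pi * fact (l - m))) * (fact (l - m) / fact (l + m)))
       * ((-1) ^ m * ((-1) ^ m * sin \<theta> ^ m * poly (legendre_deriv l m) (cos \<theta>))))"
    using \<open>0 < m\<close> unfolding sph_harmonic_coord_def e
    by (simp add: n s assoc_legendre_def assoc_legendre_nonneg_def)
  also have "\<dots> = (-1) ^ m * cnj (cartesian_harmonic l m (sph_point \<theta> \<phi>))"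
    unfolding h by (simp add: cartesian_harmonic_def solid_harmonic_def power_mult_distrib)
  finally show ?thesis .
qed

text \<open>The coordinates recovered from the point can differ from the given ones, by a multiple
  of \<open>2 * pi\<close> in the longitude or arbitrarily at a pole. Both sides are expressed
  through the Cartesian harmonic at the same point.\<close>

lemma sph_harmonic_sph_point:
  assumes "\<theta> \<in> {0..pi}" "\<bar>m\<bar> \<le> int l"
  shows "sph_harmonic l m (sph_point \<theta> \<phi>) = sph_harmonic_coord l m \<theta> \<phi>"
proof -
  let ?x = "sph_point \<theta> \<phi>"
  have x: "sph_point (colatitude ?x) (longitude ?x) = ?x"
    by (rule sph_point_colatitude_longitude[OF sph_point_in_sphere])
  have c: "colatitude ?x \<in> {0..pi}" by (rule colatitude_bounds[OF sph_point_in_sphere])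
  show ?thesis
  proof (cases "m \<ge> 0")
    case True
    then obtain n where "m = int n" by (metis nonneg_int_cases)
    then show ?thesis
      unfolding sph_harmonic_def using sph_harmonic_coord_nonneg[OF c] sph_harmonic_coord_nonneg[OF assms(1)] x
      by simp
  next
    case False
    then obtain n where "m = - int n" "0 < n" "n \<le> l"
      using assms(2) by (intro that[of "nat (- m)"]) auto
    then show ?thesis
      unfolding sph_harmonic_def using sph_harmonic_coord_neg[OF c] sph_harmonic_coord_neg[OF assms(1)] x
      by simp
  qed
qed

lemma sph_harmonic_nonneg:
  assumes "x \<in> \<S>"
  shows "sph_harmonic l (int m) x = cartesian_harmonic l m x"
  using sph_harmonic_coord_nonneg[OF colatitude_bounds[OF assms]] sph_point_colatitude_longitude[OF assms]
  by (simp add: sph_harmonic_def)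

lemma sph_harmonic_neg:
  assumes "x \<in> \<S>" "m \<le> l"
  shows "sph_harmonic l (- int m) x = (-1) ^ m * cnj (cartesian_harmonic l m x)"
proof (cases "m = 0")
  case True
  then show ?thesis
    using sph_harmonic_nonneg[OF assms(1), of l 0] by (simp add: cartesian_harmonic_def solid_harmonic_def)
next
  case False
  then show ?thesis
    using sph_harmonic_coord_neg[OF colatitude_bounds[OF assms(1)] _ assms(2)]
      sph_point_colatitude_longitude[OF assms(1)] by (simp add: sph_harmonic_def)
qed

lemma sph_harmonic_cases:
  assumes "\<bar>m\<bar> \<le> int l"
  obtains n where "n \<le> l" "m = int n" "\<And>x. x \<in> \<S> \<Longrightarrow> sph_harmonic l m x = cartesian_harmonic l n x"
  | n where "n \<le> l" "m = - int n" "\<And>x. x \<in> \<S> \<Longrightarrow> sph_harmonic l m x = (-1) ^ n * cnj (cartesian_harmonic l n x)"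
proof (cases "m \<ge> 0")
  case True
  then show ?thesis
    using that(1)[of "nat m"] assms sph_harmonic_nonneg[of _ l "nat m"] by auto
next
  case False
  then show ?thesis
    using that(2)[of "nat (- m)"] assms sph_harmonic_neg[of _ "nat (- m)" l] by auto
qed

lemma continuous_on_cartesian_harmonic: "continuous_on A (cartesian_harmonic l m)"
proof -
  have "continuous_on A equatorial"
    unfolding equatorial_def complex_of_real_def[symmetric] Complex_eq
    by (intro continuous_intros)
  then show ?thesis
    unfolding cartesian_harmonic_def solid_harmonic_def
    by (intro continuous_intros)
qed

lemma continuous_on_sph_harmonic:
  assumes "\<bar>m\<bar> \<le> int l"
  shows "continuous_on \<S> (sph_harmonic l m)"
  using assms
proof (cases rule: sph_harmonic_cases)
  case (1 n)
  then show ?thesis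
    using continuous_on_cartesian_harmonic[of \<S> l n] continuous_on_cong[of \<S> \<S>] by metis
next
  case (2 n)
  have "continuous_on \<S> (\<lambda>x. (-1) ^ n * cnj (cartesian_harmonic l n x))"
    by (intro continuous_intros continuous_on_cartesian_harmonic)
  with 2(3) show ?thesis
    using continuous_on_cong[of \<S> \<S>] by metis
qed

lemma sum_symmetric_int:
  "(\<Sum>m = - int l..int l. f m) = f 0 + (\<Sum>m<l. f (int (Suc m)) + f (- int (Suc m)))"
  for f :: "int \<Rightarrow> 'a::comm_monoid_add"
proof (induction l)
  case (Suc l)
  have "{- int (Suc l)..int (Suc l)} = insert (int (Suc l)) (insert (- int (Suc l)) {- int l..int l})"
    by auto
  with Suc show ?case by (simp add: add_ac)
qed simp

text \<open>Orders \<open>m\<close> and \<open>- m\<close> contribute complex conjugates, since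
  their two signs cancel, and add up to twice a real part. This reduces the sum to
  \<open>zonal_sum\<close>, which \<open>legendre_addition\<close> evaluates as a function of
  \<open>x \<bullet> y\<close>.\<close>

theorem sph_harmonic_addition:
  assumes x: "x \<in> \<S>" and y: "y \<in> \<S>"
  shows "(\<Sum>m = - int l..int l. sph_harmonic l m x * cnj (sph_harmonic l m y)) =
    of_real ((2 * real l + 1) / (4 * pi) * poly (legendre_poly l) 1 * poly (legendre_poly l) (x \<bullet> y))"
proof -
  let ?U = "\<lambda>m. solid_harmonic l m (equatorial x) (x $ 3)"
  let ?V = "\<lambda>m. solid_harmonic l m (equatorial y) (y $ 3)"
  have N: "(harmonic_norm l m)\<^sup>2 = (2 * real l + 1) / (4 * pi) * (fact (l - m) / fact (l + m))" for m
    by (simp add: harmonic_norm_def)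
  have prod: "cartesian_harmonic l m x * cnj (cartesian_harmonic l m y)
      = of_real ((harmonic_norm l m)\<^sup>2) * (?U m * cnj (?V m))" for m
    by (simp add: cartesian_harmonic_def power2_eq_square mult_ac flip: power_mult_distrib)
  have two: "sph_harmonic l (int (Suc m)) x * cnj (sph_harmonic l (int (Suc m)) y) +
      sph_harmonic l (- int (Suc m)) x * cnj (sph_harmonic l (- int (Suc m)) y)
      = of_real ((2 * real l + 1) / (4 * pi) * (2 * (fact (l - Suc m) / fact (l + Suc m) *
          Re (?U (Suc m) * cnj (?V (Suc m))))))" (is "?A + ?B = _") if "m < l" for m
  proof -
    have A: "?A = cartesian_harmonic l (Suc m) x * cnj (cartesian_harmonic l (Suc m) y)"
      by (simp only: sph_harmonic_nonneg x y)
    have "?B = ((-1) ^ Suc m * (-1) ^ Suc m) * cnj (cartesian_harmonic l (Suc m) x * cnj (cartesian_harmonic l (Suc m) y))"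
      using that x y by (simp only: sph_harmonic_neg Suc_leI) simp
    then have B: "?B = cnj ?A" unfolding A by (simp flip: power_mult_distrib)
    define r W where "r = (harmonic_norm l (Suc m))\<^sup>2" and "W = ?U (Suc m) * cnj (?V (Suc m))"
    have "?A + ?B = of_real (2 * (r * Re W))"
      unfolding B complex_add_cnj unfolding A prod r_def[symmetric] W_def[symmetric] by simp
    then show ?thesis unfolding r_def N W_def by (simp only: mult_ac)
  qed
  have "(\<Sum>m = - int l..int l. sph_harmonic l m x * cnj (sph_harmonic l m y)) =
    of_real ((2 * real l + 1) / (4 * pi) * zonal_sum l (equatorial x) (x $ 3) (equatorial y) (y $ 3))"
  proof -
    have 0: "sph_harmonic l 0 x * cnj (sph_harmonic l 0 y) =
        of_real ((2 * real l + 1) / (4 * pi) * (poly (legendre_poly l) (x $ 3) * poly (legendre_poly l) (y $ 3)))"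
      using sph_harmonic_nonneg[OF x, of l 0] sph_harmonic_nonneg[OF y, of l 0] prod[of 0] N[of 0]
      by (simp add: solid_harmonic_0)
    show ?thesis
      unfolding sum_symmetric_int zonal_sum_def 0 
      by (simp add: two distrib_left sum_distrib_left del: of_nat_Suc)
  qed
  then show ?thesis
    by (simp add: legendre_addition[OF equatorial_sphere[OF x] equatorial_sphere[OF y]] inner_sphere)
qed

section \<open>The surface measure and orthogonality\<close>

definition polar_rotation :: "real \<Rightarrow> real^3 \<Rightarrow> real^3" where
  "polar_rotation \<alpha> x =
     vector [cos \<alpha> * x $ 1 - sin \<alpha> * x $ 2, sin \<alpha> * x $ 1 + cos \<alpha> * x $ 2, x $ 3]"

lemma polar_rotation_simps [simp]:
  "polar_rotation \<alpha> x $ 3 = x $ 3" "equatorial (polar_rotation \<alpha> x) = cis \<alpha> * equatorial x"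
  by (simp_all add: polar_rotation_def equatorial_def complex_eq_iff)

lemma polar_rotation_sph_point: "polar_rotation \<alpha> (sph_point \<theta> \<phi>) = sph_point \<theta> (\<phi> + \<alpha>)"
  by (simp add: real3_eq_iff cis_mult mult_ac add.commute)

lemma polar_rotation_in_sphere: "x \<in> \<S> \<Longrightarrow> polar_rotation \<alpha> x \<in> \<S>"
  by (metis sphere_coordinates polar_rotation_sph_point sph_point_in_sphere)

lemma continuous_on_polar_rotation: "continuous_on A (polar_rotation \<alpha>)"
proof -
  have "continuous_on A (\<lambda>x. polar_rotation \<alpha> x $ i)" for i
    using exhaust_3[of i] by (elim disjE; simp add: polar_rotation_def; intro continuous_intros)
  then have "continuous_on A (\<lambda>x. \<chi> i. polar_rotation \<alpha> x $ i)"
    by (intro continuous_on_vec_lambda)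
  then show ?thesis by simp
qed

lemma space_sphere_measure [simp]: "space sphere_measure = \<S>"
  by (simp add: sphere_measure_def space_restrict_space)

lemma sets_sphere_measure [measurable_cong]: "sets sphere_measure = sets (restrict_space borel \<S>)"
  by (simp add: sphere_measure_def)

lemma borel_measurable_sphere:
  assumes "continuous_on \<S> f"
  shows "f \<in> borel_measurable sphere_measure"
  using borel_measurable_continuous_on_restrict[OF assms]
  by (simp cong: measurable_cong_sets add: sets_sphere_measure)

lemma continuous_on_sph_point: "continuous_on A (\<lambda>(\<theta>, \<phi>). sph_point \<theta> \<phi>)"
proof -
  have "continuous_on A (\<lambda>p. sph_point (fst p) (snd p) $ i)" for i
    using exhaust_3[of i] by (elim disjE; simp add: sph_point_def; intro continuous_intros)
  then have "continuous_on A (\<lambda>p. \<chi> i. sph_point (fst p) (snd p) $ i)"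
    by (intro continuous_on_vec_lambda)
  then show ?thesis by (simp add: case_prod_beta)
qed

lemma measurable_sph_point [measurable]:
  "(\<lambda>(\<theta>, \<phi>). sph_point \<theta> \<phi>) \<in> borel \<rightarrow>\<^sub>M restrict_space borel \<S>"
  by (rule measurable_restrict_space2)
    (use sph_point_in_sphere in \<open>auto intro: borel_measurable_continuous_onI continuous_on_sph_point\<close>)

text \<open>Tonelli in coordinates with the longitude innermost, so that a rotation about the polar
  axis affects the inner integral only.\<close>

lemma nn_integral_sphere_measure:
  assumes f: "f \<in> borel_measurable sphere_measure"
  shows "(\<integral>\<^sup>+x. f x \<partial>sphere_measure) =
    (\<integral>\<^sup>+\<theta>. ennreal (sin \<theta>) * indicator {0..pi} \<theta> *
      (\<integral>\<^sup>+\<phi>. indicator {0..<2 * pi} \<phi> * f (sph_point \<theta> \<phi>) \<partial>lborel) \<partial>lborel)"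
proof -
  have f'[measurable]: "f \<in> borel_measurable (restrict_space borel \<S>)"
    using f by (simp cong: measurable_cong_sets add: sets_sphere_measure)
  have [measurable]: "(\<lambda>p. f (case p of (\<theta>, \<phi>) \<Rightarrow> sph_point \<theta> \<phi>)) \<in> borel_measurable borel"
    by measurable
  then have [measurable]: "(\<lambda>p. f (case p of (\<theta>, \<phi>) \<Rightarrow> sph_point \<theta> \<phi>)) \<in> borel_measurable (borel \<Otimes>\<^sub>M borel)"
    by (simp add: borel_prod)
  have ind: "{0..pi} \<times> {0..<2 * pi} \<in> sets (borel :: (real \<times> real) measure)"
    unfolding borel_prod[symmetric] by measurable
  have dens: "(\<lambda>(\<theta>, \<phi>). ennreal (sin \<theta>) * indicator ({0..pi} \<times> {0..<2 * pi}) (\<theta>, \<phi>)) \<in> borel_measurable borel"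
    using ind unfolding borel_prod[symmetric] by measurable
  have "(\<integral>\<^sup>+x. f x \<partial>sphere_measure) = (\<integral>\<^sup>+p. (case p of (\<theta>, \<phi>) \<Rightarrow> ennreal (sin \<theta>) * indicator ({0..pi} \<times> {0..<2 * pi}) (\<theta>, \<phi>)) *
      f (case p of (\<theta>, \<phi>) \<Rightarrow> sph_point \<theta> \<phi>) \<partial>lborel)"
    unfolding sphere_measure_def
    by (subst nn_integral_distr, measurable, subst nn_integral_density) (use dens in measurable)
  also have "\<dots> = (\<integral>\<^sup>+p. (case p of (\<theta>, \<phi>) \<Rightarrow> ennreal (sin \<theta>) * indicator ({0..pi} \<times> {0..<2 * pi}) (\<theta>, \<phi>)) *
      f (case p of (\<theta>, \<phi>) \<Rightarrow> sph_point \<theta> \<phi>) \<partial>(lborel \<Otimes>\<^sub>M lborel))"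
    by (simp add: lborel_prod)
  also have "\<dots> = (\<integral>\<^sup>+\<theta>. \<integral>\<^sup>+\<phi>. ennreal (sin \<theta>) * indicator ({0..pi} \<times> {0..<2 * pi}) (\<theta>, \<phi>) *
      f (sph_point \<theta> \<phi>) \<partial>lborel \<partial>lborel)"
    using dens by (subst lborel.nn_integral_fst[symmetric]) (auto simp: lborel_prod)
  also have "\<dots> = (\<integral>\<^sup>+\<theta>. \<integral>\<^sup>+\<phi>. ennreal (sin \<theta>) * indicator {0..pi} \<theta> * (indicator {0..<2 * pi} \<phi> *
      f (sph_point \<theta> \<phi>)) \<partial>lborel \<partial>lborel)"
    by (intro nn_integral_cong) (auto split: split_indicator)
  also have "\<dots> = (\<integral>\<^sup>+\<theta>. ennreal (sin \<theta>) * indicator {0..pi} \<theta> *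
      (\<integral>\<^sup>+\<phi>. indicator {0..<2 * pi} \<phi> * f (sph_point \<theta> \<phi>) \<partial>lborel) \<partial>lborel)"
  proof (intro nn_integral_cong nn_integral_cmult)
    fix \<theta> :: real
    have "(\<lambda>\<phi>. f (case (\<theta>, \<phi>) of (\<theta>, \<phi>) \<Rightarrow> sph_point \<theta> \<phi>)) \<in> borel_measurable borel"
      by measurable
    then show "(\<lambda>\<phi>. indicator {0..<2 * pi} \<phi> * f (sph_point \<theta> \<phi>)) \<in> borel_measurable lborel"
      by simp
  qed
  finally show ?thesis .
qed

text \<open>The shifted interval \<open>{a..<p + a}\<close> is cut at \<open>p\<close>, and its
  upper piece is moved back by one period onto \<open>{0..<a}\<close>.\<close>

lemma nn_integral_periodic_shift:
  fixes g :: "real \<Rightarrow> ennreal"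
  assumes [measurable]: "g \<in> borel_measurable borel" and periodic: "\<And>x. g (x + p) = g x"
    and a: "0 \<le> a" "a \<le> p"
  shows "(\<integral>\<^sup>+x. indicator {0..<p} x * g (x + a) \<partial>lborel) = (\<integral>\<^sup>+x. indicator {0..<p} x * g x \<partial>lborel)"
proof -
  have shift: "(\<integral>\<^sup>+x. f x \<partial>lborel) = (\<integral>\<^sup>+x. f (x + t) \<partial>lborel)"
    if "f \<in> borel_measurable borel" for f :: "real \<Rightarrow> ennreal" and t
    using nn_integral_real_affine[of f 1 t] that by (simp add: add.commute)
  have "(\<integral>\<^sup>+x. indicator {0..<p} x * g (x + a) \<partial>lborel) = (\<integral>\<^sup>+x. indicator {a..<p + a} x * g x \<partial>lborel)"
    by (subst shift[of "\<lambda>x. indicator {a..<p + a} x * g x" a]) (auto intro!: nn_integral_cong split: split_indicator)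
  also have "\<dots> = (\<integral>\<^sup>+x. indicator {a..<p} x * g x + indicator {p..<p + a} x * g x \<partial>lborel)"
    using a by (intro nn_integral_cong) (auto split: split_indicator)
  also have "\<dots> = (\<integral>\<^sup>+x. indicator {a..<p} x * g x \<partial>lborel) + (\<integral>\<^sup>+x. indicator {p..<p + a} x * g x \<partial>lborel)"
    by (rule nn_integral_add) measurable
  also have "(\<integral>\<^sup>+x. indicator {p..<p + a} x * g x \<partial>lborel) = (\<integral>\<^sup>+x. indicator {0..<a} x * g x \<partial>lborel)"
    by (subst shift[of "\<lambda>x. indicator {p..<p + a} x * g x" p])
      (auto intro!: nn_integral_cong simp: periodic split: split_indicator)
  also have "(\<integral>\<^sup>+x. indicator {a..<p} x * g x \<partial>lborel) + (\<integral>\<^sup>+x. indicator {0..<a} x * g x \<partial>lborel)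
      = (\<integral>\<^sup>+x. indicator {a..<p} x * g x + indicator {0..<a} x * g x \<partial>lborel)"
    by (rule nn_integral_add[symmetric]) measurable
  also have "\<dots> = (\<integral>\<^sup>+x. indicator {0..<p} x * g x \<partial>lborel)"
    using a by (intro nn_integral_cong) (auto split: split_indicator)
  finally show ?thesis .
qed

lemma measurable_polar_rotation [measurable]: "polar_rotation \<alpha> \<in> sphere_measure \<rightarrow>\<^sub>M sphere_measure"
proof -
  have "polar_rotation \<alpha> \<in> restrict_space borel \<S> \<rightarrow>\<^sub>M restrict_space borel \<S>"
  proof (rule measurable_restrict_space2)
    show "polar_rotation \<alpha> \<in> space (restrict_space borel \<S>) \<rightarrow> \<S>"
      using polar_rotation_in_sphere by (auto simp: space_restrict_space simp del: mem_sphere_0)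
    show "polar_rotation \<alpha> \<in> borel_measurable (restrict_space borel \<S>)"
      by (rule borel_measurable_continuous_on_restrict[OF continuous_on_polar_rotation])
  qed
  then show ?thesis
    by (simp cong: measurable_cong_sets add: sets_sphere_measure)
qed

text \<open>A rotation shifts the longitude, and the inner integral runs over a full period. The
  range allowed for \<open>\<alpha>\<close> is that of the periodic shift; it contains every angle
  supplied by \<open>half_turn\<close>.\<close>

lemma distr_polar_rotation:
  assumes a: "0 \<le> \<alpha>" "\<alpha> \<le> 2 * pi"
  shows "distr sphere_measure sphere_measure (polar_rotation \<alpha>) = sphere_measure"
proof (rule measure_eqI)
  fix A assume "A \<in> sets (distr sphere_measure sphere_measure (polar_rotation \<alpha>))"
  then have A[measurable]: "A \<in> sets sphere_measure" by simp
  have per: "sph_point \<theta> (\<phi> + 2 * pi) = sph_point \<theta> \<phi>" for \<theta> \<phi>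
    by (simp add: sph_point_def)
  have [measurable]: "(\<lambda>\<phi>. indicator A (sph_point \<theta> \<phi>) :: ennreal) \<in> borel_measurable borel" for \<theta>
  proof -
    have "indicator A \<in> borel_measurable (restrict_space borel \<S>)"
      using A by (simp add: sets_sphere_measure)
    then have "(\<lambda>\<phi>. indicator A (case (\<theta>, \<phi>) of (\<theta>, \<phi>) \<Rightarrow> sph_point \<theta> \<phi>) :: ennreal) \<in> borel_measurable borel"
      by (intro measurable_compose[OF _ measurable_compose[OF measurable_sph_point]])
       (simp add: borel_prod[symmetric])
    then show ?thesis by simp
  qed
  have "emeasure (distr sphere_measure sphere_measure (polar_rotation \<alpha>)) A =
      (\<integral>\<^sup>+x. indicator A x \<partial>distr sphere_measure sphere_measure (polar_rotation \<alpha>))"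
    by simp
  also have "\<dots> = (\<integral>\<^sup>+x. indicator A (polar_rotation \<alpha> x) \<partial>sphere_measure)"
    by (rule nn_integral_distr) measurable
  also have "\<dots> = (\<integral>\<^sup>+\<theta>. ennreal (sin \<theta>) * indicator {0..pi} \<theta> *
      (\<integral>\<^sup>+\<phi>. indicator {0..<2 * pi} \<phi> * indicator A (sph_point \<theta> (\<phi> + \<alpha>)) \<partial>lborel) \<partial>lborel)"
    by (subst nn_integral_sphere_measure, measurable) (simp add: polar_rotation_sph_point)
  also have "\<dots> = (\<integral>\<^sup>+\<theta>. ennreal (sin \<theta>) * indicator {0..pi} \<theta> *
      (\<integral>\<^sup>+\<phi>. indicator {0..<2 * pi} \<phi> * indicator A (sph_point \<theta> \<phi>) \<partial>lborel) \<partial>lborel)"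
    by (subst nn_integral_periodic_shift) (auto simp: per a)
  also have "\<dots> = (\<integral>\<^sup>+x. indicator A x \<partial>sphere_measure)"
    by (subst nn_integral_sphere_measure) auto
  finally show "emeasure (distr sphere_measure sphere_measure (polar_rotation \<alpha>)) A = emeasure sphere_measure A"
    by simp
qed simp

lemma integral_polar_rotation:
  fixes f :: "real^3 \<Rightarrow> 'b::{banach, second_countable_topology}"
  assumes "0 \<le> \<alpha>" "\<alpha> \<le> 2 * pi" "f \<in> borel_measurable sphere_measure"
  shows "(\<integral>x. f (polar_rotation \<alpha> x) \<partial>sphere_measure) = (\<integral>x. f x \<partial>sphere_measure)"
  using integral_distr[OF measurable_polar_rotation assms(3), of \<alpha>] distr_polar_rotation[OF assms(1,2)]
  by simp

interpretation sphere_measure: finite_measure sphere_measure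
proof
  have "emeasure sphere_measure (space sphere_measure) = (\<integral>\<^sup>+x. 1 \<partial>sphere_measure)"
    by simp
  also have "\<dots> = (\<integral>\<^sup>+\<theta>. ennreal (sin \<theta>) * indicator {0..pi} \<theta> *
      (\<integral>\<^sup>+\<phi>. indicator {0..<2 * pi} \<phi> * 1 \<partial>lborel) \<partial>lborel)"
    by (rule nn_integral_sphere_measure) simp
  also have "\<dots> \<le> (\<integral>\<^sup>+\<theta>. ennreal (2 * pi) * indicator {0..pi} \<theta> \<partial>lborel)"
  proof (rule nn_integral_mono)
    fix \<theta> :: real
    have "ennreal (sin \<theta>) \<le> 1" by simp
    then have "ennreal (sin \<theta>) * ennreal (2 * pi) \<le> 1 * ennreal (2 * pi)" by (rule mult_right_mono) simp
    then show "ennreal (sin \<theta>) * indicator {0..pi} \<theta> * (\<integral>\<^sup>+\<phi>. indicator {0..<2 * pi} \<phi> * 1 \<partial>lborel)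
        \<le> ennreal (2 * pi) * indicator {0..pi} \<theta>"
      by (simp split: split_indicator)
  qed
  also have "\<dots> = ennreal (2 * pi) * ennreal pi"
    by (simp add: nn_integral_cmult)
  finally show "emeasure sphere_measure (space sphere_measure) \<noteq> \<infinity>"
    by (auto simp: ennreal_mult[symmetric] top_unique)
qed

lemma continuous_on_compact_norm_le:
  assumes "compact A" "continuous_on A f"
  shows "\<exists>B. \<forall>x\<in>A. norm (f x) \<le> B"
  using continuous_on_compact_bound[OF assms] by metis

lemma integrable_sphere_measure:
  fixes f :: "real^3 \<Rightarrow> 'b::{banach, second_countable_topology}"
  assumes "continuous_on \<S> f"
  shows "integrable sphere_measure f"
proof -
  from continuous_on_compact_norm_le[OF compact_sphere assms]
  obtain B where "\<forall>x\<in>\<S>. norm (f x) \<le> B" ..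
  note B = bspec[OF this]
  show ?thesis
  proof (rule sphere_measure.integrable_const_bound)
    show "AE x in sphere_measure. norm (f x) \<le> B" by (rule AE_I2, rule B) simp
  qed (rule borel_measurable_sphere[OF assms])
qed

text \<open>Archimedes' hat-box theorem: the height has density \<open>2 * pi\<close> on
  \<open>{-1..1}\<close>, because \<open>sin \<theta> * q' (cos \<theta>)\<close> is the derivative
  of \<open>- q (cos \<theta>)\<close>. The form with \<open>pderiv\<close> exposes the boundary
  values for integration by parts.\<close>

lemma integral_pderiv_sphere:
  "(\<integral>x. poly (pderiv q) (x $ 3) \<partial>sphere_measure) = 2 * pi * (poly q 1 - poly q (-1))"
proof -
  define g where "g = (\<lambda>(\<theta>, \<phi>). (sin \<theta> * indicator ({0..pi} \<times> {0..<2 * pi}) (\<theta>, \<phi>)) :: real)"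
  let ?h = "\<lambda>x::real^3. poly (pderiv q) (x $ 3)"
  have c: "continuous_on \<S> ?h" by (intro continuous_intros)
  have ind: "{0..pi} \<times> {0..<2 * pi} \<in> sets (borel :: (real \<times> real) measure)"
    unfolding borel_prod[symmetric] by measurable
  have g[measurable]: "g \<in> borel_measurable borel"
    using ind unfolding g_def borel_prod[symmetric] by measurable
  have g0: "0 \<le> g p" for p
    by (cases p) (auto simp: g_def sin_ge_zero split: split_indicator)
  have S: "sphere_measure = distr (density lborel (\<lambda>p. ennreal (g p))) (restrict_space borel \<S>)
      (\<lambda>(\<theta>, \<phi>). sph_point \<theta> \<phi>)"
    unfolding sphere_measure_def g_def
    by (intro arg_cong[of _ _ "\<lambda>d. distr (density lborel d) _ _"]) (auto simp: fun_eq_iff split: split_indicator)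
  have h[measurable]: "?h \<in> borel_measurable (restrict_space borel \<S>)"
    by (rule borel_measurable_continuous_on_restrict[OF c])
  have hs[measurable]: "(\<lambda>p. ?h (case p of (\<theta>, \<phi>) \<Rightarrow> sph_point \<theta> \<phi>)) \<in> borel_measurable borel"
    by measurable
  have "integrable sphere_measure ?h" by (rule integrable_sphere_measure[OF c])
  then have int: "integrable (lborel \<Otimes>\<^sub>M lborel) (\<lambda>p. g p *\<^sub>R ?h (case p of (\<theta>, \<phi>) \<Rightarrow> sph_point \<theta> \<phi>))"
    unfolding S by (subst (asm) integrable_distr_eq, simp, simp, subst (asm) integrable_density)
      (auto simp: g0 lborel_prod)
  have "(\<integral>x. ?h x \<partial>sphere_measure) = (\<integral>p. g p *\<^sub>R ?h (case p of (\<theta>, \<phi>) \<Rightarrow> sph_point \<theta> \<phi>) \<partial>(lborel \<Otimes>\<^sub>M lborel))"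
    unfolding S by (subst integral_distr, simp, simp, subst integral_density)
      (auto simp: g0 lborel_prod)
  also have "\<dots> = (\<integral>\<theta>. \<integral>\<phi>. g (\<theta>, \<phi>) *\<^sub>R ?h (case (\<theta>, \<phi>) of (\<theta>, \<phi>) \<Rightarrow> sph_point \<theta> \<phi>) \<partial>lborel \<partial>lborel)"
    by (rule lborel_pair.integral_fst'[symmetric, OF int])
  also have "\<dots> = (\<integral>\<theta>. 2 * pi * (sin \<theta> * poly (pderiv q) (cos \<theta>) * indicator {0..pi} \<theta>) \<partial>lborel)"
  proof (rule Bochner_Integration.integral_cong[OF refl])
    fix \<theta> :: real
    have "(\<integral>\<phi>. g (\<theta>, \<phi>) *\<^sub>R ?h (case (\<theta>, \<phi>) of (\<theta>, \<phi>) \<Rightarrow> sph_point \<theta> \<phi>) \<partial>lborel)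
      = (\<integral>\<phi>. indicator {0..<2 * pi} \<phi> * (sin \<theta> * poly (pderiv q) (cos \<theta>) * indicator {0..pi} \<theta>) \<partial>lborel)"
      by (rule Bochner_Integration.integral_cong) (auto simp: g_def split: split_indicator)
    also have "\<dots> = 2 * pi * (sin \<theta> * poly (pderiv q) (cos \<theta>) * indicator {0..pi} \<theta>)"
      by simp
    finally show "(\<integral>\<phi>. g (\<theta>, \<phi>) *\<^sub>R ?h (case (\<theta>, \<phi>) of (\<theta>, \<phi>) \<Rightarrow> sph_point \<theta> \<phi>) \<partial>lborel)
        = 2 * pi * (sin \<theta> * poly (pderiv q) (cos \<theta>) * indicator {0..pi} \<theta>)" .
  qed
  also have "\<dots> = 2 * pi * (\<integral>\<theta>. (sin \<theta> * poly (pderiv q) (cos \<theta>)) * indicator {0..pi} \<theta> \<partial>lborel)"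
    by simp
  also have "(\<integral>\<theta>. (sin \<theta> * poly (pderiv q) (cos \<theta>)) * indicator {0..pi} \<theta> \<partial>lborel)
      = - poly q (cos pi) - (- poly q (cos 0))"
    by (rule integral_FTC_Icc_real) (auto intro!: derivative_eq_intros poly_DERIV[THEN DERIV_chain2] continuous_intros)
  finally show ?thesis by simp
qed

section \<open>Orthogonality of the spherical harmonics\<close>

abbreviation latitude_weight :: "real poly" where
  "latitude_weight \<equiv> [:1, 0, -1:]"

text \<open>The integral of two harmonics of the same order \<open>n\<close> before normalisation:
  on the sphere \<open>w * cnj w = 1 - z^2\<close>, so the powers of \<open>w\<close> become a power
  of \<open>latitude_weight\<close>.\<close>

definition legendre_product_integral :: "nat \<Rightarrow> nat \<Rightarrow> nat \<Rightarrow> real" where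
  "legendre_product_integral n l l' =
     (\<integral>x. poly (latitude_weight ^ n * legendre_deriv l n * legendre_deriv l' n) (x $ 3) \<partial>sphere_measure)"

lemma integrable_poly_sphere: "integrable sphere_measure (\<lambda>x. poly p (x $ 3))" for p :: "real poly"
  by (intro integrable_sphere_measure continuous_intros)

lemma legendre_product_integral_commute:
  "legendre_product_integral n l l' = legendre_product_integral n l' l"
  by (simp add: legendre_product_integral_def mult_ac)

text \<open>Integration by parts against \<open>(1 - z\<^sup>2)\<^sup>n\<^sup>+\<^sup>1\<close>, which vanishes at \<open>\<plusminus>1\<close>.\<close>

lemma legendre_product_integral_Suc:
  "legendre_product_integral (Suc n) l l' =
     (real l + real n + 1) * (real l - real n) * legendre_product_integral n l l'"
proof -
  let ?c = "(real l + real n + 1) * (real l - real n)"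
  let ?p = "\<lambda>k. latitude_weight ^ k * legendre_deriv l k * legendre_deriv l' k"
  \<comment> \<open>By the differential equation, the derivative of this \<open>q\<close> is the
    integrand of order \<open>Suc n\<close> minus \<open>?c\<close> times the integrand of order
    \<open>n\<close>.\<close>
  define q where "q = latitude_weight ^ Suc n * legendre_deriv l (Suc n) * legendre_deriv l' n"
  have pd: "pderiv latitude_weight = smult (-2) [:0, 1:]" by (simp add: pderiv_pCons)
  have "poly (pderiv q) z = poly (?p (Suc n)) z - ?c * poly (?p n) z" for z
  proof -
    define a b c d e where "a = poly (legendre_deriv l (n + 2)) z" and "b = poly (legendre_deriv l (n + 1)) z"
      and "c = poly (legendre_deriv l' n) z" and "d = poly (legendre_deriv l' (n + 1)) z"
      and "e = poly (legendre_deriv l n) z"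
    have ode: "(1 - z\<^sup>2) * a - 2 * (real n + 1) * z * b + ?c * e = 0"
      using legendre_deriv_ode[of z n l] by (simp add: a_def b_def e_def)
    have "poly (pderiv q) z = (1 - z\<^sup>2) ^ Suc n * b * d +
        (1 - z\<^sup>2) ^ n * c * ((1 - z\<^sup>2) * a - 2 * (real n + 1) * z * b)"
      unfolding q_def by (simp add: pderiv_mult pderiv_power_Suc pd a_def b_def c_def d_def
         del: mult_pCons_left mult_pCons_right smult_pCons power_Suc)
        (simp add: power2_eq_square algebra_simps)
    also have "(1 - z\<^sup>2) * a - 2 * (real n + 1) * z * b = - ?c * e" using ode by simp
    finally show ?thesis
      by (simp add: b_def c_def d_def e_def power2_eq_square algebra_simps)
  qed
  then have "(\<integral>x. poly (pderiv q) (x $ 3) \<partial>sphere_measure)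
      = legendre_product_integral (Suc n) l l' - ?c * legendre_product_integral n l l'"
    unfolding legendre_product_integral_def
    by (simp only: Bochner_Integration.integral_diff integrable_poly_sphere integrable_mult_right
        Bochner_Integration.integral_mult_right_zero)
  moreover have "poly q 1 = 0" "poly q (-1) = 0" by (simp_all add: q_def)
  ultimately show ?thesis by (simp add: integral_pderiv_sphere)
qed

text \<open>By symmetry the integral of order \<open>1\<close> comes from that of order
  \<open>0\<close> with either factor \<open>l * (l + 1)\<close> or \<open>l' * (l' + 1)\<close>.
  These eigenvalues differ, so the integral of order \<open>0\<close> vanishes, and the recursion
  carries this to every order.\<close>

lemma legendre_product_integral_neq:
  assumes "l \<noteq> l'"
  shows "legendre_product_integral n l l' = 0"
proof (induction n)
  case 0
  have "real l * (real l + 1) * legendre_product_integral 0 l l' = legendre_product_integral 1 l l'"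
    by (simp add: legendre_product_integral_Suc algebra_simps)
  also have "\<dots> = real l' * (real l' + 1) * legendre_product_integral 0 l l'"
    unfolding legendre_product_integral_commute[of _ l l']
    by (simp add: legendre_product_integral_Suc algebra_simps)
  finally have "(real l - real l') * (real l + real l' + 1) * legendre_product_integral 0 l l' = 0"
    by (simp add: algebra_simps)
  moreover have "real l + real l' + 1 \<noteq> 0" by linarith
  ultimately show ?case using assms by simp
qed (simp add: legendre_product_integral_Suc)

text \<open>From one order to the next the squared normalisation shrinks by exactly the factor by
  which the integral grows. Hence all harmonics of degree \<open>l\<close> have the same norm,
  expressed here by the integral of order \<open>0\<close>.\<close>

lemma legendre_product_integral_eq:
  assumes "n \<le> l"
  shows "(harmonic_norm l n)\<^sup>2 * legendre_product_integral n l l =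
    (2 * real l + 1) / (4 * pi) * legendre_product_integral 0 l l"
  using assms
proof (induction n)
  case 0
  then show ?case by (simp add: harmonic_norm_def)
next
  case (Suc n)
  have 1: "(fact (l - n) :: real) = (real l - real n) * fact (l - Suc n)"
    using Suc.prems by (simp add: fact_reduce[of "l - n"] of_nat_diff)
  have 2: "(fact (l + Suc n) :: real) = (real l + real n + 1) * fact (l + n)"
    by (simp add: algebra_simps)
  have 3: "real l + real n + 1 \<noteq> 0" by linarith
  have N: "(harmonic_norm l m)\<^sup>2 = (2 * real l + 1) / (4 * pi) * (fact (l - m) / fact (l + m))" for m
    by (simp add: harmonic_norm_def)
  have "a / (e * b) * (e * c) = c * a / b" if "e \<noteq> 0" for a b c e :: real
    using that by simp
  from this[OF 3] have "(harmonic_norm l (Suc n))\<^sup>2 * ((real l + real n + 1) * (real l - real n)) = (harmonic_norm l n)\<^sup>2"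
    unfolding N 1 2 mult.assoc by simp
  then have "(harmonic_norm l (Suc n))\<^sup>2 * legendre_product_integral (Suc n) l l =
      (harmonic_norm l n)\<^sup>2 * legendre_product_integral n l l"
    unfolding legendre_product_integral_Suc by (metis mult.assoc)
  with Suc show ?case by simp
qed

lemma sph_harmonic_polar_rotation:
  assumes "x \<in> \<S>" "\<bar>m\<bar> \<le> int l"
  shows "sph_harmonic l m (polar_rotation \<alpha> x) = cis (of_int m * \<alpha>) * sph_harmonic l m x"
proof -
  have C: "cartesian_harmonic l n (polar_rotation \<alpha> x) = cis (real n * \<alpha>) * cartesian_harmonic l n x" for n
    unfolding cartesian_harmonic_def solid_harmonic_def polar_rotation_simps power_mult_distrib Complex.DeMoivre
    by (simp only: mult_ac)
  note R = polar_rotation_in_sphere[OF assms(1), of \<alpha>]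
  show ?thesis using assms(2)
  proof (cases rule: sph_harmonic_cases)
    case (1 n)
    then show ?thesis using R assms(1) C by simp
  next
    case (2 n)
    then show ?thesis using R assms(1) C by (simp add: cis_cnj)
  qed
qed

text \<open>At this angle harmonics of orders \<open>m\<close> and \<open>m'\<close> acquire
  opposite phases. An integral of their product against anything invariant under the rotation then
  equals its own negative. The denominator is at least \<open>1\<close>, which bounds
  \<open>\<alpha>\<close> by \<open>pi\<close>.\<close>

lemma half_turn:
  fixes m m' :: int
  defines "\<alpha> \<equiv> pi / real_of_int \<bar>m - m'\<bar>"
  assumes "m \<noteq> m'"
  shows "0 \<le> \<alpha>" "\<alpha> \<le> 2 * pi" "cis (of_int m * \<alpha>) * cis (- (of_int m' * \<alpha>)) = -1"
proof -
  have "1 \<le> real_of_int \<bar>m - m'\<bar>" using assms(2) by linarith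
  then have "\<alpha> \<le> pi" unfolding \<alpha>_def using pi_ge_zero by (simp add: divide_le_eq mult_le_cancel_left1)
  then show "\<alpha> \<le> 2 * pi" using pi_ge_zero by linarith
  have "(real_of_int m - real_of_int m') * \<alpha> = pi \<or> (real_of_int m - real_of_int m') * \<alpha> = - pi"
    using assms(2) by (auto simp: \<alpha>_def abs_if field_simps)
  then have "cis ((real_of_int m - real_of_int m') * \<alpha>) = -1"
    by (auto simp: complex_eq_iff)
  then show "cis (of_int m * \<alpha>) * cis (- (of_int m' * \<alpha>)) = -1"
    unfolding cis_mult by (simp add: algebra_simps)
qed (simp add: \<alpha>_def)

text \<open>Different orders are separated by a rotation through the \<open>half_turn\<close> angle,
  different degrees by the latitude integrals. The nonzero value does not depend on
  \<open>m\<close>.\<close>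

lemma sph_harmonic_orthogonal:
  assumes m: "\<bar>m\<bar> \<le> int l" and m': "\<bar>m'\<bar> \<le> int l'"
  shows "(\<integral>x. sph_harmonic l m x * cnj (sph_harmonic l' m' x) \<partial>sphere_measure) =
    (if l = l' \<and> m = m' then of_real ((2 * real l + 1) / (4 * pi) * legendre_product_integral 0 l l) else 0)"
proof (cases "m = m'")
  case False
  let ?h = "\<lambda>x. sph_harmonic l m x * cnj (sph_harmonic l' m' x)"
  define \<alpha> where "\<alpha> = pi / real_of_int \<bar>m - m'\<bar>"
  note \<alpha> = half_turn[OF False, folded \<alpha>_def]
  have "(\<integral>x. ?h x \<partial>sphere_measure) = (\<integral>x. ?h (polar_rotation \<alpha> x) \<partial>sphere_measure)"
    by (rule integral_polar_rotation[OF \<alpha>(1,2), symmetric])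
      (intro borel_measurable_sphere continuous_intros continuous_on_sph_harmonic m m')
  also have "\<dots> = (\<integral>x. - ?h x \<partial>sphere_measure)"
  proof (rule Bochner_Integration.integral_cong[OF refl])
    fix x assume "x \<in> space sphere_measure"
    then have "?h (polar_rotation \<alpha> x) = (cis (of_int m * \<alpha>) * cis (- (of_int m' * \<alpha>))) * ?h x"
      using m m' by (simp add: sph_harmonic_polar_rotation cis_cnj del: mem_sphere_0 cis_mult)
    also have "cis (of_int m * \<alpha>) * cis (- (of_int m' * \<alpha>)) = -1"
      by (rule \<alpha>(3))
    finally show "?h (polar_rotation \<alpha> x) = - ?h x" by simp
  qed
  also have "\<dots> = - (\<integral>x. ?h x \<partial>sphere_measure)" by simp
  finally show ?thesis using False by simp
next
  case True
  have ww: "equatorial x ^ n * cnj (equatorial x) ^ n = of_real (poly (latitude_weight ^ n) (x $ 3))"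
    if "x \<in> \<S>" for x n
  proof -
    have "equatorial x * cnj (equatorial x) = of_real ((cmod (equatorial x))\<^sup>2)"
      by (rule complex_norm_square[symmetric])
    also have "(cmod (equatorial x))\<^sup>2 = poly latitude_weight (x $ 3)"
      using equatorial_sphere[OF that] by (simp add: power2_eq_square)
    finally show ?thesis by (simp only: power_mult_distrib[symmetric] poly_power of_real_power)
  qed
  \<comment> \<open>The product of two Cartesian harmonics of the same order is real on the sphere,
    so one computation covers positive orders and, through the conjugate, negative ones.\<close>
  have *: "(\<integral>x. h x \<partial>sphere_measure) =
      of_real (harmonic_norm l n * harmonic_norm l' n * legendre_product_integral n l l')"
    if "\<And>x. x \<in> \<S> \<Longrightarrow> h x = cartesian_harmonic l n x * cnj (cartesian_harmonic l' n x) \<or>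
      h x = cnj (cartesian_harmonic l n x * cnj (cartesian_harmonic l' n x))" for h n
  proof -
    have "(\<integral>x. h x \<partial>sphere_measure) = (\<integral>x. of_real (harmonic_norm l n * harmonic_norm l' n *
       poly (latitude_weight ^ n * legendre_deriv l n * legendre_deriv l' n) (x $ 3)) \<partial>sphere_measure)"
    proof (rule Bochner_Integration.integral_cong[OF refl])
      fix x assume "x \<in> space sphere_measure"
      then have x: "x \<in> \<S>" by simp
      have "cartesian_harmonic l n x * cnj (cartesian_harmonic l' n x) =
         of_real (harmonic_norm l n * harmonic_norm l' n * poly (legendre_deriv l n) (x $ 3) *
           poly (legendre_deriv l' n) (x $ 3)) * (equatorial x ^ n * cnj (equatorial x) ^ n)"
        by (simp add: cartesian_harmonic_def solid_harmonic_def mult_ac flip: power_mult_distrib)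
      also have "\<dots> = of_real (harmonic_norm l n * harmonic_norm l' n *
          poly (latitude_weight ^ n * legendre_deriv l n * legendre_deriv l' n) (x $ 3))"
        unfolding ww[OF x] by (simp add: mult_ac)
      finally have eq: "cartesian_harmonic l n x * cnj (cartesian_harmonic l' n x) =
        of_real (harmonic_norm l n * harmonic_norm l' n *
          poly (latitude_weight ^ n * legendre_deriv l n * legendre_deriv l' n) (x $ 3))" .
      from that[OF x] show "h x = of_real (harmonic_norm l n * harmonic_norm l' n *
          poly (latitude_weight ^ n * legendre_deriv l n * legendre_deriv l' n) (x $ 3))"
        unfolding eq by simp
    qed
    then show ?thesis
      by (simp only: integral_complex_of_real integral_mult_right_zero legendre_product_integral_def)
  qed
  obtain n where n: "n \<le> l" and h: "(\<integral>x. sph_harmonic l m x * cnj (sph_harmonic l' m' x) \<partial>sphere_measure)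
      = of_real (harmonic_norm l n * harmonic_norm l' n * legendre_product_integral n l l')"
  proof (cases "m \<ge> 0")
    case 1: True
    show ?thesis
    proof (rule that[of "nat m"])
      show "(\<integral>x. sph_harmonic l m x * cnj (sph_harmonic l' m' x) \<partial>sphere_measure)
        = of_real (harmonic_norm l (nat m) * harmonic_norm l' (nat m) * legendre_product_integral (nat m) l l')"
        using 1 \<open>m = m'\<close> sph_harmonic_nonneg[of _ _ "nat m"] by (intro *) (auto simp del: mem_sphere_0)
    qed (use m in auto)
  next
    case 2: False
    show ?thesis
    proof (rule that[of "nat (- m)"])
      have "sph_harmonic l m x * cnj (sph_harmonic l' m' x) = cnj (cartesian_harmonic l (nat (- m)) x *
          cnj (cartesian_harmonic l' (nat (- m)) x))" if "x \<in> \<S>" for x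
        using 2 \<open>m = m'\<close> sph_harmonic_neg[OF that, of "nat (- m)" l] sph_harmonic_neg[OF that, of "nat (- m)" l']
          m m' by (simp flip: power_mult_distrib)
      then show "(\<integral>x. sph_harmonic l m x * cnj (sph_harmonic l' m' x) \<partial>sphere_measure)
        = of_real (harmonic_norm l (nat (- m)) * harmonic_norm l' (nat (- m)) * legendre_product_integral (nat (- m)) l l')"
        by (intro *) (auto simp del: mem_sphere_0)
    qed (use m in auto)
  qed
  show ?thesis
  proof (cases "l = l'")
    case True
    have "harmonic_norm l n * harmonic_norm l n * legendre_product_integral n l l =
       (2 * real l + 1) / (4 * pi) * legendre_product_integral 0 l l"
      using legendre_product_integral_eq[OF n] by (simp add: power2_eq_square)
    with True \<open>m = m'\<close> show ?thesis unfolding h by (simp only: simp_thms if_True)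
  next
    case False
    then show ?thesis unfolding h by (simp add: legendre_product_integral_neq)
  qed
qed

section \<open>Spectral coefficients of a random field\<close>

lemma square_integrable_mult:
  fixes f g :: "'a \<Rightarrow> 'b::{real_normed_algebra, banach, second_countable_topology}"
  assumes [measurable]: "f \<in> borel_measurable M" "g \<in> borel_measurable M"
    and "integrable M (\<lambda>x. (norm (f x))\<^sup>2)" "integrable M (\<lambda>x. (norm (g x))\<^sup>2)"
  shows "integrable M (\<lambda>x. f x * g x)"
proof (rule Bochner_Integration.integrable_bound)
  show "integrable M (\<lambda>x. (norm (f x))\<^sup>2 + (norm (g x))\<^sup>2)"
    using assms by simp
  show "AE x in M. norm (f x * g x) \<le> norm ((norm (f x))\<^sup>2 + (norm (g x))\<^sup>2)"
  proof (rule AE_I2)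
    fix x
    have "norm (f x * g x) \<le> norm (f x) * norm (g x)" by (rule norm_mult_ineq)
    also have "\<dots> \<le> 2 * norm (f x) * norm (g x)" by simp
    also have "\<dots> \<le> (norm (f x))\<^sup>2 + (norm (g x))\<^sup>2" by (rule sum_squares_bound)
    finally show "norm (f x * g x) \<le> norm ((norm (f x))\<^sup>2 + (norm (g x))\<^sup>2)" by simp
  qed
qed measurable

lemma borel_measurable_cnj [measurable (raw)]:
  "f \<in> borel_measurable M \<Longrightarrow> (\<lambda>x. cnj (f x)) \<in> borel_measurable M"
  using measurable_compose[OF _ borel_measurable_continuous_onI[OF continuous_on_cnj[OF continuous_on_id]]]
  by blast

text \<open>Cauchy-Schwarz for nonnegative integrals bounds the squared error by \<open>c\<close>
  times the mean-square error. The estimate lives in \<open>ennreal\<close>, so it stays valid for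
  those \<open>n\<close> whose mean-square error is infinite; finiteness of \<open>c\<close> carries
  the limit through.\<close>

lemma L2_tendsto_integral_mult:
  fixes X :: "nat \<Rightarrow> 'a \<Rightarrow> complex"
  assumes [measurable]: "\<And>n. X n \<in> borel_measurable M" "Y \<in> borel_measurable M" "Z \<in> borel_measurable M"
    and Z: "integrable M (\<lambda>\<omega>. (norm (Z \<omega>))\<^sup>2)"
    and XZ: "\<And>n. integrable M (\<lambda>\<omega>. X n \<omega> * Z \<omega>)" and YZ: "integrable M (\<lambda>\<omega>. Y \<omega> * Z \<omega>)"
    and lim: "(\<lambda>n. \<integral>\<^sup>+\<omega>. ennreal ((norm (Y \<omega> - X n \<omega>))\<^sup>2) \<partial>M) \<longlonglongrightarrow> 0"
  shows "(\<lambda>n. \<integral>\<omega>. X n \<omega> * Z \<omega> \<partial>M) \<longlonglongrightarrow> (\<integral>\<omega>. Y \<omega> * Z \<omega> \<partial>M)"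
proof -
  define d where "d = (\<lambda>n. (\<integral>\<omega>. Y \<omega> * Z \<omega> \<partial>M) - (\<integral>\<omega>. X n \<omega> * Z \<omega> \<partial>M))"
  define c where "c = (\<integral>\<^sup>+\<omega>. (ennreal (norm (Z \<omega>)))\<^sup>2 \<partial>M)"
  have c: "c < top"
    using Z unfolding c_def integrable_iff_bounded by (simp add: ennreal_power)
  have bound: "ennreal ((norm (d n))\<^sup>2) \<le> c * (\<integral>\<^sup>+\<omega>. ennreal ((norm (Y \<omega> - X n \<omega>))\<^sup>2) \<partial>M)" for n
  proof -
    have "d n = (\<integral>\<omega>. (Y \<omega> - X n \<omega>) * Z \<omega> \<partial>M)"
      unfolding d_def by (simp add: Bochner_Integration.integral_diff[OF YZ XZ] left_diff_distrib)
    then have "ennreal (norm (d n)) \<le> (\<integral>\<^sup>+\<omega>. norm ((Y \<omega> - X n \<omega>) * Z \<omega>) \<partial>M)"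
      using integral_norm_bound_ennreal[of M "\<lambda>\<omega>. (Y \<omega> - X n \<omega>) * Z \<omega>"] XZ YZ
      by (simp add: left_diff_distrib)
    also have "\<dots> = (\<integral>\<^sup>+\<omega>. ennreal (norm (Z \<omega>)) * ennreal (norm (Y \<omega> - X n \<omega>)) \<partial>M)"
      by (simp add: norm_mult ennreal_mult mult.commute)
    finally have "(ennreal (norm (d n)))\<^sup>2 \<le>
        (\<integral>\<^sup>+\<omega>. ennreal (norm (Z \<omega>)) * ennreal (norm (Y \<omega> - X n \<omega>)) \<partial>M)\<^sup>2"
      by (rule power_mono) simp
    also have "\<dots> \<le> c * (\<integral>\<^sup>+\<omega>. (ennreal (norm (Y \<omega> - X n \<omega>)))\<^sup>2 \<partial>M)"
      unfolding c_def by (rule Cauchy_Schwarz_nn_integral) measurable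
    finally show ?thesis by (simp add: ennreal_power)
  qed
  have "(\<lambda>n. c * (\<integral>\<^sup>+\<omega>. ennreal ((norm (Y \<omega> - X n \<omega>))\<^sup>2) \<partial>M)) \<longlonglongrightarrow> c * 0"
    by (rule ennreal_tendsto_cmult[OF c lim])
  then have "(\<lambda>n. c * (\<integral>\<^sup>+\<omega>. ennreal ((norm (Y \<omega> - X n \<omega>))\<^sup>2) \<partial>M)) \<longlonglongrightarrow> 0"
    by simp
  then have "(\<lambda>n. ennreal ((norm (d n))\<^sup>2)) \<longlonglongrightarrow> 0"
    by (rule tendsto_sandwich[OF _ _ tendsto_const, rotated 2]) (simp_all add: bound)
  then have "(\<lambda>n. (norm (d n))\<^sup>2) \<longlonglongrightarrow> 0"
    by (subst (asm) ennreal_tendsto_0_iff) simp_all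
  then have "(\<lambda>n. sqrt ((norm (d n))\<^sup>2)) \<longlonglongrightarrow> sqrt 0" by (rule tendsto_real_sqrt)
  then have "d \<longlonglongrightarrow> 0" by (simp add: tendsto_norm_zero_iff)
  then have "(\<lambda>n. (\<integral>\<omega>. Y \<omega> * Z \<omega> \<partial>M) - d n) \<longlonglongrightarrow> (\<integral>\<omega>. Y \<omega> * Z \<omega> \<partial>M) - 0"
    by (intro tendsto_intros)
  then show ?thesis by (simp add: d_def)
qed

interpretation sphere_pair: finite_measure "sphere_measure \<Otimes>\<^sub>M sphere_measure"
  by (rule finite_measure_pair_measure) unfold_locales

interpretation sphere_pair: pair_sigma_finite sphere_measure sphere_measure
  by unfold_locales

text \<open>In these second countable spaces the product of the Borel sigma-algebras is the Borel
  sigma-algebra of the product, and continuity is then used on the subset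
  \<open>\<S> \<times> \<S>\<close>.\<close>

lemma borel_measurable_sphere_pair:
  assumes "continuous_on (\<S> \<times> \<S>) f"
  shows "f \<in> borel_measurable (sphere_measure \<Otimes>\<^sub>M sphere_measure)"
proof -
  have id: "(\<lambda>x. x) \<in> sphere_measure \<rightarrow>\<^sub>M borel"
    by (rule borel_measurable_sphere) (rule continuous_on_id)
  have "(\<lambda>p. (fst p, snd p)) \<in> sphere_measure \<Otimes>\<^sub>M sphere_measure \<rightarrow>\<^sub>M borel \<Otimes>\<^sub>M borel"
    by (intro measurable_Pair measurable_compose[OF measurable_fst id] measurable_compose[OF measurable_snd id])
  then have "(\<lambda>p. p) \<in> sphere_measure \<Otimes>\<^sub>M sphere_measure \<rightarrow>\<^sub>M restrict_space borel (\<S> \<times> \<S>)"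
    by (intro measurable_restrict_space2) (auto simp: borel_prod space_pair_measure)
  from measurable_compose[OF this borel_measurable_continuous_on_restrict[OF assms]] show ?thesis .
qed

lemma integrable_sphere_pair:
  fixes f :: "_ \<Rightarrow> 'b::{banach, second_countable_topology}"
  assumes "continuous_on (\<S> \<times> \<S>) f"
  shows "integrable (sphere_measure \<Otimes>\<^sub>M sphere_measure) f"
proof -
  from continuous_on_compact_norm_le[OF compact_Times[OF compact_sphere compact_sphere] assms]
  obtain B where "\<forall>p\<in>\<S> \<times> \<S>. norm (f p) \<le> B" ..
  note B = bspec[OF this]
  show ?thesis
  proof (rule sphere_pair.integrable_const_bound)
    show "AE p in sphere_measure \<Otimes>\<^sub>M sphere_measure. norm (f p) \<le> B"
      by (rule AE_I2, rule B) (simp add: space_pair_measure)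
  qed (rule borel_measurable_sphere_pair[OF assms])
qed

section \<open>Fubini for the field and the expansion of its covariance\<close>

context spherical_random_field
begin

lemma field_cov_eq:
  assumes "x \<in> \<S>" "y \<in> \<S>"
  shows "field_cov M T x y = (\<integral>\<omega>. T x \<omega> * T y \<omega> \<partial>M)"
  unfolding field_cov_def using zero_mean[OF assms(1)] zero_mean[OF assms(2)] by simp

lemma continuous_on_field_cov:
  assumes "continuous_on A f" "continuous_on A g" "f ` A \<subseteq> \<S>" "g ` A \<subseteq> \<S>"
  shows "continuous_on A (\<lambda>a. field_cov M T (f a) (g a))"
  using continuous_on_compose2[OF continuous_cov continuous_on_Pair[OF assms(1,2)]] assms(3,4)
  by auto

lemma integrable_field_mult:
  assumes "x \<in> \<S>" "y \<in> \<S>"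
  shows "integrable M (\<lambda>\<omega>. T x \<omega> * T y \<omega>)"
  using assms by (intro square_integrable_mult measurable_at) (auto simp: second_order simp del: mem_sphere_0)

text \<open>A product is dominated by the sum of the two squares, whose expectations are variances,
  and the variance is continuous on the compact sphere. The uniform bound supplies absolute
  integrability for Fubini.\<close>

lemma abs_product_bound:
  "\<exists>B. \<forall>x\<in>\<S>. \<forall>y\<in>\<S>. (\<integral>\<omega>. \<bar>T x \<omega> * T y \<omega>\<bar> \<partial>M) \<le> B"
proof -
  have "continuous_on \<S> (\<lambda>x. field_cov M T x x)"
    by (rule continuous_on_field_cov) (auto intro: continuous_on_id)
  from continuous_on_compact_norm_le[OF compact_sphere this]
  obtain B where "\<forall>x\<in>\<S>. norm (field_cov M T x x) \<le> B" ..
  note B = bspec[OF this]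
  have "(\<integral>\<omega>. \<bar>T x \<omega> * T y \<omega>\<bar> \<partial>M) \<le> B + B" if xy: "x \<in> \<S>" "y \<in> \<S>" for x y
  proof -
    have "(\<integral>\<omega>. \<bar>T x \<omega> * T y \<omega>\<bar> \<partial>M) \<le> (\<integral>\<omega>. T x \<omega> * T x \<omega> + T y \<omega> * T y \<omega> \<partial>M)"
    proof (rule integral_mono)
      show "integrable M (\<lambda>\<omega>. \<bar>T x \<omega> * T y \<omega>\<bar>)" using integrable_field_mult[OF xy] by simp
      show "integrable M (\<lambda>\<omega>. T x \<omega> * T x \<omega> + T y \<omega> * T y \<omega>)"
        using integrable_field_mult xy by (simp del: mem_sphere_0)
      fix \<omega>
      show "\<bar>T x \<omega> * T y \<omega>\<bar> \<le> T x \<omega> * T x \<omega> + T y \<omega> * T y \<omega>"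
      proof -
        have "2 * \<bar>T x \<omega> * T y \<omega>\<bar> \<le> T x \<omega> * T x \<omega> + T y \<omega> * T y \<omega>"
          using sum_squares_bound[of "\<bar>T x \<omega>\<bar>" "\<bar>T y \<omega>\<bar>"]
          by (simp add: abs_mult power2_eq_square mult.assoc)
        then show ?thesis using abs_ge_zero[of "T x \<omega> * T y \<omega>"] by linarith
      qed
    qed
    also have "\<dots> = field_cov M T x x + field_cov M T y y"
      unfolding field_cov_eq[OF xy(1) xy(1)] field_cov_eq[OF xy(2) xy(2)]
      by (intro Bochner_Integration.integral_add integrable_field_mult xy)
    also have "\<dots> \<le> B + B" using B[OF xy(1)] B[OF xy(2)] by simp
    finally show ?thesis .
  qed
  then show ?thesis by blast
qed

lemma measurable_field_swap [measurable]: "(\<lambda>(x, \<omega>). T x \<omega>) \<in> borel_measurable (sphere_measure \<Otimes>\<^sub>M M)"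
  using measurable_compose[OF measurable_pair_swap' measurable_field] by (simp add: case_prod_beta)

lemma measurable_harmonic_coeff [measurable]:
  assumes "\<bar>m\<bar> \<le> int l"
  shows "harmonic_coeff T l m \<in> borel_measurable M"
proof -
  have [measurable]: "sph_harmonic l m \<in> borel_measurable sphere_measure"
    by (rule borel_measurable_sphere[OF continuous_on_sph_harmonic[OF assms]])
  note [measurable] = measurable_field
  show ?thesis unfolding harmonic_coeff_def
    by (rule sphere_measure.borel_measurable_lebesgue_integral) measurable
qed

text \<open>Fubini on \<open>\<S> \<times> \<S> \<times> \<Omega>\<close>: the triple integral
  converges absolutely because \<open>abs_product_bound\<close> and the bounds on \<open>g\<close>
  and \<open>h\<close> are uniform and the surface measure is finite. With a conjugated harmonic for
  \<open>g\<close> and a harmonic for \<open>h\<close> this expresses the spectral coefficients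
  through the covariance.\<close>

lemma
  fixes g h :: "real^3 \<Rightarrow> complex"
  assumes g: "continuous_on \<S> g" and h: "continuous_on \<S> h"
  shows integrable_linear_functional_product:
      "integrable M (\<lambda>\<omega>. (\<integral>x. of_real (T x \<omega>) * g x \<partial>sphere_measure) * (\<integral>y. of_real (T y \<omega>) * h y \<partial>sphere_measure))"
      (is "integrable M ?P")
    and integral_linear_functional_product:
      "(\<integral>\<omega>. (\<integral>x. of_real (T x \<omega>) * g x \<partial>sphere_measure) * (\<integral>y. of_real (T y \<omega>) * h y \<partial>sphere_measure) \<partial>M)
        = (\<integral>(x, y). of_real (field_cov M T x y) * (g x * h y) \<partial>(sphere_measure \<Otimes>\<^sub>M sphere_measure))"
proof -
  let ?S = "sphere_measure \<Otimes>\<^sub>M sphere_measure"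
  interpret P: pair_sigma_finite ?S M by unfold_locales
  have [measurable]: "g \<in> borel_measurable sphere_measure" "h \<in> borel_measurable sphere_measure"
    by (intro borel_measurable_sphere g h)+
  define F where "F = (\<lambda>((x, y), \<omega>). complex_of_real (T x \<omega> * T y \<omega>) * (g x * h y))"
  have Tx: "(\<lambda>p. T (fst (fst p)) (snd p)) \<in> borel_measurable (?S \<Otimes>\<^sub>M M)"
  proof -
    have "(\<lambda>p. case (fst (fst p), snd p) of (x, \<omega>) \<Rightarrow> T x \<omega>) \<in> borel_measurable (?S \<Otimes>\<^sub>M M)"
      by (rule measurable_compose[OF _ measurable_field_swap]) measurable
    then show ?thesis by simp
  qed
  have Ty: "(\<lambda>p. T (snd (fst p)) (snd p)) \<in> borel_measurable (?S \<Otimes>\<^sub>M M)"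
  proof -
    have "(\<lambda>p. case (snd (fst p), snd p) of (x, \<omega>) \<Rightarrow> T x \<omega>) \<in> borel_measurable (?S \<Otimes>\<^sub>M M)"
      by (rule measurable_compose[OF _ measurable_field_swap]) measurable
    then show ?thesis by simp
  qed
  have gm: "(\<lambda>p. g (fst (fst p))) \<in> borel_measurable (?S \<Otimes>\<^sub>M M)"
    and hm: "(\<lambda>p. h (snd (fst p))) \<in> borel_measurable (?S \<Otimes>\<^sub>M M)"
    by measurable
  have F[measurable]: "F \<in> borel_measurable (?S \<Otimes>\<^sub>M M)"
    unfolding F_def case_prod_unfold of_real_mult
    by (intro borel_measurable_times gm hm measurable_compose[OF Tx borel_measurable_of_real]
        measurable_compose[OF Ty borel_measurable_of_real])
  from continuous_on_compact_norm_le[OF compact_sphere g]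
  obtain Bg where "\<forall>x\<in>\<S>. norm (g x) \<le> Bg" ..
  note Bg = bspec[OF this]
  from continuous_on_compact_norm_le[OF compact_sphere h]
  obtain Bh where "\<forall>x\<in>\<S>. norm (h x) \<le> Bh" ..
  note Bh = bspec[OF this]
  from abs_product_bound
  obtain B where "\<forall>x\<in>\<S>. \<forall>y\<in>\<S>. (\<integral>\<omega>. \<bar>T x \<omega> * T y \<omega>\<bar> \<partial>M) \<le> B" ..
  note B = bspec[OF bspec[OF this]]
  have intF: "integrable (?S \<Otimes>\<^sub>M M) F"
  proof (rule P.Fubini_integrable[OF F])
    show "integrable ?S (\<lambda>p. \<integral>\<omega>. norm (F (p, \<omega>)) \<partial>M)"
    proof (rule sphere_pair.integrable_const_bound[where B = "B * (Bg * Bh)"])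
      show "AE p in ?S. norm (\<integral>\<omega>. norm (F (p, \<omega>)) \<partial>M) \<le> B * (Bg * Bh)"
      proof (rule AE_I2)
        fix p assume "p \<in> space ?S"
        then obtain x y where p: "p = (x, y)" and xy: "x \<in> \<S>" "y \<in> \<S>" by (auto simp: space_pair_measure)
        have "(\<integral>\<omega>. norm (F (p, \<omega>)) \<partial>M) = (\<integral>\<omega>. \<bar>T x \<omega> * T y \<omega>\<bar> \<partial>M) * (norm (g x) * norm (h y))"
          by (simp add: p F_def norm_mult abs_mult)
        also have "\<dots> \<le> B * (Bg * Bh)"
          using B[OF xy] Bg[OF xy(1)] Bh[OF xy(2)]
          by (intro mult_mono mult_nonneg_nonneg norm_ge_zero order_trans[OF norm_ge_zero Bg[OF xy(1)]]
              order_trans[OF Bochner_Integration.integral_nonneg B[OF xy]]) auto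
        finally show "norm (\<integral>\<omega>. norm (F (p, \<omega>)) \<partial>M) \<le> B * (Bg * Bh)" by simp
      qed
    qed measurable
    show "AE p in ?S. integrable M (\<lambda>\<omega>. F (p, \<omega>))"
    proof (rule AE_I2)
      fix p assume "p \<in> space ?S"
      then obtain x y where p: "p = (x, y)" and xy: "x \<in> \<S>" "y \<in> \<S>" by (auto simp: space_pair_measure)
      show "integrable M (\<lambda>\<omega>. F (p, \<omega>))"
        unfolding p F_def using integrable_field_mult[OF xy]
        by (auto intro!: integrable_mult_left simp del: of_real_mult)
    qed
  qed
  have "AE \<omega> in M. integrable ?S (\<lambda>p. F (p, \<omega>))"
    using P.AE_integrable_snd[of "\<lambda>p \<omega>. F (p, \<omega>)"] intF by simp
  \<comment> \<open>The double integral factors wherever the section at \<open>\<omega>\<close> is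
    integrable. On the exceptional null set the Bochner integral may take its default value
    \<open>0\<close>, so equality holds only almost everywhere.\<close>
  then have AE: "AE \<omega> in M. (\<integral>p. F (p, \<omega>) \<partial>?S) = ?P \<omega>"
  proof eventually_elim
    case (elim \<omega>)
    have "(\<integral>p. F (p, \<omega>) \<partial>?S) = (\<integral>x. \<integral>y. F ((x, y), \<omega>) \<partial>sphere_measure \<partial>sphere_measure)"
      by (rule sphere_pair.integral_fst'[symmetric, OF elim])
    also have "\<dots> = (\<integral>x. \<integral>y. (of_real (T x \<omega>) * g x) * (of_real (T y \<omega>) * h y) \<partial>sphere_measure \<partial>sphere_measure)"
      by (simp add: F_def mult_ac)
    also have "\<dots> = ?P \<omega>" by simp
    finally show ?case .
  qed
  have meas: "?P \<in> borel_measurable M"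
  proof -
    have "(\<lambda>\<omega>. \<integral>x. of_real (T x \<omega>) * f x \<partial>sphere_measure) \<in> borel_measurable M"
      if [measurable]: "f \<in> borel_measurable sphere_measure" for f :: "real^3 \<Rightarrow> complex"
    proof (rule sphere_measure.borel_measurable_lebesgue_integral)
      note [measurable] = measurable_field
      show "(\<lambda>(\<omega>, x). complex_of_real (T x \<omega>) * f x) \<in> borel_measurable (M \<Otimes>\<^sub>M sphere_measure)"
        by measurable
    qed
    then show ?thesis by (intro borel_measurable_times) measurable
  qed
  have int: "integrable M (\<lambda>\<omega>. \<integral>p. F (p, \<omega>) \<partial>?S)"
    using P.integrable_snd[of "\<lambda>p \<omega>. F (p, \<omega>)"] intF by simp
  show "integrable M ?P"
    using integrable_cong_AE[OF _ meas AE] int by (auto dest: borel_measurable_integrable)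
  have "(\<integral>\<omega>. ?P \<omega> \<partial>M) = (\<integral>\<omega>. \<integral>p. F (p, \<omega>) \<partial>?S \<partial>M)"
    using AE by (intro integral_cong_AE meas borel_measurable_integrable[OF int]) auto
  also have "\<dots> = (\<integral>p. \<integral>\<omega>. F (p, \<omega>) \<partial>M \<partial>?S)"
    using P.Fubini_integral[of "\<lambda>p \<omega>. F (p, \<omega>)"] intF by simp
  also have "\<dots> = (\<integral>(x, y). of_real (field_cov M T x y) * (g x * h y) \<partial>?S)"
  proof (rule Bochner_Integration.integral_cong[OF refl])
    fix p assume "p \<in> space ?S"
    then obtain x y where p: "p = (x, y)" and xy: "x \<in> \<S>" "y \<in> \<S>" by (auto simp: space_pair_measure)
    have "(\<integral>\<omega>. F (p, \<omega>) \<partial>M) = (\<integral>\<omega>. complex_of_real (T x \<omega> * T y \<omega>) \<partial>M) * (g x * h y)"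
      unfolding p F_def by (simp del: of_real_mult)
    then show "(\<integral>\<omega>. F (p, \<omega>) \<partial>M) = (case p of (x, y) \<Rightarrow> of_real (field_cov M T x y) * (g x * h y))"
      by (simp only: integral_complex_of_real field_cov_eq[OF xy] p prod.case)
  qed
  finally show "(\<integral>\<omega>. ?P \<omega> \<partial>M) = (\<integral>(x, y). of_real (field_cov M T x y) * (g x * h y) \<partial>?S)" .
qed

lemma cnj_harmonic_coeff:
  "cnj (harmonic_coeff T l m \<omega>) = (\<integral>x. of_real (T x \<omega>) * sph_harmonic l m x \<partial>sphere_measure)"
  unfolding harmonic_coeff_def by (simp flip: Bochner_Integration.integral_cnj)

lemma
  assumes "\<bar>m\<bar> \<le> int l" "\<bar>m'\<bar> \<le> int l'"
  shows integrable_harmonic_coeff_mult: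
      "integrable M (\<lambda>\<omega>. harmonic_coeff T l m \<omega> * cnj (harmonic_coeff T l' m' \<omega>))"
    and spectral_coeff_eq: "spectral_coeff M T l l' m m' =
      (\<integral>(x, y). of_real (field_cov M T x y) * (cnj (sph_harmonic l m x) * sph_harmonic l' m' y)
        \<partial>(sphere_measure \<Otimes>\<^sub>M sphere_measure))"
proof -
  have "continuous_on \<S> (\<lambda>x. cnj (sph_harmonic l m x))"
    by (intro continuous_intros continuous_on_sph_harmonic assms)
  note * = this continuous_on_sph_harmonic[OF assms(2)]
  show "integrable M (\<lambda>\<omega>. harmonic_coeff T l m \<omega> * cnj (harmonic_coeff T l' m' \<omega>))"
    using integrable_linear_functional_product[OF *] unfolding cnj_harmonic_coeff
    unfolding harmonic_coeff_def .
  show "spectral_coeff M T l l' m m' =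
      (\<integral>(x, y). of_real (field_cov M T x y) * (cnj (sph_harmonic l m x) * sph_harmonic l' m' y)
        \<partial>(sphere_measure \<Otimes>\<^sub>M sphere_measure))"
    using integral_linear_functional_product[OF *] unfolding spectral_coeff_def cnj_harmonic_coeff
    unfolding harmonic_coeff_def .
qed

lemma square_integrable_harmonic_coeff:
  assumes "\<bar>m\<bar> \<le> int l"
  shows "integrable M (\<lambda>\<omega>. (cmod (harmonic_coeff T l m \<omega>))\<^sup>2)"
  using integrable_norm[OF integrable_harmonic_coeff_mult[OF assms assms]]
  by (simp add: norm_mult power2_eq_square)

definition spectral_term :: "real^3 \<Rightarrow> real^3 \<Rightarrow> nat \<Rightarrow> nat \<Rightarrow> complex" where
  "spectral_term x y l l' = (\<Sum>m = -int l..int l. \<Sum>m' = -int l'..int l'.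
     spectral_coeff M T l l' m m' * sph_harmonic l m x * cnj (sph_harmonic l' m' y))"

text \<open>\<open>L_2\<close> convergence is used twice: expanding the field at \<open>y\<close>
  against a fixed coefficient gives the inner series over \<open>l'\<close>, and expanding it at
  \<open>x\<close> against \<open>T y\<close> gives the outer one. The link is \<open>b l m\<close>,
  the limit of an inner series and a coefficient of the outer. This order of limits is the reason
  for an iterated sum.\<close>

lemma spectral_expansion:
  assumes x: "x \<in> \<S>" and y: "y \<in> \<S>"
  shows spectral_term_summable: "summable (spectral_term x y l)"
    and spectral_term_sums: "(\<lambda>l. \<Sum>l'. spectral_term x y l l') sums of_real (field_cov M T x y)"
proof -
  define b where "b = (\<lambda>l m. \<integral>\<omega>. of_real (T y \<omega>) * harmonic_coeff T l m \<omega> \<partial>M)"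
  have Ty: "(\<lambda>\<omega>. complex_of_real (T y \<omega>)) \<in> borel_measurable M" using measurable_at[OF y] by measurable
  have Ty2: "integrable M (\<lambda>\<omega>. (norm (complex_of_real (T y \<omega>)))\<^sup>2)"
    using second_order[OF y] by simp
  have aT: "integrable M (\<lambda>\<omega>. of_real (T y \<omega>) * harmonic_coeff T l m \<omega>)" if "\<bar>m\<bar> \<le> int l" for l m
    by (intro square_integrable_mult Ty Ty2 measurable_harmonic_coeff square_integrable_harmonic_coeff that)
  have meas_sum: "harmonic_partial_sum T L x \<in> borel_measurable M" for L x
    unfolding harmonic_partial_sum_def
    by (intro borel_measurable_sum borel_measurable_times measurable_harmonic_coeff) auto
  have inner: "(\<lambda>l'. spectral_term x y l l') sums (\<Sum>m = -int l..int l. sph_harmonic l m x * b l m)" for l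
  proof -
    have "(\<lambda>l'. \<Sum>m' = -int l'..int l'. spectral_coeff M T l l' m m' * cnj (sph_harmonic l' m' y)) sums b l m"
      if m: "\<bar>m\<bar> \<le> int l" for m
    proof -
      \<comment> \<open>The field is real, so the conjugated partial sums converge to it as well,
        and they bring in the conjugated coefficients that \<open>spectral_coeff\<close>
        contains.\<close>
      have mult: "cnj (harmonic_partial_sum T L y \<omega>) * harmonic_coeff T l m \<omega> = (\<Sum>l'\<le>L. \<Sum>m' = -int l'..int l'.
          (harmonic_coeff T l m \<omega> * cnj (harmonic_coeff T l' m' \<omega>)) * cnj (sph_harmonic l' m' y))" for L \<omega>
        by (simp add: harmonic_partial_sum_def sum_distrib_left sum_distrib_right mult_ac)
      have int: "integrable M (\<lambda>\<omega>. (harmonic_coeff T l m \<omega> * cnj (harmonic_coeff T l' m' \<omega>)) * cnj (sph_harmonic l' m' y))"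
        if "\<bar>m'\<bar> \<le> int l'" for l' m'
        by (intro integrable_mult_left integrable_harmonic_coeff_mult m that)
      have "(\<lambda>L. \<integral>\<omega>. cnj (harmonic_partial_sum T L y \<omega>) * harmonic_coeff T l m \<omega> \<partial>M) \<longlonglongrightarrow> b l m"
        unfolding b_def
      proof (rule L2_tendsto_integral_mult)
        show "(\<lambda>\<omega>. cnj (harmonic_partial_sum T L y \<omega>)) \<in> borel_measurable M" for L
          using meas_sum[of L y] by (rule borel_measurable_cnj)
        show "integrable M (\<lambda>\<omega>. cnj (harmonic_partial_sum T L y \<omega>) * harmonic_coeff T l m \<omega>)" for L
          unfolding mult by (intro Bochner_Integration.integrable_sum int) auto
        have "norm (complex_of_real (T y \<omega>) - cnj (harmonic_partial_sum T L y \<omega>))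
            = norm (complex_of_real (T y \<omega>) - harmonic_partial_sum T L y \<omega>)" for L \<omega>
          by (metis complex_cnj_complex_of_real complex_cnj_diff complex_mod_cnj)
        then show "(\<lambda>L. \<integral>\<^sup>+\<omega>. ennreal ((norm (complex_of_real (T y \<omega>) - cnj (harmonic_partial_sum T L y \<omega>)))\<^sup>2) \<partial>M)
            \<longlonglongrightarrow> 0"
          using expansion_pointwise_L2[OF y] by simp
      qed (intro Ty measurable_harmonic_coeff m square_integrable_harmonic_coeff aT)+
      also have "(\<lambda>L. \<integral>\<omega>. cnj (harmonic_partial_sum T L y \<omega>) * harmonic_coeff T l m \<omega> \<partial>M) =
         (\<lambda>L. \<Sum>l'\<le>L. \<Sum>m' = -int l'..int l'. spectral_coeff M T l l' m m' * cnj (sph_harmonic l' m' y))"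
      proof
        fix L
        show "(\<integral>\<omega>. cnj (harmonic_partial_sum T L y \<omega>) * harmonic_coeff T l m \<omega> \<partial>M) =
          (\<Sum>l'\<le>L. \<Sum>m' = -int l'..int l'. spectral_coeff M T l l' m m' * cnj (sph_harmonic l' m' y))"
          unfolding mult spectral_coeff_def
          by (subst Bochner_Integration.integral_sum, (intro Bochner_Integration.integrable_sum int; auto),
              rule sum.cong[OF refl], subst Bochner_Integration.integral_sum, (intro int; auto),
              rule sum.cong[OF refl]) simp
      qed
      finally show ?thesis by (simp add: sums_def_le)
    qed
    then have "(\<lambda>l'. \<Sum>m = -int l..int l. sph_harmonic l m x *
        (\<Sum>m' = -int l'..int l'. spectral_coeff M T l l' m m' * cnj (sph_harmonic l' m' y))) sums
       (\<Sum>m = -int l..int l. sph_harmonic l m x * b l m)"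
      by (intro sums_sum sums_mult) auto
    then show ?thesis by (simp add: spectral_term_def[abs_def] sum_distrib_left mult_ac)
  qed
  show "summable (spectral_term x y l)" using inner[of l] by (simp add: sums_iff)
  have mult: "harmonic_partial_sum T L x \<omega> * of_real (T y \<omega>) = (\<Sum>l\<le>L. \<Sum>m = -int l..int l.
      sph_harmonic l m x * (of_real (T y \<omega>) * harmonic_coeff T l m \<omega>))" for L \<omega>
    by (simp add: harmonic_partial_sum_def sum_distrib_left sum_distrib_right mult_ac)
  have int: "integrable M (\<lambda>\<omega>. sph_harmonic l m x * (of_real (T y \<omega>) * harmonic_coeff T l m \<omega>))"
    if "\<bar>m\<bar> \<le> int l" for l m
    by (intro integrable_mult_right aT that)
  have "(\<lambda>L. \<integral>\<omega>. harmonic_partial_sum T L x \<omega> * of_real (T y \<omega>) \<partial>M) \<longlonglongrightarrow>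
      (\<integral>\<omega>. of_real (T x \<omega>) * of_real (T y \<omega>) \<partial>M)"
  proof (rule L2_tendsto_integral_mult)
    show "(\<lambda>\<omega>. complex_of_real (T x \<omega>)) \<in> borel_measurable M" using measurable_at[OF x] by measurable
    show "integrable M (\<lambda>\<omega>. complex_of_real (T x \<omega>) * complex_of_real (T y \<omega>))"
      using integrable_field_mult[OF x y] by (simp flip: of_real_mult)
    show "integrable M (\<lambda>\<omega>. harmonic_partial_sum T L x \<omega> * complex_of_real (T y \<omega>))" for L
      unfolding mult by (intro Bochner_Integration.integrable_sum int) auto
  qed (intro Ty Ty2 meas_sum expansion_pointwise_L2 x)+
  also have "(\<integral>\<omega>. complex_of_real (T x \<omega>) * of_real (T y \<omega>) \<partial>M) = of_real (field_cov M T x y)"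
    unfolding field_cov_eq[OF x y] by (simp flip: of_real_mult)
  also have "(\<lambda>L. \<integral>\<omega>. harmonic_partial_sum T L x \<omega> * of_real (T y \<omega>) \<partial>M) =
      (\<lambda>L. \<Sum>l\<le>L. \<Sum>m = -int l..int l. sph_harmonic l m x * b l m)"
  proof
    fix L
    show "(\<integral>\<omega>. harmonic_partial_sum T L x \<omega> * of_real (T y \<omega>) \<partial>M) =
       (\<Sum>l\<le>L. \<Sum>m = -int l..int l. sph_harmonic l m x * b l m)"
      unfolding mult b_def
      by (subst Bochner_Integration.integral_sum, (intro Bochner_Integration.integrable_sum int; auto),
          rule sum.cong[OF refl], subst Bochner_Integration.integral_sum, (intro int; auto),
          rule sum.cong[OF refl]) simp
  qed
  finally have "(\<lambda>l. \<Sum>m = -int l..int l. sph_harmonic l m x * b l m) sums of_real (field_cov M T x y)"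
    by (simp add: sums_def_le)
  also have "(\<lambda>l. \<Sum>m = -int l..int l. sph_harmonic l m x * b l m) = (\<lambda>l. \<Sum>l'. spectral_term x y l l')"
    using inner by (simp add: sums_iff fun_eq_iff)
  finally show "(\<lambda>l. \<Sum>l'. spectral_term x y l l') sums of_real (field_cov M T x y)" .
qed

end

section \<open>Axial symmetry\<close>

lemma north_pole_simps: "north_pole = sph_point 0 \<phi>" "north_pole \<bullet> sph_point \<theta> \<phi> = cos \<theta>"
  by (simp_all add: north_pole_def real3_eq_iff inner_sphere)

lemma south_pole_simps: "south_pole = sph_point pi \<phi>" "south_pole \<bullet> sph_point \<theta> \<phi> = - cos \<theta>"
  by (simp_all add: south_pole_def real3_eq_iff inner_sphere)

lemma polar_rotation_matrix:
  "\<exists>R :: real^3^3. rotation_matrix R \<and> (\<forall>x. R *v x = polar_rotation \<alpha> x)"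
proof (intro exI conjI allI)
  define R :: "real^3^3" where
    "R = vector [vector [cos \<alpha>, - sin \<alpha>, 0], vector [sin \<alpha>, cos \<alpha>, 0], vector [0, 0, 1]]"
  have "sin \<alpha> * sin \<alpha> + cos \<alpha> * cos \<alpha> = 1"
    using sin_cos_squared_add[of \<alpha>] by (simp only: power2_eq_square)
  then show "rotation_matrix R"
    unfolding rotation_matrix_def orthogonal_matrix_def
    by (simp add: R_def det_3 vec_eq_iff forall_3 matrix_matrix_mult_def transpose_def mat_def sum_3)
  show "R *v x = polar_rotation \<alpha> x" for x
    by (simp add: R_def vec_eq_iff forall_3 matrix_vector_mult_def sum_3 polar_rotation_def)
qed

text \<open>The fixed pole determines the third column. The third row is a unit vector whose last
  entry is \<open>1\<close>, so its other entries vanish, and a planar rotation block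
  remains.\<close>

lemma rotation_matrix_fixing_pole:
  assumes "rotation_matrix R" "R *v north_pole = north_pole"
  shows "\<exists>\<alpha>. \<forall>x. R *v x = polar_rotation \<alpha> x"
proof -
  have fix3: "R $ 1 $ 3 = 0" "R $ 2 $ 3 = 0" "R $ 3 $ 3 = 1"
    using assms(2)
    by (simp_all add: north_pole_def sph_point_def vec_eq_iff forall_3 matrix_vector_mult_def sum_3)
  have "R ** transpose R = mat 1" "det R = 1"
    using assms(1) by (simp_all add: rotation_matrix_def orthogonal_matrix_def)
  then have orth: "R $ 1 $ 1 * R $ 1 $ 1 + R $ 1 $ 2 * R $ 1 $ 2 = 1"
    "R $ 2 $ 1 * R $ 1 $ 1 + R $ 2 $ 2 * R $ 1 $ 2 = 0"
    "R $ 3 $ 1 * R $ 3 $ 1 + R $ 3 $ 2 * R $ 3 $ 2 = 0"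
    and det: "R $ 1 $ 1 * R $ 2 $ 2 - R $ 1 $ 2 * R $ 2 $ 1 = 1"
    by (simp_all add: fix3 det_3 vec_eq_iff forall_3 matrix_matrix_mult_def transpose_def mat_def sum_3)
  have row3: "R $ 3 $ 1 = 0" "R $ 3 $ 2 = 0"
    using orth(3) by (simp_all add: sum_squares_eq_zero_iff)
  \<comment> \<open>The first row of the block is a unit vector; orthogonality and determinant
    \<open>1\<close> leave only its quarter turn as second row.\<close>
  have R22: "R $ 2 $ 2 = R $ 1 $ 1" using orth(1,2) det by algebra
  have R21: "R $ 2 $ 1 = - R $ 1 $ 2" using orth(1,2) det by algebra
  obtain \<alpha> where R11: "R $ 1 $ 1 = cos \<alpha>" and "- R $ 1 $ 2 = sin \<alpha>"
    using sincos_total_2pi[of "R $ 1 $ 1" "- R $ 1 $ 2"] orth(1) by (auto simp: power2_eq_square)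
  then have R12: "R $ 1 $ 2 = - sin \<alpha>" by linarith
  have "R *v x = polar_rotation \<alpha> x" for x
    by (simp add: vec_eq_iff forall_3 matrix_vector_mult_def sum_3 polar_rotation_def fix3 row3 R21 R22 R11 R12)
  then show ?thesis by blast
qed

lemma axially_symmetric_iff:
  "axially_symmetric M T \<longleftrightarrow>
    (\<forall>\<alpha>. \<forall>x\<in>\<S>. \<forall>y\<in>\<S>. field_cov M T (polar_rotation \<alpha> x) (polar_rotation \<alpha> y) = field_cov M T x y)"
  (is "_ \<longleftrightarrow> ?P")
proof
  assume ax: "axially_symmetric M T"
  show ?P
  proof (rule allI)
    fix \<alpha>
    from polar_rotation_matrix[of \<alpha>]
    obtain R :: "real^3^3" where R: "rotation_matrix R \<and> (\<forall>x. R *v x = polar_rotation \<alpha> x)" ..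
    have "R *v north_pole = north_pole"
      using R by (simp add: real3_eq_iff north_pole_def)
    with ax R show "\<forall>x\<in>\<S>. \<forall>y\<in>\<S>. field_cov M T (polar_rotation \<alpha> x) (polar_rotation \<alpha> y) = field_cov M T x y"
      unfolding axially_symmetric_def by metis
  qed
next
  assume P: ?P
  show "axially_symmetric M T"
    unfolding axially_symmetric_def
  proof (intro allI impI, elim conjE)
    fix R :: "real^3^3" assume "rotation_matrix R" "R *v north_pole = north_pole"
    from rotation_matrix_fixing_pole[OF this] obtain \<alpha> where "\<forall>x. R *v x = polar_rotation \<alpha> x" ..
    with P show "\<forall>x\<in>\<S>. \<forall>y\<in>\<S>. field_cov M T (R *v x) (R *v y) = field_cov M T x y" by simp
  qed
qed

lemma axially_symmetric_coord_iff:
  "axially_symmetric M T \<longleftrightarrow>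
    (\<forall>\<theta>1\<in>{0..pi}. \<forall>\<phi>1. \<forall>\<theta>2\<in>{0..pi}. \<forall>\<phi>2. \<forall>\<alpha>.
      field_cov M T (sph_point \<theta>1 (\<phi>1 + \<alpha>)) (sph_point \<theta>2 (\<phi>2 + \<alpha>)) =
      field_cov M T (sph_point \<theta>1 \<phi>1) (sph_point \<theta>2 \<phi>2))" (is "_ \<longleftrightarrow> ?P")
proof
  assume "axially_symmetric M T"
  then show ?P
    unfolding axially_symmetric_iff polar_rotation_sph_point[symmetric] using sph_point_in_sphere by blast
next
  assume P: ?P
  show "axially_symmetric M T"
    unfolding axially_symmetric_iff
  proof (intro allI ballI)
    fix \<alpha> x y assume "x \<in> \<S>" "y \<in> \<S>"
    then obtain \<theta>1 \<phi>1 \<theta>2 \<phi>2 where "\<theta>1 \<in> {0..pi}" "x = sph_point \<theta>1 \<phi>1" "\<theta>2 \<in> {0..pi}" "y = sph_point \<theta>2 \<phi>2"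
      by (meson sphere_coordinates)
    with P show "field_cov M T (polar_rotation \<alpha> x) (polar_rotation \<alpha> y) = field_cov M T x y"
      by (simp add: polar_rotation_sph_point)
  qed
qed

lemma isotropic_imp_axially_symmetric:
  assumes "isotropic M T"
  shows "axially_symmetric M T"
proof -
  obtain f where "\<And>x y. x \<in> \<S> \<Longrightarrow> y \<in> \<S> \<Longrightarrow> field_cov M T x y = f (great_circle_dist x y)"
    using assms unfolding isotropic_def by blast
  note f = this
  show ?thesis
    unfolding axially_symmetric_def
  proof (intro allI impI ballI, elim conjE)
    fix R :: "real^3^3" and x y assume R: "rotation_matrix R" and xy: "x \<in> \<S>" "y \<in> \<S>"
    have R: "(R *v v) \<bullet> (R *v w) = v \<bullet> w" for v w
      using R orthogonal_transformation_matrix[of "(*v) R"]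
      by (simp add: rotation_matrix_def orthogonal_transformation_def)
    then have "R *v x \<in> \<S>" "R *v y \<in> \<S>" using xy by (simp_all add: norm_eq_1)
    from f[OF this] f[OF xy] show "field_cov M T (R *v x) (R *v y) = field_cov M T x y"
      by (simp only: great_circle_dist_def R)
  qed
qed

text \<open>A pole may be written with any longitude. Rotating by the longitude of \<open>x\<close>
  therefore leaves the pole in place and reduces \<open>x\<close> to the zero meridian, where only
  its colatitude, or equivalently its distance from the pole, is left.\<close>

lemma axially_symmetric_points_of_isotropy:
  assumes "axially_symmetric M T"
  shows "point_of_isotropy M T north_pole" "point_of_isotropy M T south_pole"
proof -
  have ax: "field_cov M T (sph_point \<theta>1 (0 + \<alpha>)) (sph_point \<theta>2 (0 + \<alpha>)) =
      field_cov M T (sph_point \<theta>1 0) (sph_point \<theta>2 0)" if "\<theta>1 \<in> {0..pi}" "\<theta>2 \<in> {0..pi}" for \<theta>1 \<theta>2 \<alpha>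
    using assms that unfolding axially_symmetric_coord_iff by blast
  show "point_of_isotropy M T north_pole"
    unfolding point_of_isotropy_def
  proof (intro exI ballI)
    fix x assume "x \<in> \<S>"
    then obtain \<theta> \<phi> where x: "\<theta> \<in> {0..pi}" "x = sph_point \<theta> \<phi>" by (rule sphere_coordinates)
    show "field_cov M T north_pole x = (\<lambda>t. field_cov M T north_pole (sph_point t 0)) (great_circle_dist north_pole x)"
      using ax[of 0 \<theta> \<phi>] x
      by (simp add: great_circle_dist_def north_pole_simps arccos_cos) (metis north_pole_simps(1))
  qed
  show "point_of_isotropy M T south_pole"
    unfolding point_of_isotropy_def
  proof (intro exI ballI)
    fix x assume "x \<in> \<S>"
    then obtain \<theta> \<phi> where x: "\<theta> \<in> {0..pi}" "x = sph_point \<theta> \<phi>" by (rule sphere_coordinates)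
    have "arccos (- cos \<theta>) = pi - \<theta>" using x arccos_cos[of "pi - \<theta>"] by (simp add: cos_diff)
    then show "field_cov M T south_pole x = (\<lambda>t. field_cov M T south_pole (sph_point (pi - t) 0)) (great_circle_dist south_pole x)"
      using ax[of pi \<theta> \<phi>] x
      by (simp add: great_circle_dist_def south_pole_simps) (metis south_pole_simps(1))
  qed
qed

section \<open>The spectrum and the series of an axially symmetric field\<close>

lemma integral_sphere_pair_rotation:
  fixes f :: "(real^3) \<times> (real^3) \<Rightarrow> complex"
  assumes f: "continuous_on (\<S> \<times> \<S>) f" and \<alpha>: "0 \<le> \<alpha>" "\<alpha> \<le> 2 * pi"
  shows "(\<integral>p. f (polar_rotation \<alpha> (fst p), polar_rotation \<alpha> (snd p)) \<partial>(sphere_measure \<Otimes>\<^sub>M sphere_measure)) =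
    (\<integral>p. f p \<partial>(sphere_measure \<Otimes>\<^sub>M sphere_measure))"
proof -
  let ?R = "polar_rotation \<alpha>"
  have rot: "continuous_on (\<S> \<times> \<S>) (\<lambda>p. f (g p))"
    if "continuous_on (\<S> \<times> \<S>) g" "g ` (\<S> \<times> \<S>) \<subseteq> \<S> \<times> \<S>" for g
    using continuous_on_compose2[OF f that] .
  have R: "continuous_on A (\<lambda>p. ?R (g p))" if "continuous_on A g" for A and g :: "(real^3) \<times> (real^3) \<Rightarrow> real^3"
    using continuous_on_compose2[OF continuous_on_polar_rotation[of UNIV] that] by simp
  have c1: "continuous_on (\<S> \<times> \<S>) (\<lambda>p. f (fst p, ?R (snd p)))"
    using polar_rotation_in_sphere by (intro rot continuous_intros R) fastforce
  have c2: "continuous_on (\<S> \<times> \<S>) (\<lambda>p. f (?R (fst p), ?R (snd p)))"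
    using polar_rotation_in_sphere by (intro rot continuous_intros R) fastforce
  have "(\<integral>p. f p \<partial>(sphere_measure \<Otimes>\<^sub>M sphere_measure)) = (\<integral>x. \<integral>y. f (x, y) \<partial>sphere_measure \<partial>sphere_measure)"
    by (rule sphere_pair.integral_fst'[symmetric, OF integrable_sphere_pair[OF f]])
  also have "\<dots> = (\<integral>x. \<integral>y. f (x, ?R y) \<partial>sphere_measure \<partial>sphere_measure)"
  proof (rule Bochner_Integration.integral_cong[OF refl])
    fix x assume "x \<in> space sphere_measure"
    then have "(\<lambda>y. f (x, y)) \<in> borel_measurable sphere_measure"
      by (intro borel_measurable_sphere continuous_on_compose2[OF f] continuous_intros) auto
    then show "(\<integral>y. f (x, y) \<partial>sphere_measure) = (\<integral>y. f (x, ?R y) \<partial>sphere_measure)"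
      by (rule integral_polar_rotation[OF \<alpha>, symmetric])
  qed
  also have "\<dots> = (\<integral>x. \<integral>y. f (?R x, ?R y) \<partial>sphere_measure \<partial>sphere_measure)"
  proof (rule integral_polar_rotation[OF \<alpha>, symmetric])
    show "(\<lambda>x. \<integral>y. f (x, ?R y) \<partial>sphere_measure) \<in> borel_measurable sphere_measure"
      using borel_measurable_sphere_pair[OF c1]
      by (intro sphere_measure.borel_measurable_lebesgue_integral) (simp add: case_prod_unfold)
  qed
  also have "\<dots> = (\<integral>p. f (?R (fst p), ?R (snd p)) \<partial>(sphere_measure \<Otimes>\<^sub>M sphere_measure))"
    using sphere_pair.integral_fst'[OF integrable_sphere_pair[OF c2]] by simp
  finally show ?thesis by simp
qed

lemma continuous_on_harmonic_kernel:
  assumes "\<bar>m\<bar> \<le> int l" "\<bar>m'\<bar> \<le> int l'" "continuous_on (\<S> \<times> \<S>) (\<lambda>p. F (fst p) (snd p))"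
  shows "continuous_on (\<S> \<times> \<S>) (\<lambda>p. complex_of_real (F (fst p) (snd p)) *
     (cnj (sph_harmonic l m (fst p)) * sph_harmonic l' m' (snd p)))"
  by (intro continuous_on_mult continuous_on_of_real continuous_on_cnj assms
      continuous_on_compose2[OF continuous_on_sph_harmonic[OF assms(1)]]
      continuous_on_compose2[OF continuous_on_sph_harmonic[OF assms(2)]] continuous_on_fst continuous_on_snd
      continuous_on_id) auto

context spherical_random_field
begin

text \<open>A simultaneous rotation by the \<open>half_turn\<close> angle preserves the product
  measure and the covariance but reverses the sign of the product of harmonics, so the coefficient
  equals its own negative.\<close>

lemma axially_symmetric_spectral_coeff:
  assumes ax: "axially_symmetric M T" and m: "\<bar>m\<bar> \<le> int l" "\<bar>m'\<bar> \<le> int l'" and "m \<noteq> m'"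
  shows "spectral_coeff M T l l' m m' = 0"
proof -
  let ?S = "sphere_measure \<Otimes>\<^sub>M sphere_measure"
  define \<alpha> where "\<alpha> = pi / real_of_int \<bar>m - m'\<bar>"
  note \<alpha> = half_turn[OF \<open>m \<noteq> m'\<close>, folded \<alpha>_def]
  let ?f = "\<lambda>p. complex_of_real (field_cov M T (fst p) (snd p)) *
     (cnj (sph_harmonic l m (fst p)) * sph_harmonic l' m' (snd p))"
  have f: "continuous_on (\<S> \<times> \<S>) ?f"
    using continuous_cov by (intro continuous_on_harmonic_kernel m) (simp add: case_prod_unfold)
  have eq: "spectral_coeff M T l l' m m' = (\<integral>p. ?f p \<partial>?S)"
    unfolding spectral_coeff_eq[OF m] by (simp add: case_prod_unfold)
  also have "\<dots> = (\<integral>p. ?f (polar_rotation \<alpha> (fst p), polar_rotation \<alpha> (snd p)) \<partial>?S)"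
    by (rule integral_sphere_pair_rotation[OF f \<alpha>(1,2), symmetric])
  also have "\<dots> = (\<integral>p. - ?f p \<partial>?S)"
  proof (rule Bochner_Integration.integral_cong[OF refl])
    fix p assume "p \<in> space ?S"
    then have p: "fst p \<in> \<S>" "snd p \<in> \<S>" by (auto simp: space_pair_measure)
    have cov: "field_cov M T (polar_rotation \<alpha> (fst p)) (polar_rotation \<alpha> (snd p)) = field_cov M T (fst p) (snd p)"
      using ax p unfolding axially_symmetric_iff by blast
    have "?f (polar_rotation \<alpha> (fst p), polar_rotation \<alpha> (snd p)) =
       cnj (cis (of_int m * \<alpha>) * cis (- (of_int m' * \<alpha>))) * ?f p"
      unfolding fst_conv snd_conv cov sph_harmonic_polar_rotation[OF p(1) m(1)] sph_harmonic_polar_rotation[OF p(2) m(2)]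
      by (simp add: cis_cnj del: cis_mult)
    then show "?f (polar_rotation \<alpha> (fst p), polar_rotation \<alpha> (snd p)) = - ?f p"
      unfolding \<alpha>(3) by simp
  qed
  also have "\<dots> = - spectral_coeff M T l l' m m'" unfolding eq by simp
  finally show ?thesis by simp
qed

lemma axially_symmetric_imp_order_diagonal:
  assumes "axially_symmetric M T"
  shows "order_diagonal_spectrum M T (\<lambda>l l' m. spectral_coeff M T l l' m m)"
  unfolding order_diagonal_spectrum_def using axially_symmetric_spectral_coeff[OF assms] by simp

text \<open>The Kronecker symbol keeps only orders admissible for both degrees, which gives the
  range up to \<open>min l l'\<close>. The two normalising roots multiply to the single root with
  \<open>16 * pi^2\<close>, and the longitudes combine into their difference.\<close>

lemma order_diagonal_spectral_term:
  assumes c: "order_diagonal_spectrum M T c" and \<theta>: "\<theta>1 \<in> {0..pi}" "\<theta>2 \<in> {0..pi}"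
  shows "spectral_term (sph_point \<theta>1 \<phi>1) (sph_point \<theta>2 \<phi>2) l l' = axial_term c \<theta>1 \<phi>1 \<theta>2 \<phi>2 l l'"
proof -
  let ?Y = "\<lambda>m. sph_harmonic l m (sph_point \<theta>1 \<phi>1)" and ?Y' = "\<lambda>m. sph_harmonic l' m (sph_point \<theta>2 \<phi>2)"
  have C: "spectral_coeff M T l l' m m' = (if m = m' then c l l' m else 0)"
    if "m \<in> {-int l..int l}" "m' \<in> {-int l'..int l'}" for m m'
    using c that unfolding order_diagonal_spectrum_def by (simp add: abs_le_iff)
  have "spectral_term (sph_point \<theta>1 \<phi>1) (sph_point \<theta>2 \<phi>2) l l' =
      (\<Sum>m = -int l..int l. \<Sum>m' = -int l'..int l'. if m = m' then c l l' m * ?Y m * cnj (?Y' m) else 0)"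
    unfolding spectral_term_def by (intro sum.cong refl) (simp add: C)
  also have "\<dots> = (\<Sum>m = -int l..int l. if m \<in> {-int l'..int l'} then c l l' m * ?Y m * cnj (?Y' m) else 0)"
    by (intro sum.cong refl) (simp add: sum.delta')
  also have "\<dots> = (\<Sum>m \<in> {-int l..int l} \<inter> {-int l'..int l'}. c l l' m * ?Y m * cnj (?Y' m))"
    by (rule sum.inter_restrict[symmetric]) simp
  also have "{-int l..int l} \<inter> {-int l'..int l'} = {-int (min l l')..int (min l l')}"
    by (auto simp: min_def)
  also have "(\<Sum>m \<in> {-int (min l l')..int (min l l')}. c l l' m * ?Y m * cnj (?Y' m)) = axial_term c \<theta>1 \<phi>1 \<theta>2 \<phi>2 l l'"
    unfolding axial_term_def
  proof (rule sum.cong[OF refl])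
    fix m assume "m \<in> {-int (min l l')..int (min l l')}"
    then have m: "\<bar>m\<bar> \<le> int l" "\<bar>m\<bar> \<le> int l'" by auto
    let ?N = "\<lambda>l. (2 * real l + 1) * fact (nat (int l - m)) / (4 * pi * fact (nat (int l + m)))"
    have e: "exp (\<i> * of_int m * of_real \<phi>1) * cnj (exp (\<i> * of_int m * of_real \<phi>2)) =
       exp (\<i> * of_int m * of_real (\<phi>1 - \<phi>2))"
    proof -
      have "cnj (exp (\<i> * of_int m * of_real \<phi>2)) = exp (- (\<i> * of_int m * of_real \<phi>2))"
        by (simp add: exp_cnj)
      then show ?thesis by (simp add: mult_exp_exp algebra_simps)
    qed
    have s: "sqrt (((2 * real l + 1) * fact (nat (int l - m)) * (2 * real l' + 1) * fact (nat (int l' - m))) /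
        (16 * pi\<^sup>2 * fact (nat (int l + m)) * fact (nat (int l' + m)))) = sqrt (?N l) * sqrt (?N l')"
      unfolding real_sqrt_mult[symmetric] by (simp add: power2_eq_square mult_ac)
    have "c l l' m * ?Y m * cnj (?Y' m) = of_real (sqrt (?N l) * sqrt (?N l')) * c l l' m *
       (exp (\<i> * of_int m * of_real \<phi>1) * cnj (exp (\<i> * of_int m * of_real \<phi>2))) *
       of_real (assoc_legendre l m (cos \<theta>1) * assoc_legendre l' m (cos \<theta>2))"
      unfolding sph_harmonic_sph_point[OF \<theta>(1) m(1)] sph_harmonic_sph_point[OF \<theta>(2) m(2)] sph_harmonic_coord_def
      by (simp only: complex_cnj_mult complex_cnj_complex_of_real of_real_mult mult_ac)
    then show "c l l' m * ?Y m * cnj (?Y' m) =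
        of_real (sqrt (((2 * real l + 1) * fact (nat (int l - m)) * (2 * real l' + 1) * fact (nat (int l' - m))) /
        (16 * pi\<^sup>2 * fact (nat (int l + m)) * fact (nat (int l' + m))))) * c l l' m *
        exp (\<i> * of_int m * of_real (\<phi>1 - \<phi>2)) *
        of_real (assoc_legendre l m (cos \<theta>1) * assoc_legendre l' m (cos \<theta>2))"
      unfolding e s .
  qed
  finally show ?thesis .
qed

lemma order_diagonal_imp_axial_representation:
  assumes c: "order_diagonal_spectrum M T c"
  shows "axial_representation M T c"
  unfolding axial_representation_def
proof (intro ballI allI conjI)
  fix \<theta>1 \<phi>1 \<theta>2 \<phi>2 :: real assume \<theta>: "\<theta>1 \<in> {0..pi}" "\<theta>2 \<in> {0..pi}"
  have eq: "axial_term c \<theta>1 \<phi>1 \<theta>2 \<phi>2 l = spectral_term (sph_point \<theta>1 \<phi>1) (sph_point \<theta>2 \<phi>2) l" for l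
    by (rule ext) (rule order_diagonal_spectral_term[OF c \<theta>, symmetric])
  show "summable (axial_term c \<theta>1 \<phi>1 \<theta>2 \<phi>2 l)" for l
    unfolding eq by (rule spectral_term_summable[OF sph_point_in_sphere sph_point_in_sphere])
  show "(\<lambda>l. \<Sum>l'. axial_term c \<theta>1 \<phi>1 \<theta>2 \<phi>2 l l') sums
      complex_of_real (field_cov M T (sph_point \<theta>1 \<phi>1) (sph_point \<theta>2 \<phi>2))"
    unfolding eq by (rule spectral_term_sums[OF sph_point_in_sphere sph_point_in_sphere])
qed

end

lemma axial_representation_imp_axially_symmetric:
  assumes "axial_representation M T c"
  shows "axially_symmetric M T"
  unfolding axially_symmetric_coord_iff
proof (intro ballI allI)
  fix \<theta>1 \<phi>1 \<theta>2 \<phi>2 \<alpha> :: real assume \<theta>: "\<theta>1 \<in> {0..pi}" "\<theta>2 \<in> {0..pi}"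
  have *: "(\<lambda>l. \<Sum>l'. axial_term c \<theta>1 \<phi>1 \<theta>2 \<phi>2 l l') sums
      complex_of_real (field_cov M T (sph_point \<theta>1 \<phi>1) (sph_point \<theta>2 \<phi>2))" for \<phi>1 \<phi>2
    using assms \<theta> unfolding axial_representation_def by blast
  have "axial_term c \<theta>1 (\<phi>1 + \<alpha>) \<theta>2 (\<phi>2 + \<alpha>) = axial_term c \<theta>1 \<phi>1 \<theta>2 \<phi>2"
    unfolding axial_term_def by simp
  with *[of "\<phi>1 + \<alpha>" "\<phi>2 + \<alpha>"] *[of \<phi>1 \<phi>2]
  have "complex_of_real (field_cov M T (sph_point \<theta>1 (\<phi>1 + \<alpha>)) (sph_point \<theta>2 (\<phi>2 + \<alpha>))) =
      complex_of_real (field_cov M T (sph_point \<theta>1 \<phi>1) (sph_point \<theta>2 \<phi>2))"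
    using sums_unique2 by metis
  then show "field_cov M T (sph_point \<theta>1 (\<phi>1 + \<alpha>)) (sph_point \<theta>2 (\<phi>2 + \<alpha>)) =
      field_cov M T (sph_point \<theta>1 \<phi>1) (sph_point \<theta>2 \<phi>2)"
    by (simp only: of_real_eq_iff)
qed

section \<open>Isotropy\<close>

definition kernel_coeff :: "(real \<Rightarrow> real) \<Rightarrow> nat \<Rightarrow> nat \<Rightarrow> int \<Rightarrow> int \<Rightarrow> complex" where
  "kernel_coeff g l l' m m' = (\<integral>p. of_real (g (fst p \<bullet> snd p)) *
     (cnj (sph_harmonic l m (fst p)) * sph_harmonic l' m' (snd p)) \<partial>(sphere_measure \<Otimes>\<^sub>M sphere_measure))"

text \<open>The Funk-Hecke property in terms of coefficients. That \<open>e\<close> depends on the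
  degree alone is the spectral mark of isotropy.\<close>

definition degree_diagonal_kernel :: "(real \<Rightarrow> real) \<Rightarrow> bool" where
  "degree_diagonal_kernel g \<longleftrightarrow> (\<exists>e. \<forall>l l' m m'. \<bar>m\<bar> \<le> int l \<and> \<bar>m'\<bar> \<le> int l' \<longrightarrow>
     kernel_coeff g l l' m m' = (if l = l' \<and> m = m' then e l else 0))"

lemma inner_sphere_bounds:
  assumes "x \<in> \<S>" "y \<in> \<S>"
  shows "x \<bullet> y \<in> {-1..1}"
  using Cauchy_Schwarz_ineq2[of x y] assms by (simp add: abs_le_iff)

lemma continuous_on_inner_kernel:
  fixes g :: "real \<Rightarrow> real"
  assumes "continuous_on {-1..1} g"
  shows "continuous_on (\<S> \<times> \<S>) (\<lambda>p. g (fst p \<bullet> snd p))"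
proof (rule continuous_on_compose2[OF assms])
  show "(\<lambda>p. fst p \<bullet> snd p) ` (\<S> \<times> \<S>) \<subseteq> {-1..1}"
    using inner_sphere_bounds by force
qed (intro continuous_intros)

lemma integrable_kernel:
  assumes "\<bar>m\<bar> \<le> int l" "\<bar>m'\<bar> \<le> int l'" "continuous_on {-1..1} g"
  shows "integrable (sphere_measure \<Otimes>\<^sub>M sphere_measure) (\<lambda>p. complex_of_real (g (fst p \<bullet> snd p)) *
     (cnj (sph_harmonic l m (fst p)) * sph_harmonic l' m' (snd p)))"
  by (intro integrable_sphere_pair continuous_on_harmonic_kernel[where F = "\<lambda>x y. g (x \<bullet> y)"]
      continuous_on_inner_kernel assms)

lemma kernel_coeff_add:
  assumes "\<bar>m\<bar> \<le> int l" "\<bar>m'\<bar> \<le> int l'" "continuous_on {-1..1} g" "continuous_on {-1..1} h"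
  shows "kernel_coeff (\<lambda>t. g t + h t) l l' m m' = kernel_coeff g l l' m m' + kernel_coeff h l l' m m'"
  unfolding kernel_coeff_def of_real_add distrib_right
  by (rule Bochner_Integration.integral_add) (intro integrable_kernel assms)+

lemma kernel_coeff_scale:
  "kernel_coeff (\<lambda>t. c * g t) l l' m m' = of_real c * kernel_coeff g l l' m m'"
  unfolding kernel_coeff_def of_real_mult mult.assoc by (rule integral_mult_right_zero)

lemma degree_diagonal_kernel_add:
  assumes g: "continuous_on {-1..1} g" "degree_diagonal_kernel g"
    and h: "continuous_on {-1..1} h" "degree_diagonal_kernel h"
  shows "degree_diagonal_kernel (\<lambda>t. g t + h t)"
proof -
  obtain d where d: "\<forall>l l' m m'. \<bar>m\<bar> \<le> int l \<and> \<bar>m'\<bar> \<le> int l' \<longrightarrow>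
     kernel_coeff g l l' m m' = (if l = l' \<and> m = m' then d l else 0)"
    using g(2) unfolding degree_diagonal_kernel_def ..
  obtain e where e: "\<forall>l l' m m'. \<bar>m\<bar> \<le> int l \<and> \<bar>m'\<bar> \<le> int l' \<longrightarrow>
     kernel_coeff h l l' m m' = (if l = l' \<and> m = m' then e l else 0)"
    using h(2) unfolding degree_diagonal_kernel_def ..
  show ?thesis
    unfolding degree_diagonal_kernel_def
  proof (intro exI allI impI, elim conjE)
    fix l l' m m' assume m: "\<bar>m\<bar> \<le> int l" "\<bar>m'\<bar> \<le> int l'"
    show "kernel_coeff (\<lambda>t. g t + h t) l l' m m' = (if l = l' \<and> m = m' then (\<lambda>l. d l + e l) l else 0)"
      unfolding kernel_coeff_add[OF m g(1) h(1)] using d e m by simp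
  qed
qed

lemma degree_diagonal_kernel_scale:
  assumes "degree_diagonal_kernel g"
  shows "degree_diagonal_kernel (\<lambda>t. c * g t)"
proof -
  obtain d where d: "\<forall>l l' m m'. \<bar>m\<bar> \<le> int l \<and> \<bar>m'\<bar> \<le> int l' \<longrightarrow>
     kernel_coeff g l l' m m' = (if l = l' \<and> m = m' then d l else 0)"
    using assms unfolding degree_diagonal_kernel_def ..
  show ?thesis
    unfolding degree_diagonal_kernel_def
  proof (intro exI allI impI, elim conjE)
    fix l l' m m' assume m: "\<bar>m\<bar> \<le> int l" "\<bar>m'\<bar> \<le> int l'"
    show "kernel_coeff (\<lambda>t. c * g t) l l' m m' = (if l = l' \<and> m = m' then (\<lambda>l. of_real c * d l) l else 0)"
      unfolding kernel_coeff_scale using d m by simp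
  qed
qed

lemma integral_sphere_pair_mult:
  fixes a b :: "real^3 \<Rightarrow> complex"
  assumes "continuous_on \<S> a" "continuous_on \<S> b"
  shows "integrable (sphere_measure \<Otimes>\<^sub>M sphere_measure) (\<lambda>p. a (fst p) * b (snd p))"
    and "(\<integral>p. a (fst p) * b (snd p) \<partial>(sphere_measure \<Otimes>\<^sub>M sphere_measure)) =
      (\<integral>x. a x \<partial>sphere_measure) * (\<integral>y. b y \<partial>sphere_measure)"
proof -
  show int: "integrable (sphere_measure \<Otimes>\<^sub>M sphere_measure) (\<lambda>p. a (fst p) * b (snd p))"
    by (intro integrable_sphere_pair continuous_on_mult continuous_on_compose2[OF assms(1)]
      continuous_on_compose2[OF assms(2)] continuous_intros) auto
  show "(\<integral>p. a (fst p) * b (snd p) \<partial>(sphere_measure \<Otimes>\<^sub>M sphere_measure)) =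
      (\<integral>x. a x \<partial>sphere_measure) * (\<integral>y. b y \<partial>sphere_measure)"
    using sphere_pair.integral_fst'[OF int, symmetric] by simp
qed

text \<open>By the addition theorem, the Legendre kernel of degree \<open>k\<close> is a multiple of the orthogonal
  projection onto the harmonics of degree \<open>k\<close>.\<close>

lemma degree_diagonal_kernel_legendre: "degree_diagonal_kernel (poly (legendre_poly k))"
proof -
  \<comment> \<open>\<open>K\<close> is the factor in \<open>sph_harmonic_addition\<close>, and
    \<open>\<nu>\<close> below is the squared norm common to all harmonics of degree
    \<open>k\<close>.\<close>
  define K where "K = (2 * real k + 1) / (4 * pi) * poly (legendre_poly k) 1"
  define \<nu> where "\<nu> = (2 * real k + 1) / (4 * pi) * legendre_product_integral 0 k k"
  have "2 * real k + 1 \<noteq> 0" by linarith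
  then have K: "K \<noteq> 0" using legendre_poly_1_nonzero[of k] by (simp add: K_def)
  have "degree_diagonal_kernel (\<lambda>t. K * poly (legendre_poly k) t)"
    unfolding degree_diagonal_kernel_def
  proof (intro exI allI impI, elim conjE)
    fix l l' m m' assume m: "\<bar>m\<bar> \<le> int l" "\<bar>m'\<bar> \<le> int l'"
    let ?S = "sphere_measure \<Otimes>\<^sub>M sphere_measure"
    let ?a = "\<lambda>\<mu> x. sph_harmonic k \<mu> x * cnj (sph_harmonic l m x)"
    let ?b = "\<lambda>\<mu> x. sph_harmonic l' m' x * cnj (sph_harmonic k \<mu> x)"
    have c: "continuous_on \<S> (?a \<mu>)" "continuous_on \<S> (?b \<mu>)" if "\<mu> \<in> {-int k..int k}" for \<mu>
      using that m by (intro continuous_on_mult continuous_on_cnj continuous_on_sph_harmonic; simp add: abs_le_iff)+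
    have "kernel_coeff (\<lambda>t. K * poly (legendre_poly k) t) l l' m m' =
        (\<integral>p. (\<Sum>\<mu> = -int k..int k. ?a \<mu> (fst p) * ?b \<mu> (snd p)) \<partial>?S)"
      unfolding kernel_coeff_def
    proof (rule Bochner_Integration.integral_cong[OF refl])
      fix p assume "p \<in> space ?S"
      then have p: "fst p \<in> \<S>" "snd p \<in> \<S>" by (auto simp: space_pair_measure)
      show "of_real (K * poly (legendre_poly k) (fst p \<bullet> snd p)) * (cnj (sph_harmonic l m (fst p)) *
          sph_harmonic l' m' (snd p)) = (\<Sum>\<mu> = -int k..int k. ?a \<mu> (fst p) * ?b \<mu> (snd p))"
        unfolding K_def sph_harmonic_addition[OF p, symmetric] sum_distrib_right
        by (intro sum.cong refl) (simp only: mult_ac)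
    qed
    also have "\<dots> = (\<Sum>\<mu> = -int k..int k. \<integral>p. ?a \<mu> (fst p) * ?b \<mu> (snd p) \<partial>?S)"
      by (intro Bochner_Integration.integral_sum integral_sphere_pair_mult c)
    also have "\<dots> = (\<Sum>\<mu> = -int k..int k. (\<integral>x. ?a \<mu> x \<partial>sphere_measure) * (\<integral>x. ?b \<mu> x \<partial>sphere_measure))"
      by (intro sum.cong refl integral_sphere_pair_mult c)
    also have "\<dots> = (\<Sum>\<mu> = -int k..int k. if \<mu> = m then
        (if k = l \<and> k = l' \<and> m = m' then (of_real \<nu>)\<^sup>2 else 0) else 0)"
    proof (intro sum.cong refl)
      fix \<mu> assume "\<mu> \<in> {-int k..int k}"
      then have \<mu>: "\<bar>\<mu>\<bar> \<le> int k" by auto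
      show "(\<integral>x. ?a \<mu> x \<partial>sphere_measure) * (\<integral>x. ?b \<mu> x \<partial>sphere_measure) =
        (if \<mu> = m then (if k = l \<and> k = l' \<and> m = m' then (of_real \<nu>)\<^sup>2 else 0) else 0)"
        unfolding sph_harmonic_orthogonal[OF \<mu> m(1)] sph_harmonic_orthogonal[OF m(2) \<mu>]
        by (auto simp: \<nu>_def power2_eq_square)
    qed
    also have "\<dots> = (if l = l' \<and> m = m' then (\<lambda>l. if k = l then (of_real \<nu>)\<^sup>2 else 0) l else 0)"
      using m by (auto simp: sum.delta' abs_le_iff)
    finally show "kernel_coeff (\<lambda>t. K * poly (legendre_poly k) t) l l' m m' =
      (if l = l' \<and> m = m' then (\<lambda>l. if k = l then (of_real \<nu>)\<^sup>2 else 0) l else 0)" .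
  qed
  from degree_diagonal_kernel_scale[OF this, of "1 / K"] show ?thesis using K by simp
qed

text \<open>The Legendre polynomials have exact degrees, so subtracting a suitable multiple of one
  of them cancels the leading term.\<close>

lemma degree_diagonal_kernel_poly: "degree_diagonal_kernel (poly p)"
proof (induction "degree p" arbitrary: p rule: less_induct)
  case less
  let ?P = "legendre_poly (degree p)"
  define c where "c = lead_coeff p / lead_coeff ?P"
  define q where "q = p - smult c ?P"
  have lP: "lead_coeff ?P \<noteq> 0" using legendre_poly_nonzero by simp
  have "coeff q (degree p) = 0"
    using lP by (simp add: q_def c_def degree_legendre_poly)
  moreover have "degree q \<le> degree p"
    unfolding q_def by (intro degree_diff_le) (simp_all add: degree_legendre_poly degree_smult_le[THEN order_trans])
  \<comment> \<open>The case \<open>q = 0\<close> stands apart because the degree cannot drop when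
    \<open>p\<close> is constant.\<close>
  ultimately have "q = 0 \<or> degree q < degree p"
    by (metis le_neq_implies_less leading_coeff_0_iff)
  then have q: "degree_diagonal_kernel (poly q)"
  proof
    assume "q = 0"
    then show ?thesis
      using degree_diagonal_kernel_scale[OF degree_diagonal_kernel_legendre, of 0 0] by (simp add: poly_0[abs_def])
  qed (rule less)
  have "degree_diagonal_kernel (\<lambda>t. poly q t + c * poly ?P t)"
    by (intro degree_diagonal_kernel_add q degree_diagonal_kernel_scale degree_diagonal_kernel_legendre
        continuous_intros)
  also have "(\<lambda>t. poly q t + c * poly ?P t) = poly p"
    by (simp add: q_def)
  finally show ?case .
qed

lemma polynomial_approximation:
  fixes g :: "real \<Rightarrow> real"
  assumes "continuous_on {-1..1} g" "0 < e"
  shows "\<exists>p. \<forall>t\<in>{-1..1}. \<bar>g t - poly p t\<bar> < e"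
proof -
  obtain f where f: "real_polynomial_function f" "\<And>t. t \<in> {-1..1} \<Longrightarrow> \<bar>g t - f t\<bar> < e"
    using Stone_Weierstrass_real_polynomial_function[OF compact_Icc assms] by metis
  obtain a n where "f = (\<lambda>t. \<Sum>i\<le>n. a i * t ^ i)"
    using f(1) unfolding real_polynomial_function_iff_sum by blast
  then have "f = poly (\<Sum>i\<le>n. monom (a i) i)"
    by (simp add: fun_eq_iff poly_sum poly_monom)
  with f(2) show ?thesis by blast
qed

text \<open>A uniform error in the kernel changes a coefficient by at most that error times the
  integral \<open>W\<close> of the absolute product of harmonics. Each coefficient is thus a limit
  of coefficients of polynomial kernels.\<close>

lemma degree_diagonal_kernel_continuous:
  assumes g: "continuous_on {-1..1} g"
  shows "degree_diagonal_kernel g"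
proof -
  let ?S = "sphere_measure \<Otimes>\<^sub>M sphere_measure"
  have "\<forall>n. \<exists>p. \<forall>t\<in>{-1..1}. \<bar>g t - poly p t\<bar> < inverse (real (Suc n))"
    by (intro allI polynomial_approximation g) simp
  from choice[OF this] obtain p where p: "\<forall>n. \<forall>t\<in>{-1..1}. \<bar>g t - poly (p n) t\<bar> < inverse (real (Suc n))" ..
  have "\<forall>n. \<exists>e. \<forall>l l' m m'. \<bar>m\<bar> \<le> int l \<and> \<bar>m'\<bar> \<le> int l' \<longrightarrow>
     kernel_coeff (poly (p n)) l l' m m' = (if l = l' \<and> m = m' then e l else 0)"
    using degree_diagonal_kernel_poly unfolding degree_diagonal_kernel_def by blast
  from choice[OF this] obtain e where e: "\<forall>n l l' m m'. \<bar>m\<bar> \<le> int l \<and> \<bar>m'\<bar> \<le> int l' \<longrightarrow>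
     kernel_coeff (poly (p n)) l l' m m' = (if l = l' \<and> m = m' then e n l else 0)" ..
  have lim: "(\<lambda>n. kernel_coeff (poly (p n)) l l' m m') \<longlonglongrightarrow> kernel_coeff g l l' m m'"
    if m: "\<bar>m\<bar> \<le> int l" "\<bar>m'\<bar> \<le> int l'" for l l' m m'
  proof -
    let ?Y = "\<lambda>p. cnj (sph_harmonic l m (fst p)) * sph_harmonic l' m' (snd p)"
    define W where "W = (\<integral>p. norm (?Y p) \<partial>?S)"
    have cp: "continuous_on {-1..1} (poly (p n))" for n by (intro continuous_intros)
    have Y: "integrable ?S (\<lambda>p. norm (?Y p))"
      using integrable_norm[OF integrable_kernel[OF m, of "\<lambda>_. 1"]] by simp
    have bound: "norm (kernel_coeff (poly (p n)) l l' m m' - kernel_coeff g l l' m m') \<le> inverse (real (Suc n)) * W" for n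
    proof -
      have "kernel_coeff (poly (p n)) l l' m m' - kernel_coeff g l l' m m' =
        (\<integral>q. of_real (poly (p n) (fst q \<bullet> snd q)) * ?Y q - of_real (g (fst q \<bullet> snd q)) * ?Y q \<partial>?S)"
        unfolding kernel_coeff_def
        by (rule Bochner_Integration.integral_diff[symmetric]) (intro integrable_kernel m cp g)+
      also have "norm \<dots> \<le> (\<integral>q. inverse (real (Suc n)) * norm (?Y q) \<partial>?S)"
      proof (rule Bochner_Integration.integral_norm_bound_integral)
        show "integrable ?S (\<lambda>q. of_real (poly (p n) (fst q \<bullet> snd q)) * ?Y q - of_real (g (fst q \<bullet> snd q)) * ?Y q)"
          by (intro Bochner_Integration.integrable_diff integrable_kernel m cp g)
        show "integrable ?S (\<lambda>q. inverse (real (Suc n)) * norm (?Y q))"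
          by (intro integrable_mult_right Y)
        fix q assume "q \<in> space ?S"
        then have "fst q \<bullet> snd q \<in> {-1..1}"
          by (intro inner_sphere_bounds) (auto simp: space_pair_measure)
        then have "\<bar>poly (p n) (fst q \<bullet> snd q) - g (fst q \<bullet> snd q)\<bar> \<le> inverse (real (Suc n))"
          using p by (metis abs_minus_commute less_imp_le)
        then have "\<bar>poly (p n) (fst q \<bullet> snd q) - g (fst q \<bullet> snd q)\<bar> * norm (?Y q) \<le> inverse (real (Suc n)) * norm (?Y q)"
          by (rule mult_right_mono) simp
        then show "norm (of_real (poly (p n) (fst q \<bullet> snd q)) * ?Y q - of_real (g (fst q \<bullet> snd q)) * ?Y q)
          \<le> inverse (real (Suc n)) * norm (?Y q)"
          unfolding left_diff_distrib[symmetric] of_real_diff[symmetric] norm_mult[of "of_real _"] norm_of_real .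
      qed
      also have "\<dots> = inverse (real (Suc n)) * W" unfolding W_def by simp
      finally show ?thesis .
    qed
    have null: "(\<lambda>n. inverse (real (Suc n)) * W) \<longlonglongrightarrow> 0"
      by (rule tendsto_mult_left_zero[OF LIMSEQ_inverse_real_of_nat])
    have "(\<lambda>n. kernel_coeff (poly (p n)) l l' m m' - kernel_coeff g l l' m m') \<longlonglongrightarrow> 0"
      by (rule Lim_null_comparison[OF always_eventually[OF allI[OF bound]] null])
    then show ?thesis by (simp add: LIM_zero_iff)
  qed
  show ?thesis
    unfolding degree_diagonal_kernel_def
  proof (intro exI allI impI, elim conjE)
    fix l l' m m' assume m: "\<bar>m\<bar> \<le> int l" "\<bar>m'\<bar> \<le> int l'"
    \<comment> \<open>Order \<open>0\<close> is admissible in every degree, so its coefficient can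
      serve as the eigenvalue: the sequence \<open>e n l\<close> converges to it and to the
      coefficient of every other order.\<close>
    show "kernel_coeff g l l' m m' = (if l = l' \<and> m = m' then (\<lambda>l. kernel_coeff g l l 0 0) l else 0)"
    proof (cases "l = l' \<and> m = m'")
      case True
      have "(\<lambda>n. e n l) \<longlonglongrightarrow> kernel_coeff g l l' m m'" using lim[OF m] e m True by simp
      moreover have "(\<lambda>n. e n l) \<longlonglongrightarrow> kernel_coeff g l l 0 0" using lim[of 0 l 0 l] e by simp
      ultimately show ?thesis using True LIMSEQ_unique by simp
    next
      case False
      have "kernel_coeff (poly (p n)) l l' m m' = 0" for n using e m False by (simp only: simp_thms if_False)
      then have "(\<lambda>n. 0) \<longlonglongrightarrow> kernel_coeff g l l' m m'" using lim[OF m] by simp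
      then show ?thesis unfolding if_not_P[OF False] using LIMSEQ_unique tendsto_const by metis
    qed
  qed
qed

section \<open>Isotropic spectra and the classification\<close>

context spherical_random_field
begin

text \<open>The profile \<open>f\<close> in the definition of isotropy comes without continuity.
  Reading the covariance along a meridian from the north pole gives a profile \<open>g\<close> in
  the variable \<open>x \<bullet> y\<close> that inherits continuity from the covariance.\<close>

lemma isotropic_spectral_coeff:
  assumes "isotropic M T"
  shows "\<exists>e. \<forall>l l' m m'. \<bar>m\<bar> \<le> int l \<and> \<bar>m'\<bar> \<le> int l' \<longrightarrow>
     spectral_coeff M T l l' m m' = (if l = l' \<and> m = m' then e l else 0)"
proof -
  obtain f where f: "\<forall>x\<in>\<S>. \<forall>y\<in>\<S>. field_cov M T x y = f (great_circle_dist x y)"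
    using assms unfolding isotropic_def ..
  define g where "g = (\<lambda>t. field_cov M T north_pole (sph_point (arccos t) 0))"
  have pole: "north_pole \<in> \<S>" unfolding north_pole_def by (rule sph_point_in_sphere)
  have "continuous_on {-1..1} (\<lambda>t. sph_point (arccos t) 0)"
  proof -
    have "continuous_on {-1..1} (\<lambda>t. case (arccos t, 0) of (\<theta>, \<phi>) \<Rightarrow> sph_point \<theta> \<phi>)"
      by (rule continuous_on_compose2[OF continuous_on_sph_point[of UNIV]])
        (intro continuous_on_Pair continuous_on_arccos' continuous_on_const, simp)
    then show ?thesis by simp
  qed
  then have g: "continuous_on {-1..1} g"
    unfolding g_def using pole sph_point_in_sphere
    by (intro continuous_on_field_cov continuous_on_const) blast+
  have cov: "field_cov M T x y = g (x \<bullet> y)" if "x \<in> \<S>" "y \<in> \<S>" for x y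
  proof -
    have t: "x \<bullet> y \<in> {-1..1}" by (rule inner_sphere_bounds[OF that])
    have "great_circle_dist north_pole (sph_point (arccos (x \<bullet> y)) 0) = great_circle_dist x y"
      using t by (simp add: great_circle_dist_def north_pole_simps)
    then show ?thesis unfolding g_def using f that pole sph_point_in_sphere by metis
  qed
  have "spectral_coeff M T l l' m m' = kernel_coeff g l l' m m'" if "\<bar>m\<bar> \<le> int l" "\<bar>m'\<bar> \<le> int l'" for l l' m m'
    unfolding spectral_coeff_eq[OF that] kernel_coeff_def
    by (rule Bochner_Integration.integral_cong[OF refl])
      (auto simp: space_pair_measure cov simp del: mem_sphere_0)
  with degree_diagonal_kernel_continuous[OF g] show ?thesis
    unfolding degree_diagonal_kernel_def by simp
qed

text \<open>Each inner series has the single term \<open>l' = l\<close>, and as \<open>e l\<close>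
  is the same for all orders, the addition theorem sums that term to a function of
  \<open>x \<bullet> y\<close>. Limits of series being unique, pairs with equal inner product have
  equal covariance.\<close>

lemma degree_diagonal_imp_isotropic:
  assumes e: "\<And>l l' m m'. \<bar>m\<bar> \<le> int l \<Longrightarrow> \<bar>m'\<bar> \<le> int l' \<Longrightarrow>
     spectral_coeff M T l l' m m' = (if l = l' \<and> m = m' then e l else 0)"
  shows "isotropic M T"
proof -
  define k where "k = (\<lambda>l t. complex_of_real ((2 * real l + 1) / (4 * pi) * poly (legendre_poly l) 1 * poly (legendre_poly l) t))"
  have st: "spectral_term x y l l' = (if l' = l then e l * k l (x \<bullet> y) else 0)"
    if xy: "x \<in> \<S>" "y \<in> \<S>" for x y l l'
  proof -
    have "spectral_term x y l l' = (\<Sum>m = -int l..int l. \<Sum>m' = -int l'..int l'.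
        if m' = m then (if l' = l then e l * (sph_harmonic l m x * cnj (sph_harmonic l m y)) else 0) else 0)"
      unfolding spectral_term_def by (intro sum.cong refl) (auto simp: e abs_le_iff)
    also have "\<dots> = (if l' = l then e l * (\<Sum>m = -int l..int l. sph_harmonic l m x * cnj (sph_harmonic l m y)) else 0)"
    proof (cases "l' = l")
      case True
      then show ?thesis
        unfolding sum_distrib_left if_P[OF True] by (intro sum.cong refl) (simp add: True)
    next
      case False
      then show ?thesis by (simp only: if_False if_cancel sum.neutral_const)
    qed
    finally show ?thesis unfolding k_def sph_harmonic_addition[OF xy] .
  qed
  have sums: "(\<lambda>l. e l * k l (x \<bullet> y)) sums of_real (field_cov M T x y)" if "x \<in> \<S>" "y \<in> \<S>" for x y
  proof -
    have "(\<Sum>l'. spectral_term x y l l') = e l * k l (x \<bullet> y)" for l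
      unfolding st[OF that] using sums_single[of l "\<lambda>l'. e l * k l (x \<bullet> y)"] by (simp add: sums_iff)
    then show ?thesis using spectral_term_sums[OF that] by simp
  qed
  have pole: "north_pole \<in> \<S>" unfolding north_pole_def by (rule sph_point_in_sphere)
  show ?thesis
    unfolding isotropic_def
  proof (intro exI ballI)
    fix x y assume xy: "x \<in> \<S>" "y \<in> \<S>"
    \<comment> \<open>The north pole and \<open>?z\<close> form a reference pair with the same inner
      product as \<open>x\<close> and \<open>y\<close>.\<close>
    let ?z = "sph_point (great_circle_dist x y) 0"
    have "north_pole \<bullet> ?z = x \<bullet> y"
      using inner_sphere_bounds[OF xy] by (simp add: great_circle_dist_def north_pole_simps)
    then have "complex_of_real (field_cov M T x y) = of_real (field_cov M T north_pole ?z)"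
      using sums[OF xy] sums[OF pole sph_point_in_sphere[of "great_circle_dist x y" 0]] sums_unique2 by metis
    then show "field_cov M T x y = (\<lambda>t. field_cov M T north_pole (sph_point t 0)) (great_circle_dist x y)"
      by (simp only: of_real_eq_iff)
  qed
qed

text \<open>Although each class chooses its own \<open>c\<close>, at admissible indices
  \<open>c\<close> is forced to equal the spectral coefficient. Classes are therefore compared
  through the spectrum, here and in the two lemmas that follow.\<close>

lemma isotropic_not_diagonal_anisotropic:
  assumes "isotropic M T"
  shows "\<not> diagonal_anisotropic M T"
proof
  assume "diagonal_anisotropic M T"
  then obtain c l m m' where c: "\<forall>l l' m m'. \<bar>m\<bar> \<le> int l \<and> \<bar>m'\<bar> \<le> int l' \<longrightarrow>
       spectral_coeff M T l l' m m' = (if l = l' \<and> m = m' then c l m else 0)"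
    and m: "\<bar>m\<bar> \<le> int l" "\<bar>m'\<bar> \<le> int l" "c l m \<noteq> c l m'"
    unfolding diagonal_anisotropic_def by blast
  obtain e where "\<forall>l l' m m'. \<bar>m\<bar> \<le> int l \<and> \<bar>m'\<bar> \<le> int l' \<longrightarrow>
     spectral_coeff M T l l' m m' = (if l = l' \<and> m = m' then e l else 0)"
    using isotropic_spectral_coeff[OF assms] ..
  with c m(1,2) have "c l m = e l" "c l m' = e l" by (metis (full_types))+
  with m(3) show False by simp
qed

lemma isotropic_not_degree_dependent:
  assumes "isotropic M T"
  shows "\<not> degree_dependent_anisotropic M T"
proof
  assume "degree_dependent_anisotropic M T"
  then obtain c l l' m where c: "order_diagonal_spectrum M T c"
    and m: "l \<noteq> l'" "\<bar>m\<bar> \<le> int (min l l')" "c l l' m \<noteq> 0"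
    unfolding degree_dependent_anisotropic_def by blast
  have ml: "\<bar>m\<bar> \<le> int l" "\<bar>m\<bar> \<le> int l'" using m(2) by auto
  obtain e where "\<forall>l l' m m'. \<bar>m\<bar> \<le> int l \<and> \<bar>m'\<bar> \<le> int l' \<longrightarrow>
     spectral_coeff M T l l' m m' = (if l = l' \<and> m = m' then e l else 0)"
    using isotropic_spectral_coeff[OF assms] ..
  then have "spectral_coeff M T l l' m m = 0" using ml m(1) by simp
  then show False using c ml m(3) unfolding order_diagonal_spectrum_def by simp
qed

lemma diagonal_not_degree_dependent:
  assumes "diagonal_anisotropic M T"
  shows "\<not> degree_dependent_anisotropic M T"
proof
  assume "degree_dependent_anisotropic M T"
  then obtain c l l' m where c: "order_diagonal_spectrum M T c"
    and m: "l \<noteq> l'" "\<bar>m\<bar> \<le> int (min l l')" "c l l' m \<noteq> 0"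
    unfolding degree_dependent_anisotropic_def by blast
  have ml: "\<bar>m\<bar> \<le> int l" "\<bar>m\<bar> \<le> int l'" using m(2) by auto
  have "spectral_coeff M T l l' m m = 0"
    using assms ml m(1) unfolding diagonal_anisotropic_def by auto
  then show False using c ml m(3) unfolding order_diagonal_spectrum_def by simp
qed

text \<open>Excluding degree dependence removes the coefficients with \<open>l \<noteq> l'\<close>;
  excluding diagonal anisotropy then makes the rest equal to their value at order \<open>0\<close>.
  What is left is the spectrum of an isotropic field.\<close>

lemma order_diagonal_classification:
  assumes c: "order_diagonal_spectrum M T c"
  shows "isotropic M T \<or> diagonal_anisotropic M T \<or> degree_dependent_anisotropic M T"
proof (rule ccontr)
  assume not: "\<not> ?thesis"
  have C: "spectral_coeff M T l l' m m' = (if m = m' then c l l' m else 0)"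
    if "\<bar>m\<bar> \<le> int l" "\<bar>m'\<bar> \<le> int l'" for l l' m m'
    using c that unfolding order_diagonal_spectrum_def by blast
  have off: "c l l' m = 0" if "l \<noteq> l'" "\<bar>m\<bar> \<le> int l" "\<bar>m\<bar> \<le> int l'" for l l' m
    using not c that unfolding degree_dependent_anisotropic_def by (metis min_def)
  have D: "spectral_coeff M T l l' m m' = (if l = l' \<and> m = m' then c l l m else 0)"
    if "\<bar>m\<bar> \<le> int l" "\<bar>m'\<bar> \<le> int l'" for l l' m m'
    using C[OF that] off[of l l' m] that by auto
  have const: "c l l m = c l l 0" if "\<bar>m\<bar> \<le> int l" for l m
  proof (rule ccontr)
    assume "c l l m \<noteq> c l l 0"
    then have "\<exists>l m m'. m \<noteq> m' \<and> \<bar>m\<bar> \<le> int l \<and> \<bar>m'\<bar> \<le> int l \<and> c l l m \<noteq> c l l m'"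
      using that by (intro exI[of _ l] exI[of _ m] exI[of _ 0]) auto
    then have "diagonal_anisotropic M T"
      unfolding diagonal_anisotropic_def using D by (intro exI[of _ "\<lambda>l m. c l l m"] conjI allI impI) auto
    with not show False by simp
  qed
  have "isotropic M T"
  proof (rule degree_diagonal_imp_isotropic)
    fix l l' m m' assume m: "\<bar>m\<bar> \<le> int l" "\<bar>m'\<bar> \<le> int l'"
    show "spectral_coeff M T l l' m m' = (if l = l' \<and> m = m' then (\<lambda>l. c l l 0) l else 0)"
      unfolding D[OF m] const[OF m(1)] ..
  qed
  with not show False by simp
qed

end

section \<open>Axial symmetry in terms of longitude derivatives\<close>

lemma differentiable_cov_longitude_derivatives:
  assumes diff: "differentiable_cov M T" and \<theta>: "\<theta>1 \<in> {0..pi}" "\<theta>2 \<in> {0..pi}"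
  defines "G \<equiv> \<lambda>\<phi>1 \<phi>2. field_cov M T (sph_point \<theta>1 \<phi>1) (sph_point \<theta>2 \<phi>2)"
  shows "\<exists>D1 D2. ((\<lambda>\<phi>. G \<phi> \<phi>2) has_real_derivative D1) (at \<phi>1) \<and>
    ((\<lambda>\<phi>. G \<phi>1 \<phi>) has_real_derivative D2) (at \<phi>2) \<and>
    ((\<lambda>t. G (\<phi>1 + t) (\<phi>2 + t)) has_real_derivative D1 + D2) (at 0)"
proof -
  let ?D = "({0..pi} \<times> UNIV) \<times> ({0..pi} \<times> UNIV) :: ((real \<times> real) \<times> (real \<times> real)) set"
  let ?F = "\<lambda>((\<theta>1, \<phi>1), (\<theta>2, \<phi>2)). field_cov M T (sph_point \<theta>1 \<phi>1) (sph_point \<theta>2 \<phi>2)"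
  \<comment> \<open>At \<open>0\<close> and \<open>pi\<close> the domain is one-sided in the
    colatitude. The curves used below vary only the longitudes, so they stay inside it and their
    derivatives in the parameter are two-sided.\<close>
  have "?F differentiable (at ((\<theta>1, \<phi>1), (\<theta>2, \<phi>2)) within ?D)"
    using diff \<theta> unfolding differentiable_cov_def differentiable_on_def by auto
  then obtain L where L: "(?F has_derivative L) (at ((\<theta>1, \<phi>1), (\<theta>2, \<phi>2)) within ?D)"
    unfolding differentiable_def ..
  interpret L: linear L using L by (rule has_derivative_linear)
  \<comment> \<open>The directions \<open>(1, 0)\<close> and \<open>(0, 1)\<close> give the partial
    derivatives, \<open>(1, 1)\<close> the simultaneous rotation; linearity of \<open>L\<close>
    makes the third derivative the sum of the other two.\<close>
  have line: "((\<lambda>t. G (a + b * t) (c + d * t)) has_real_derivative L ((0, b), (0, d))) (at s)"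
    if s: "a + b * s = \<phi>1" "c + d * s = \<phi>2" for a b c d s
  proof -
    let ?g = "\<lambda>t. ((\<theta>1, a + b * t), (\<theta>2, c + d * t))"
    have g: "(?g has_derivative (\<lambda>h. ((0, b * h), (0, d * h)))) (at s)"
      by (auto intro!: derivative_eq_intros)
    have "range ?g \<subseteq> ?D" using \<theta> by auto
    then have "(?F has_derivative L) (at (?g s) within range ?g)"
      using L s has_derivative_subset by (metis (no_types, lifting))
    from has_derivative_in_compose[OF g this]
    have "((\<lambda>t. G (a + b * t) (c + d * t)) has_derivative (\<lambda>h. L ((0, b * h), (0, d * h)))) (at s)"
      by (simp add: G_def)
    moreover have "L ((0, b * h), (0, d * h)) = L ((0, b), (0, d)) * h" for h
      using L.scaleR[of h "((0, b), (0, d))"] by (simp add: mult.commute)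
    ultimately show ?thesis by (simp add: has_field_derivative_def)
  qed
  have "L ((0, 1), (0, 1)) = L ((0, 1), (0, 0)) + L ((0, 0), (0, 1))"
    using L.add[of "((0, 1), (0, 0))" "((0, 0), (0, 1))"] by simp
  with line[of 0 1 \<phi>1 \<phi>2 0] line[of \<phi>1 0 \<phi>2 0 1] line[of \<phi>1 1 0 \<phi>2 1]
  show ?thesis by auto
qed

lemma axially_symmetric_iff_longitude_derivatives:
  assumes diff: "differentiable_cov M T"
  shows "axially_symmetric M T \<longleftrightarrow>
    (\<forall>\<theta>1\<in>{0..pi}. \<forall>\<phi>1. \<forall>\<theta>2\<in>{0..pi}. \<forall>\<phi>2.
       deriv (\<lambda>\<phi>. field_cov M T (sph_point \<theta>1 \<phi>) (sph_point \<theta>2 \<phi>2)) \<phi>1 =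
       - deriv (\<lambda>\<phi>. field_cov M T (sph_point \<theta>1 \<phi>1) (sph_point \<theta>2 \<phi>)) \<phi>2)" (is "_ \<longleftrightarrow> ?P")
proof
  assume ax: "axially_symmetric M T"
  show ?P
  proof (intro ballI allI)
    fix \<theta>1 \<phi>1 \<theta>2 \<phi>2 :: real assume \<theta>: "\<theta>1 \<in> {0..pi}" "\<theta>2 \<in> {0..pi}"
    obtain D1 D2 where D:
      "((\<lambda>\<phi>. field_cov M T (sph_point \<theta>1 \<phi>) (sph_point \<theta>2 \<phi>2)) has_real_derivative D1) (at \<phi>1)"
      "((\<lambda>\<phi>. field_cov M T (sph_point \<theta>1 \<phi>1) (sph_point \<theta>2 \<phi>)) has_real_derivative D2) (at \<phi>2)"
      "((\<lambda>t. field_cov M T (sph_point \<theta>1 (\<phi>1 + t)) (sph_point \<theta>2 (\<phi>2 + t))) has_real_derivative D1 + D2) (at 0)"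
      using differentiable_cov_longitude_derivatives[OF diff \<theta>] by blast
    have "(\<lambda>t. field_cov M T (sph_point \<theta>1 (\<phi>1 + t)) (sph_point \<theta>2 (\<phi>2 + t))) =
        (\<lambda>t. field_cov M T (sph_point \<theta>1 \<phi>1) (sph_point \<theta>2 \<phi>2))"
      using ax \<theta> unfolding axially_symmetric_coord_iff by blast
    with D(3) have "D1 + D2 = 0" using DERIV_unique DERIV_const by metis
    then show "deriv (\<lambda>\<phi>. field_cov M T (sph_point \<theta>1 \<phi>) (sph_point \<theta>2 \<phi>2)) \<phi>1 =
       - deriv (\<lambda>\<phi>. field_cov M T (sph_point \<theta>1 \<phi>1) (sph_point \<theta>2 \<phi>)) \<phi>2"
      using DERIV_imp_deriv[OF D(1)] DERIV_imp_deriv[OF D(2)] by simp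
  qed
next
  assume P: ?P
  show "axially_symmetric M T"
    unfolding axially_symmetric_coord_iff
  proof (intro ballI allI)
    fix \<theta>1 \<phi>1 \<theta>2 \<phi>2 \<alpha> :: real assume \<theta>: "\<theta>1 \<in> {0..pi}" "\<theta>2 \<in> {0..pi}"
    let ?H = "\<lambda>t. field_cov M T (sph_point \<theta>1 (\<phi>1 + t)) (sph_point \<theta>2 (\<phi>2 + t))"
    \<comment> \<open>The diagonal derivative is available at parameter \<open>0\<close> only, so
      both base longitudes are first moved by \<open>s\<close>.\<close>
    have "(?H has_real_derivative 0) (at s)" for s
    proof -
      obtain D1 D2 where D:
        "((\<lambda>\<phi>. field_cov M T (sph_point \<theta>1 \<phi>) (sph_point \<theta>2 (\<phi>2 + s))) has_real_derivative D1) (at (\<phi>1 + s))"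
        "((\<lambda>\<phi>. field_cov M T (sph_point \<theta>1 (\<phi>1 + s)) (sph_point \<theta>2 \<phi>)) has_real_derivative D2) (at (\<phi>2 + s))"
        "((\<lambda>t. field_cov M T (sph_point \<theta>1 (\<phi>1 + s + t)) (sph_point \<theta>2 (\<phi>2 + s + t))) has_real_derivative D1 + D2) (at 0)"
        using differentiable_cov_longitude_derivatives[OF diff \<theta>] by blast
      have "D1 = - D2"
        using P \<theta> DERIV_imp_deriv[OF D(1)] DERIV_imp_deriv[OF D(2)] by metis
      then have "((\<lambda>t. ?H (t + s)) has_real_derivative 0) (at 0)"
        using D(3) by (simp add: add_ac)
      then show ?thesis using DERIV_shift[of ?H 0 0 s] by simp
    qed
    then have "?H \<alpha> = ?H 0" by (intro DERIV_isconst_all) blast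
    then show "?H \<alpha> = field_cov M T (sph_point \<theta>1 \<phi>1) (sph_point \<theta>2 \<phi>2)" by simp
  qed
qed

theorem proposition5:
  fixes M :: "'a measure" and T :: "real^3 \<Rightarrow> 'a \<Rightarrow> real"
  assumes "spherical_random_field M T"
  shows
    "(axially_symmetric M T \<longleftrightarrow>
        isotropic M T \<or> diagonal_anisotropic M T \<or> degree_dependent_anisotropic M T) \<and>
     \<not> (isotropic M T \<and> diagonal_anisotropic M T) \<and>
     \<not> (isotropic M T \<and> degree_dependent_anisotropic M T) \<and>
     \<not> (diagonal_anisotropic M T \<and> degree_dependent_anisotropic M T) \<and>
     (axially_symmetric M T \<longrightarrow>
        point_of_isotropy M T north_pole \<and> point_of_isotropy M T south_pole) \<and>
     (axially_symmetric M T \<longleftrightarrow> (\<exists>c. order_diagonal_spectrum M T c)) \<and>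
     (axially_symmetric M T \<longleftrightarrow> (\<exists>c. axial_representation M T c)) \<and>
     (\<forall>c. order_diagonal_spectrum M T c \<longrightarrow> axial_representation M T c) \<and>
     (differentiable_cov M T \<longrightarrow>
        (axially_symmetric M T \<longleftrightarrow>
          (\<forall>\<theta>1\<in>{0..pi}. \<forall>\<phi>1. \<forall>\<theta>2\<in>{0..pi}. \<forall>\<phi>2.
             deriv (\<lambda>\<phi>. field_cov M T (sph_point \<theta>1 \<phi>) (sph_point \<theta>2 \<phi>2)) \<phi>1 =
             - deriv (\<lambda>\<phi>. field_cov M T (sph_point \<theta>1 \<phi>1) (sph_point \<theta>2 \<phi>)) \<phi>2)))"
proof -
  interpret spherical_random_field M T by fact
  \<comment> \<open>The next three facts close a cycle from symmetry through the diagonal spectrum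
    and the series representation back to symmetry, with the same \<open>c\<close> in the middle
    implication.\<close>
  have spectrum: "\<exists>c. order_diagonal_spectrum M T c" if "axially_symmetric M T"
    using axially_symmetric_imp_order_diagonal[OF that] by blast
  have representation: "axial_representation M T c" if "order_diagonal_spectrum M T c" for c
    by (rule order_diagonal_imp_axial_representation[OF that])
  have symmetric: "axially_symmetric M T" if "axial_representation M T c" for c
    by (rule axial_representation_imp_axially_symmetric[OF that])
  have diagonal: "\<exists>c. order_diagonal_spectrum M T c" if "diagonal_anisotropic M T"
  proof -
    from that obtain c where "\<forall>l l' m m'. \<bar>m\<bar> \<le> int l \<and> \<bar>m'\<bar> \<le> int l' \<longrightarrow>
        spectral_coeff M T l l' m m' = (if l = l' \<and> m = m' then c l m else 0)"
      unfolding diagonal_anisotropic_def by blast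
    then have "order_diagonal_spectrum M T (\<lambda>l l' m. if l = l' then c l m else 0)"
      unfolding order_diagonal_spectrum_def by simp
    then show ?thesis by blast
  qed
  have "axially_symmetric M T \<longleftrightarrow>
      isotropic M T \<or> diagonal_anisotropic M T \<or> degree_dependent_anisotropic M T"
    using spectrum representation symmetric diagonal order_diagonal_classification
      isotropic_imp_axially_symmetric degree_dependent_anisotropic_def by metis
  moreover have "axially_symmetric M T \<longleftrightarrow> (\<exists>c. order_diagonal_spectrum M T c)"
    using spectrum representation symmetric by blast
  moreover have "axially_symmetric M T \<longleftrightarrow> (\<exists>c. axial_representation M T c)"
    using spectrum representation symmetric by blast
  ultimately show ?thesis
    using isotropic_not_diagonal_anisotropic isotropic_not_degree_dependent diagonal_not_degree_dependent
      axially_symmetric_points_of_isotropy representation axially_symmetric_iff_longitude_derivatives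
    by (intro conjI) blast+
qed

end
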